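(* Let $(A\xrightarrow{\psi_n}F_n\xrightarrow{\varphi_n}A)_n$ be a summable system of c.p.c. approximations of a separable $C^*$-algebra $A$. Then the associated c.p.c. system $(F_n,\rho_{n+1,n})_n$, $\rho_{n+1,n}=\psi_{n+1}\circ\varphi_n$, is $C^*$-encoding. Moreover, writing $L\subset F_\infty$ for its limit, $C^*_\bullet(L)$ for its $C^*$-limit, $\Psi\colon A\to F_\infty$ for the map $\Psi(a)=[(\psi_n(a))_n]$, and $\Theta=\mathrm{id}_L\colon C^*_\bullet(L)\to F_\infty$ for the identity map of $L$, the map $\Theta^{-1}\circ\Psi\colon A\to C^*_{\bullet}(L)$ is a $*$-isomorphism between $A$ and the $C^*$-limit $C^*_\bullet(L)$ of the system.
   Context: A map is c.p.c. if it is completely positive and contractive. A system of c.p.c. approximations $(A\xrightarrow{\psi_n}F_n\xrightarrow{\varphi_n}A)_n$ of a separable $C^*$-algebra $A$ consists of finite-dimensional $C^*$-algebras $F_n$ ($n\ge 0$) and c.p.c. maps $\psi_n\colon A\to F_n$, $\varphi_n\colon F_n\to A$ with $\lim_n\|\varphi_n(\psi_n(a))-a\|=0$ for all $a\in A$. It is summable if there is a decreasing sequence $(\varepsilon_m)_m$ of non-negative reals with $\sum_m\varepsilon_m\le 1$ such that $\|\varphi_n-\varphi_m\circ\psi_m\circ\varphi_n\|<\varepsilon_m$ for all $m>n\ge0$. For a sequence $(F_n)_{n\ge 0}$ of $C^*$-algebras, $\prod_n F_n$ denotes the $C^*$-algebra of norm bounded sequences, $\bigoplus_n F_n$ its ideal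 of sequences converging to $0$ in norm, $F_\infty=\prod_n F_n/\bigoplus_n F_n$, and $[(a_n)_n]$ the class of $(a_n)_n$. A c.p.c. system $(F_n,\rho_{n+1,n})_n$ consists of $C^*$-algebras $(F_n)_{n\ge0}$ and c.p.c. maps $\rho_{n+1,n}\colon F_n\to F_{n+1}$. For $m>n$ set $\rho_{m,n}=\rho_{m,m-1}\circ\cdots\circ\rho_{n+1,n}$ and $\rho_{n,n}=\mathrm{id}_{F_n}$. Define $\rho_n\colon F_n\to F_\infty$ by $\rho_n(x)=[(\rho_{m,n}(x))_{m>n}]$. The limit of the system is the closed self-adjoint subspace $L=\overline{\bigcup_n\rho_n(F_n)}\subset F_\infty$. A c.p.c. system is $C^*$-encoding if for any $k\ge0$, $x,y\in F_k$ and $\varepsilon>0$ there is $M>k$ such that for all $m>n,j>M$ (that is, $n,j>M$ and $m>\max\{n,j\}$), $$\|\rho_{m,n}(\rho_{n,k}(x)\rho_{n,k}(y))-\rho_{m,j}(\rho_{j,k}(x)\rho_{j,k}(y))\|<\varepsilon .$$ The $C^*$-limit of a $C^*$-encoding system is the $C^*$-algebra $C^*_{\bullet}(L)$ obtained by equipping $L$ with the norm and involution inherited from $F_\infty$ and with the (bounded, associative, bilinear) product $\bullet\colon L\times L\to L$ determined on the dense subspace $\bigcup_n\rho_n(F_n)$ by $\rho_k(x)\bullet\rho_k(y)=\lim_n\rho_n(\rho_{n,k}(x)\rho_{n,k}(y))$ for $k\ge0$, $x,y\in F_k$. *)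

theory Defs
  imports "HOL-Analysis.Analysis" "HOL-Algebra.Module" "HOL-Algebra.QuotRing"
begin

section \<open>C*-algebras with explicit carriers\<close>

text \<open>C*-algebras need not be unital. The field \<open>one\<close>, inherited from the record \<open>ring\<close>
  so that the additive and module theory of HOL-Algebra applies, carries no meaning below.\<close>

record 'a cstar = "(complex, 'a) module" +
  adj :: "'a \<Rightarrow> 'a" (\<open>_\<^sup>\<star>\<index>\<close> [1000] 999)
  nrm :: "'a \<Rightarrow> real" (\<open>\<parallel>_\<parallel>\<index>\<close> [0] 1000)

definition complex_ring :: "complex ring" where
  "complex_ring = \<lparr>carrier = UNIV, mult = (*), one = 1, zero = 0, add = (+)\<rparr>"

lemma cring_complex_ring: "cring complex_ring"
proof (rule cringI)
  show "abelian_group complex_ring"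
    by (rule abelian_groupI)
      (auto simp: complex_ring_def intro: exI[of _ "- x" for x])
  show "comm_monoid complex_ring"
    by (rule comm_monoidI) (auto simp: complex_ring_def)
qed (auto simp: complex_ring_def algebra_simps)

text \<open>The locale \<^locale>\<open>Metric_space\<close> asks for non-negativity and symmetry also off the carrier.\<close>

definition cdist :: "('a, 'm) cstar_scheme \<Rightarrow> 'a \<Rightarrow> 'a \<Rightarrow> real" where
  "cdist A x y =
     (if x \<in> carrier A \<and> y \<in> carrier A then \<parallel>x \<ominus>\<^bsub>A\<^esub> y\<parallel>\<^bsub>A\<^esub> else 0)"

definition norm_topology :: "('a, 'm) cstar_scheme \<Rightarrow> 'a topology" where
  "norm_topology A = Metric_space.mtopology (carrier A) (cdist A)"

locale cstar_algebra = module complex_ring A for A (structure) +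
  assumes mult_closed: "\<lbrakk>x \<in> carrier A; y \<in> carrier A\<rbrakk> \<Longrightarrow> x \<otimes> y \<in> carrier A"
    and mult_assoc: "\<lbrakk>x \<in> carrier A; y \<in> carrier A; z \<in> carrier A\<rbrakk>
      \<Longrightarrow> (x \<otimes> y) \<otimes> z = x \<otimes> (y \<otimes> z)"
    and mult_add_left: "\<lbrakk>x \<in> carrier A; y \<in> carrier A; z \<in> carrier A\<rbrakk>
      \<Longrightarrow> (x \<oplus> y) \<otimes> z = x \<otimes> z \<oplus> y \<otimes> z"
    and mult_add_right: "\<lbrakk>x \<in> carrier A; y \<in> carrier A; z \<in> carrier A\<rbrakk>
      \<Longrightarrow> z \<otimes> (x \<oplus> y) = z \<otimes> x \<oplus> z \<otimes> y"
    and mult_smult_left: "\<lbrakk>x \<in> carrier A; y \<in> carrier A\<rbrakk>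
      \<Longrightarrow> (c \<odot> x) \<otimes> y = c \<odot> (x \<otimes> y)"
    and mult_smult_right: "\<lbrakk>x \<in> carrier A; y \<in> carrier A\<rbrakk>
      \<Longrightarrow> x \<otimes> (c \<odot> y) = c \<odot> (x \<otimes> y)"
    and adj_closed: "x \<in> carrier A \<Longrightarrow> x\<^sup>\<star> \<in> carrier A"
    and adj_adj: "x \<in> carrier A \<Longrightarrow> (x\<^sup>\<star>)\<^sup>\<star> = x"
    and adj_add: "\<lbrakk>x \<in> carrier A; y \<in> carrier A\<rbrakk> \<Longrightarrow> (x \<oplus> y)\<^sup>\<star> = x\<^sup>\<star> \<oplus> y\<^sup>\<star>"
    and adj_smult: "x \<in> carrier A \<Longrightarrow> (c \<odot> x)\<^sup>\<star> = cnj c \<odot> x\<^sup>\<star>"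
    and adj_mult: "\<lbrakk>x \<in> carrier A; y \<in> carrier A\<rbrakk> \<Longrightarrow> (x \<otimes> y)\<^sup>\<star> = y\<^sup>\<star> \<otimes> x\<^sup>\<star>"
    and nrm_nonneg: "x \<in> carrier A \<Longrightarrow> 0 \<le> \<parallel>x\<parallel>"
    and nrm_eq_0: "x \<in> carrier A \<Longrightarrow> \<parallel>x\<parallel> = 0 \<longleftrightarrow> x = \<zero>"
    and nrm_triangle: "\<lbrakk>x \<in> carrier A; y \<in> carrier A\<rbrakk> \<Longrightarrow> \<parallel>x \<oplus> y\<parallel> \<le> \<parallel>x\<parallel> + \<parallel>y\<parallel>"
    and nrm_smult: "x \<in> carrier A \<Longrightarrow> \<parallel>c \<odot> x\<parallel> = cmod c * \<parallel>x\<parallel>"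
    and nrm_mult: "\<lbrakk>x \<in> carrier A; y \<in> carrier A\<rbrakk> \<Longrightarrow> \<parallel>x \<otimes> y\<parallel> \<le> \<parallel>x\<parallel> * \<parallel>y\<parallel>"
    and cstar_identity: "x \<in> carrier A \<Longrightarrow> \<parallel>x\<^sup>\<star> \<otimes> x\<parallel> = \<parallel>x\<parallel>\<^sup>2"
    and complete: "Metric_space.mcomplete (carrier A) (cdist A)"

lemma (in cstar_algebra) nrm_a_inv:
  assumes "x \<in> carrier A"
  shows "\<parallel>\<ominus> x\<parallel> = \<parallel>x\<parallel>"
proof -
  have "(- 1) \<odot> x \<oplus> x = (- 1) \<odot> x \<oplus> 1 \<odot> x"
    using assms smult_one[of x] by (simp add: complex_ring_def)
  also have "\<dots> = (- 1 \<oplus>\<^bsub>complex_ring\<^esub> 1) \<odot> x"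
    using assms smult_l_distr[of "- 1" 1 x] by (simp add: complex_ring_def)
  also have "\<dots> = \<zero>"
    using assms smult_l_null by (simp add: complex_ring_def)
  finally have "\<ominus> x = (- 1) \<odot> x"
    using assms smult_closed[of "- 1" x] by (intro minus_equality) (auto simp: complex_ring_def)
  then show ?thesis
    using nrm_smult[OF assms, of "- 1"] by simp
qed

lemma (in cstar_algebra) Metric_space_cdist: "Metric_space (carrier A) (cdist A)"
proof
  fix x y z
  show "0 \<le> cdist A x y"
    by (simp add: cdist_def nrm_nonneg)
  show "cdist A x y = cdist A y x"
  proof (cases "x \<in> carrier A \<and> y \<in> carrier A")
    case True
    then have "\<ominus> (x \<ominus> y) = y \<ominus> x"
      by (simp add: a_minus_def minus_add a_comm)
    then show ?thesis
      using True nrm_a_inv[of "x \<ominus> y"] by (simp add: cdist_def)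
  qed (auto simp: cdist_def)
  assume x: "x \<in> carrier A" and y: "y \<in> carrier A"
  show "cdist A x y = 0 \<longleftrightarrow> x = y"
    using x y by (auto simp: cdist_def nrm_eq_0 r_neg a_minus_def
        dest: minus_equality[of x "\<ominus> y"])
  assume z: "z \<in> carrier A"
  have "x \<ominus> z = (x \<ominus> y) \<oplus> (y \<ominus> z)"
    using x y z by (simp add: a_minus_def a_assoc r_neg1)
  then show "cdist A x z \<le> cdist A x y + cdist A y z"
    using x y z by (simp add: cdist_def nrm_triangle)
qed

definition separable_cstar :: "('a, 'm) cstar_scheme \<Rightarrow> bool" where
  "separable_cstar A \<longleftrightarrow> cstar_algebra A \<and> separable_space (norm_topology A)"

definition finite_dim_cstar :: "('a, 'm) cstar_scheme \<Rightarrow> bool" where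
  "finite_dim_cstar A \<longleftrightarrow> cstar_algebra A \<and>
     (\<exists>B. finite B \<and> B \<subseteq> carrier A \<and>
        (\<forall>x\<in>carrier A. \<exists>c. x = (\<Oplus>\<^bsub>A\<^esub>b\<in>B. c b \<odot>\<^bsub>A\<^esub> b)))"

section \<open>Completely positive contractive maps\<close>

definition linear_map ::
    "('a, 'm) cstar_scheme \<Rightarrow> ('b, 'n) cstar_scheme \<Rightarrow> ('a \<Rightarrow> 'b) \<Rightarrow> bool" where
  "linear_map A B f \<longleftrightarrow> f \<in> carrier A \<rightarrow> carrier B \<and>
     (\<forall>x\<in>carrier A. \<forall>y\<in>carrier A. f (x \<oplus>\<^bsub>A\<^esub> y) = f x \<oplus>\<^bsub>B\<^esub> f y) \<and>
     (\<forall>c. \<forall>x\<in>carrier A. f (c \<odot>\<^bsub>A\<^esub> x) = c \<odot>\<^bsub>B\<^esub> f x)"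

text \<open>The underlying *-algebra of \<open>M\<^sub>n(A)\<close>: a matrix is a function on index pairs below \<open>n\<close>,
  \<open>undefined\<close> elsewhere.\<close>

definition matrices :: "nat \<Rightarrow> ('a, 'm) cstar_scheme \<Rightarrow> (nat \<times> nat \<Rightarrow> 'a) set" where
  "matrices n A = ({..<n} \<times> {..<n} \<rightarrow>\<^sub>E carrier A)"

definition mat_mult :: "nat \<Rightarrow> ('a, 'm) cstar_scheme
    \<Rightarrow> (nat \<times> nat \<Rightarrow> 'a) \<Rightarrow> (nat \<times> nat \<Rightarrow> 'a) \<Rightarrow> (nat \<times> nat \<Rightarrow> 'a)" where
  "mat_mult n A X Y =
     (\<lambda>(i, j)\<in>{..<n} \<times> {..<n}. \<Oplus>\<^bsub>A\<^esub>k\<in>{..<n}. X (i, k) \<otimes>\<^bsub>A\<^esub> Y (k, j))"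

definition mat_adj :: "nat \<Rightarrow> ('a, 'm) cstar_scheme
    \<Rightarrow> (nat \<times> nat \<Rightarrow> 'a) \<Rightarrow> (nat \<times> nat \<Rightarrow> 'a)" where
  "mat_adj n A X = (\<lambda>(i, j)\<in>{..<n} \<times> {..<n}. (X (j, i))\<^sup>\<star>\<^bsub>A\<^esub>)"

definition positive_matrix ::
    "nat \<Rightarrow> ('a, 'm) cstar_scheme \<Rightarrow> (nat \<times> nat \<Rightarrow> 'a) \<Rightarrow> bool" where
  "positive_matrix n A X \<longleftrightarrow> (\<exists>Y\<in>matrices n A. X = mat_mult n A (mat_adj n A Y) Y)"

definition amplification ::
    "nat \<Rightarrow> ('a \<Rightarrow> 'b) \<Rightarrow> (nat \<times> nat \<Rightarrow> 'a) \<Rightarrow> (nat \<times> nat \<Rightarrow> 'b)" where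
  "amplification n f X = (\<lambda>p\<in>{..<n} \<times> {..<n}. f (X p))"

definition completely_positive ::
    "('a, 'm) cstar_scheme \<Rightarrow> ('b, 'n) cstar_scheme \<Rightarrow> ('a \<Rightarrow> 'b) \<Rightarrow> bool" where
  "completely_positive A B f \<longleftrightarrow> linear_map A B f \<and>
     (\<forall>n X. positive_matrix n A X \<longrightarrow> positive_matrix n B (amplification n f X))"

definition cpc :: "('a, 'm) cstar_scheme \<Rightarrow> ('b, 'n) cstar_scheme \<Rightarrow> ('a \<Rightarrow> 'b) \<Rightarrow> bool" where
  "cpc A B f \<longleftrightarrow> completely_positive A B f \<and> (\<forall>x\<in>carrier A. \<parallel>f x\<parallel>\<^bsub>B\<^esub> \<le> \<parallel>x\<parallel>\<^bsub>A\<^esub>)"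

definition operator_norm ::
    "('a, 'm) cstar_scheme \<Rightarrow> ('b, 'n) cstar_scheme \<Rightarrow> ('a \<Rightarrow> 'b) \<Rightarrow> real" where
  "operator_norm A B T = (SUP x\<in>{x \<in> carrier A. \<parallel>x\<parallel>\<^bsub>A\<^esub> \<le> 1}. \<parallel>T x\<parallel>\<^bsub>B\<^esub>)"

definition star_isomorphism ::
    "('a, 'm) cstar_scheme \<Rightarrow> ('b, 'n) cstar_scheme \<Rightarrow> ('a \<Rightarrow> 'b) \<Rightarrow> bool" where
  "star_isomorphism A B f \<longleftrightarrow> linear_map A B f \<and>
     (\<forall>x\<in>carrier A. \<forall>y\<in>carrier A. f (x \<otimes>\<^bsub>A\<^esub> y) = f x \<otimes>\<^bsub>B\<^esub> f y) \<and>
     (\<forall>x\<in>carrier A. f (x\<^sup>\<star>\<^bsub>A\<^esub>) = (f x)\<^sup>\<star>\<^bsub>B\<^esub>) \<and>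
     bij_betw f (carrier A) (carrier B)"

section \<open>Systems of c.p.c. approximations\<close>

text \<open>The algebras \<open>F n\<close> are arbitrary; only their carriers live in a common type.\<close>

locale cpc_approximations =
  fixes A :: "'a cstar" and F :: "nat \<Rightarrow> 'b cstar"
    and \<psi> :: "nat \<Rightarrow> 'a \<Rightarrow> 'b" and \<phi> :: "nat \<Rightarrow> 'b \<Rightarrow> 'a"
  assumes separable: "separable_cstar A"
    and finite_dim: "\<And>n. finite_dim_cstar (F n)"
    and cpc_down: "\<And>n. cpc A (F n) (\<psi> n)"
    and cpc_up: "\<And>n. cpc (F n) A (\<phi> n)"
    and approx: "\<And>a. a \<in> carrier A \<Longrightarrow> (\<lambda>n. \<parallel>\<phi> n (\<psi> n a) \<ominus>\<^bsub>A\<^esub> a\<parallel>\<^bsub>A\<^esub>) \<longlonglongrightarrow> 0"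

locale summable_cpc_approximations = cpc_approximations +
  assumes summable_approx:
    "\<exists>\<epsilon>. decseq \<epsilon> \<and> (\<forall>m. 0 \<le> \<epsilon> m) \<and> summable \<epsilon> \<and> (\<Sum>m. \<epsilon> m) \<le> 1 \<and>
       (\<forall>n m. n < m \<longrightarrow>
          operator_norm (F n) A (\<lambda>x. \<phi> n x \<ominus>\<^bsub>A\<^esub> \<phi> m (\<psi> m (\<phi> n x))) < \<epsilon> m)"

section \<open>Sequence algebras\<close>

definition cstar_prod :: "(nat \<Rightarrow> 'b cstar) \<Rightarrow> (nat \<Rightarrow> 'b) cstar" where
  "cstar_prod F =
     \<lparr>carrier = {a. (\<forall>n. a n \<in> carrier (F n)) \<and> (\<exists>K. \<forall>n. \<parallel>a n\<parallel>\<^bsub>F n\<^esub> \<le> K)},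
      mult = (\<lambda>a b n. a n \<otimes>\<^bsub>F n\<^esub> b n),
      one = (\<lambda>n. \<one>\<^bsub>F n\<^esub>),
      zero = (\<lambda>n. \<zero>\<^bsub>F n\<^esub>),
      add = (\<lambda>a b n. a n \<oplus>\<^bsub>F n\<^esub> b n),
      smult = (\<lambda>c a n. c \<odot>\<^bsub>F n\<^esub> a n),
      adj = (\<lambda>a n. (a n)\<^sup>\<star>\<^bsub>F n\<^esub>),
      nrm = (\<lambda>a. SUP n. \<parallel>a n\<parallel>\<^bsub>F n\<^esub>)\<rparr>"

definition null_sequences :: "(nat \<Rightarrow> 'b cstar) \<Rightarrow> (nat \<Rightarrow> 'b) set" where
  "null_sequences F = {a \<in> carrier (cstar_prod F). (\<lambda>n. \<parallel>a n\<parallel>\<^bsub>F n\<^esub>) \<longlonglongrightarrow> 0}"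

text \<open>The quotient by a closed two-sided ideal, with the quotient norm. As for \<^const>\<open>rcoset_mult\<close>,
  the operations on cosets are unions over all representatives.\<close>

definition cstar_quotient :: "'a cstar \<Rightarrow> 'a set \<Rightarrow> 'a set cstar" where
  "cstar_quotient A I =
     \<lparr>carrier = carrier (A Quot I),
      mult = mult (A Quot I),
      one = one (A Quot I),
      zero = zero (A Quot I),
      add = add (A Quot I),
      smult = (\<lambda>c X. \<Union>a\<in>X. I +>\<^bsub>A\<^esub> (c \<odot>\<^bsub>A\<^esub> a)),
      adj = (\<lambda>X. \<Union>a\<in>X. I +>\<^bsub>A\<^esub> a\<^sup>\<star>\<^bsub>A\<^esub>),
      nrm = (\<lambda>X. INF a\<in>X. \<parallel>a\<parallel>\<^bsub>A\<^esub>)\<rparr>"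

definition F_infinity :: "(nat \<Rightarrow> 'b cstar) \<Rightarrow> (nat \<Rightarrow> 'b) set cstar" where
  "F_infinity F = cstar_quotient (cstar_prod F) (null_sequences F)"

definition seq_class :: "(nat \<Rightarrow> 'b cstar) \<Rightarrow> (nat \<Rightarrow> 'b) \<Rightarrow> (nat \<Rightarrow> 'b) set" where
  "seq_class F a = null_sequences F +>\<^bsub>cstar_prod F\<^esub> a"

section \<open>C.p.c. systems and their limits\<close>

text \<open>\<open>\<rho> n\<close> stands for \<open>\<rho>\<^bsub>n+1,n\<^esub>\<close>.\<close>

locale cpc_system =
  fixes F :: "nat \<Rightarrow> 'b cstar" and \<rho> :: "nat \<Rightarrow> 'b \<Rightarrow> 'b"
  assumes cstar: "\<And>n. cstar_algebra (F n)"
    and cpc_step: "\<And>n. cpc (F n) (F (Suc n)) (\<rho> n)"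

text \<open>\<open>connecting \<rho> m n\<close> is \<open>\<rho>\<^bsub>m,n\<^esub>\<close> for \<open>m \<ge> n\<close>; it is only used in that range.\<close>

primrec connecting :: "(nat \<Rightarrow> 'b \<Rightarrow> 'b) \<Rightarrow> nat \<Rightarrow> nat \<Rightarrow> 'b \<Rightarrow> 'b" where
  "connecting \<rho> 0 n = id"
| "connecting \<rho> (Suc m) n = (if n \<le> m then \<rho> m \<circ> connecting \<rho> m n else id)"

text \<open>The class does not depend on the entries with index \<open>m \<le> n\<close>, which are filled with \<open>0\<close>.\<close>

definition limit_map ::
    "(nat \<Rightarrow> 'b cstar) \<Rightarrow> (nat \<Rightarrow> 'b \<Rightarrow> 'b) \<Rightarrow> nat \<Rightarrow> 'b \<Rightarrow> (nat \<Rightarrow> 'b) set" where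
  "limit_map F \<rho> n x = seq_class F (\<lambda>m. if n < m then connecting \<rho> m n x else \<zero>\<^bsub>F m\<^esub>)"

definition system_limit ::
    "(nat \<Rightarrow> 'b cstar) \<Rightarrow> (nat \<Rightarrow> 'b \<Rightarrow> 'b) \<Rightarrow> (nat \<Rightarrow> 'b) set set" where
  "system_limit F \<rho> =
     Abstract_Topology.closure_of (norm_topology (F_infinity F))
       (\<Union>n. limit_map F \<rho> n ` carrier (F n))"

locale cstar_encoding_system = cpc_system +
  assumes encoding: "\<lbrakk>x \<in> carrier (F k); y \<in> carrier (F k); 0 < (\<epsilon>::real)\<rbrakk> \<Longrightarrow>
    \<exists>M>k. \<forall>m n j. M < n \<and> M < j \<and> max n j < m \<longrightarrow>
      \<parallel>connecting \<rho> m n (connecting \<rho> n k x \<otimes>\<^bsub>F n\<^esub> connecting \<rho> n k y) \<ominus>\<^bsub>F m\<^esub>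
       connecting \<rho> m j (connecting \<rho> j k x \<otimes>\<^bsub>F j\<^esub> connecting \<rho> j k y)\<parallel>\<^bsub>F m\<^esub> < \<epsilon>"

text \<open>The bounded, associative, bilinear products on the limit that are given by the defining
  formula on the dense subspace.\<close>

definition is_limit_product :: "(nat \<Rightarrow> 'b cstar) \<Rightarrow> (nat \<Rightarrow> 'b \<Rightarrow> 'b)
    \<Rightarrow> ((nat \<Rightarrow> 'b) set \<Rightarrow> (nat \<Rightarrow> 'b) set \<Rightarrow> (nat \<Rightarrow> 'b) set) \<Rightarrow> bool" where
  "is_limit_product F \<rho> p \<longleftrightarrow> (let L = system_limit F \<rho>; Q = F_infinity F in
     (\<forall>X\<in>L. \<forall>Y\<in>L. p X Y \<in> L) \<and>
     (\<forall>X\<in>L. \<forall>Y\<in>L. \<forall>Z\<in>L. p (X \<oplus>\<^bsub>Q\<^esub> Y) Z = p X Z \<oplus>\<^bsub>Q\<^esub> p Y Z) \<and>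
     (\<forall>X\<in>L. \<forall>Y\<in>L. \<forall>Z\<in>L. p X (Y \<oplus>\<^bsub>Q\<^esub> Z) = p X Y \<oplus>\<^bsub>Q\<^esub> p X Z) \<and>
     (\<forall>c. \<forall>X\<in>L. \<forall>Y\<in>L. p (c \<odot>\<^bsub>Q\<^esub> X) Y = c \<odot>\<^bsub>Q\<^esub> p X Y) \<and>
     (\<forall>c. \<forall>X\<in>L. \<forall>Y\<in>L. p X (c \<odot>\<^bsub>Q\<^esub> Y) = c \<odot>\<^bsub>Q\<^esub> p X Y) \<and>
     (\<exists>K. \<forall>X\<in>L. \<forall>Y\<in>L. \<parallel>p X Y\<parallel>\<^bsub>Q\<^esub> \<le> K * \<parallel>X\<parallel>\<^bsub>Q\<^esub> * \<parallel>Y\<parallel>\<^bsub>Q\<^esub>) \<and>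
     (\<forall>X\<in>L. \<forall>Y\<in>L. \<forall>Z\<in>L. p (p X Y) Z = p X (p Y Z)) \<and>
     (\<forall>k. \<forall>x\<in>carrier (F k). \<forall>y\<in>carrier (F k).
        limitin (norm_topology Q)
          (\<lambda>n. limit_map F \<rho> n (connecting \<rho> n k x \<otimes>\<^bsub>F n\<^esub> connecting \<rho> n k y))
          (p (limit_map F \<rho> k x) (limit_map F \<rho> k y)) sequentially))"

text \<open>On \<open>L \<times> L\<close> the product is determined by boundedness and density; the choice below only
  affects arguments outside \<open>L\<close>.\<close>

definition limit_product :: "(nat \<Rightarrow> 'b cstar) \<Rightarrow> (nat \<Rightarrow> 'b \<Rightarrow> 'b)
    \<Rightarrow> (nat \<Rightarrow> 'b) set \<Rightarrow> (nat \<Rightarrow> 'b) set \<Rightarrow> (nat \<Rightarrow> 'b) set" where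
  "limit_product F \<rho> = (SOME p. is_limit_product F \<rho> p)"

definition cstar_limit ::
    "(nat \<Rightarrow> 'b cstar) \<Rightarrow> (nat \<Rightarrow> 'b \<Rightarrow> 'b) \<Rightarrow> (nat \<Rightarrow> 'b) set cstar" where
  "cstar_limit F \<rho> =
     (F_infinity F)\<lparr>carrier := system_limit F \<rho>, mult := limit_product F \<rho>\<rparr>"

end

theory Submission
  imports Defs
begin

text \<open>By the Kadison--Schwarz inequality, \<open>\<phi>\<^sub>n(\<psi>\<^sub>n(a)\<^sup>* \<psi>\<^sub>n(a))\<close> lies between
  \<open>\<phi>\<^sub>n(\<psi>\<^sub>n(a))\<^sup>* \<phi>\<^sub>n(\<psi>\<^sub>n(a))\<close> and \<open>\<phi>\<^sub>n(\<psi>\<^sub>n(a\<^sup>* a))\<close>, so it converges to \<open>a\<^sup>* a\<close>, and by polarisation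
  \<open>\<phi>\<^sub>n(\<psi>\<^sub>n(a) \<psi>\<^sub>n(b))\<close> converges to \<open>a b\<close>. Summability makes \<open>\<phi>\<^sub>m(\<rho>\<^sub>m\<^sub>,\<^sub>n(x))\<close> a Cauchy sequence in \<open>m\<close>; if \<open>a\<close> is its
  limit, then \<open>\<rho>\<^sub>n(x) = \<Psi>(a)\<close>. Hence the isometry \<open>\<Psi>\<close> maps \<open>A\<close> onto \<open>L\<close>, and \<open>\<bullet>\<close> is the transported
  product of \<open>A\<close>. The positivity theory of C*-algebras behind the Kadison--Schwarz inequality rests on
  square roots obtained by iteration, without spectra or states.\<close>

section \<open>Positivity in C*-seminormed algebras\<close>

text \<open>Positivity consists of long identities in a unital ring, but the C*-algebras here are
  records with carriers, possibly without unit, and a type cannot depend on such a record. So the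
  positivity theory is carried out on a type of class \<open>real_algebra_1\<close>. For each
  element type there is one such type, the product of the unitizations of all C*-algebras on it, and
  a single C*-algebra is seen through the seminorm of its own factor. Positivity of a self-adjoint
  \<open>h\<close> is the condition \<open>N (t *\<^sub>R 1 - h) \<le> t\<close> for some
  \<open>t\<close>, which says that the spectrum lies in [0, 2t]. Sums and positive multiples are
  then immediate, whereas positivity of \<open>s * s\<close> and \<open>st y * y\<close> becomes the
  real work. Complete positivity is applied to 2 by 2 matrices built from a row
  \<open>(x, e)\<close>; this gives a Cauchy--Schwarz inequality in which an approximate unit
  \<open>e\<close> stands in for the missing 1. The product of the C*-limit is a choice, so it has
  to be shown both that the transported product qualifies and that every other candidate agrees with
  it on the limit.\<close>

text \<open>\<open>st\<close> is the involution and \<open>j\<close> the imaginary unit. As \<open>N\<close> is only a seminorm, equality is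
  mostly replaced by the relation \<open>\<doteq>\<close> of being at distance \<open>0\<close>.\<close>

locale cstar_seminorm =
  fixes N :: "'c::real_algebra_1 \<Rightarrow> real" and st :: "'c \<Rightarrow> 'c" and j :: 'c
  assumes N_add: "N (x + y) \<le> N x + N y"
    and N_scaleR: "N (r *\<^sub>R x) = \<bar>r\<bar> * N x"
    and N_mult: "N (x * y) \<le> N x * N y"
    and N_one: "N 1 \<le> 1"
    and N_star_mult: "N (st x * x) = (N x)\<^sup>2"
    and st_add: "st (x + y) = st x + st y"
    and st_mult: "st (x * y) = st y * st x"
    and st_st [simp]: "st (st x) = x"
    and st_scaleR: "st (r *\<^sub>R x) = r *\<^sub>R st x"
    and st_j: "st j = - j"
    and j_central: "j * x = x * j"
    and j_square: "j * j = - 1"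
    and N_complete: "\<lbrakk>\<And>e. e > 0 \<Longrightarrow> \<exists>M. \<forall>m\<ge>M. \<forall>n\<ge>M. N (X m - X n) < e\<rbrakk>
      \<Longrightarrow> \<exists>L. (\<lambda>n. N (X n - L)) \<longlonglongrightarrow> 0"
begin

section \<open>Elementary rules for the seminorm and the involution\<close>

lemma N_zero [simp]: "N 0 = 0"
  using N_scaleR[of 0 0] by simp

lemma N_half: "N ((1/2) *\<^sub>R x) = N x / 2"
  by (simp add: N_scaleR)

lemma N_minus [simp]: "N (- x) = N x"
  using N_scaleR[of "- 1" x] by simp

lemma N_minus_commute: "N (x - y) = N (y - x)"
  using N_minus[of "x - y"] by simp

lemma N_nonneg [simp]: "0 \<le> N x"
  using N_add[of x "- x"] by simp

lemma N_diff: "N (x - y) \<le> N x + N y"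
  using N_add[of x "- y"] by simp

lemma N_star [simp]: "N (st x) = N x"
proof -
  have *: "N x \<le> N (st x)" for x
  proof (cases "N x = 0")
    case False
    have "N x * N x \<le> N (st x) * N x"
      using N_star_mult[of x] N_mult[of "st x" x] by (simp add: power2_eq_square)
    then show ?thesis
      using False by (simp add: less_le)
  qed simp
  show ?thesis
    using *[of x] *[of "st x"] by simp
qed

lemma N_power: "N x \<le> 1 \<Longrightarrow> N (x ^ n) \<le> 1"
proof (induction n)
  case (Suc n)
  have "N (x * x ^ n) \<le> 1 * 1"
    by (rule order_trans[OF N_mult mult_mono]) (use Suc in auto)
  then show ?case by simp
qed (simp add: N_one)

lemma st_zero [simp]: "st 0 = 0"
  using st_scaleR[of 0 0] by simp

lemma st_minus: "st (- x) = - st x"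
  using st_scaleR[of "- 1" x] by simp

lemma st_diff: "st (x - y) = st x - st y"
  using st_add[of x "- y"] by (simp add: st_minus)

lemma st_one [simp]: "st 1 = 1"
  using st_mult[of "st 1" 1] by simp

definition eqv :: "'c \<Rightarrow> 'c \<Rightarrow> bool" (infix \<open>\<doteq>\<close> 50) where
  "x \<doteq> y \<longleftrightarrow> N (x - y) = 0"

lemma eqv_refl [simp]: "x \<doteq> x"
  by (simp add: eqv_def)

lemma eqv_sym: "x \<doteq> y \<Longrightarrow> y \<doteq> x"
  by (simp add: eqv_def N_minus_commute)

lemma eqvI: "N (x - y) \<le> 0 \<Longrightarrow> x \<doteq> y"
  using N_nonneg[of "x - y"] by (simp add: eqv_def)

lemma eqv_trans [trans]: "x \<doteq> y \<Longrightarrow> y \<doteq> z \<Longrightarrow> x \<doteq> z"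
  using N_add[of "x - y" "y - z"] by (intro eqvI) (simp add: eqv_def)

lemma eqv_add: "x \<doteq> y \<Longrightarrow> u \<doteq> v \<Longrightarrow> x + u \<doteq> y + v"
  using N_add[of "x - y" "u - v"] by (intro eqvI) (simp add: eqv_def algebra_simps)

lemma eqv_scaleR: "x \<doteq> y \<Longrightarrow> r *\<^sub>R x \<doteq> r *\<^sub>R y"
  by (simp add: eqv_def N_scaleR flip: scaleR_diff_right)

text \<open>\<open>pos\<close> demands \<open>st h = h\<close> exactly, while the product of two
  commuting self-adjoint elements is self-adjoint only up to \<doteq>. Averaging the two orders of
  the product repairs this.\<close>

lemma eqv_average:
  assumes "x \<doteq> y"
  shows "(1/2) *\<^sub>R (x + y) \<doteq> x" "(1/2) *\<^sub>R (x + y) \<doteq> y"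
  using eqv_scaleR[OF eqv_add[OF eqv_refl eqv_sym[OF assms]], of "1/2" x]
    eqv_scaleR[OF eqv_add[OF assms eqv_refl], of "1/2" y]
  by (simp_all only: scaleR_half_double)

lemma eqv_minus: "x \<doteq> y \<Longrightarrow> - x \<doteq> - y"
  using eqv_scaleR[of x y "- 1"] by simp

lemma eqv_diff: "x \<doteq> y \<Longrightarrow> u \<doteq> v \<Longrightarrow> x - u \<doteq> y - v"
  using eqv_add[of x y "- u" "- v"] by (simp add: eqv_minus)

lemma N_mult_diff: "N (x * u - y * v) \<le> N (x - y) * N u + N y * N (u - v)"
proof -
  have "x * u - y * v = (x - y) * u + y * (u - v)"
    by (simp add: algebra_simps)
  then have "N (x * u - y * v) = N ((x - y) * u + y * (u - v))"
    by simp
  then show ?thesis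
    using N_add[of "(x - y) * u" "y * (u - v)"] N_mult[of "x - y" u] N_mult[of y "u - v"] by linarith
qed

lemma eqv_mult: "x \<doteq> y \<Longrightarrow> u \<doteq> v \<Longrightarrow> x * u \<doteq> y * v"
  using N_mult_diff[of x u y v] by (intro eqvI) (simp add: eqv_def)

lemma eqv_st: "x \<doteq> y \<Longrightarrow> st x \<doteq> st y"
  by (simp add: eqv_def flip: st_diff)

lemma N_cong: "x \<doteq> y \<Longrightarrow> N x = N y"
  using N_add[of "x - y" y] N_add[of "y - x" x] by (simp add: eqv_def N_minus_commute)

section \<open>Convergence with respect to the seminorm\<close>

definition tends :: "(nat \<Rightarrow> 'c) \<Rightarrow> 'c \<Rightarrow> bool" where
  "tends X L \<longleftrightarrow> (\<lambda>n. N (X n - L)) \<longlonglongrightarrow> 0"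

lemma tends_const: "tends (\<lambda>n. x) x"
  by (simp add: tends_def)

lemma tends_bound: "tends X L" if "\<And>n. N (X n - L) \<le> f n" "f \<longlonglongrightarrow> 0"
  unfolding tends_def by (rule tendsto_sandwich[OF _ _ tendsto_const that(2)]) (use that in auto)

lemma tends_Suc: "tends X L \<Longrightarrow> tends (\<lambda>n. X (Suc n)) L"
  unfolding tends_def by (rule LIMSEQ_Suc)

lemma tends_scaleR: "tends X L \<Longrightarrow> tends (\<lambda>n. r *\<^sub>R X n) (r *\<^sub>R L)"
  unfolding tends_def by (simp add: N_scaleR tendsto_mult_right_zero flip: scaleR_diff_right)

lemma tends_add: "tends X L \<Longrightarrow> tends Y M \<Longrightarrow> tends (\<lambda>n. X n + Y n) (L + M)"
proof (rule tends_bound)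
  show "N (X n + Y n - (L + M)) \<le> N (X n - L) + N (Y n - M)" for n
    using N_add[of "X n - L" "Y n - M"] by (simp add: algebra_simps)
qed (simp add: tends_def tendsto_add_zero)

lemma tends_st: "tends X L \<Longrightarrow> tends (\<lambda>n. st (X n)) (st L)"
  by (simp add: tends_def flip: st_diff)

lemma tends_diff: "tends X L \<Longrightarrow> tends Y M \<Longrightarrow> tends (\<lambda>n. X n - Y n) (L - M)"
  using tends_add[OF _ tends_scaleR[of Y M "- 1"]] by simp

lemma N_diff_ge: "\<bar>N x - N y\<bar> \<le> N (x - y)"
proof -
  have "N x \<le> N (x - y) + N y" "N y \<le> N (y - x) + N x"
    using N_add[of "x - y" y] N_add[of "y - x" x] by simp_all
  then show ?thesis
    using N_minus_commute[of x y] by linarith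
qed

lemma tends_N: "tends X L \<Longrightarrow> (\<lambda>n. N (X n)) \<longlonglongrightarrow> N L"
proof (rule LIM_zero_cancel, rule Lim_null_comparison)
  show "\<forall>\<^sub>F n in sequentially. norm (N (X n) - N L) \<le> N (X n - L)"
    by (simp add: N_diff_ge)
qed (simp add: tends_def)

lemma tends_mult: "tends X L \<Longrightarrow> tends Y M \<Longrightarrow> tends (\<lambda>n. X n * Y n) (L * M)"
proof (rule tends_bound)
  assume *: "tends X L" "tends Y M"
  show "N (X n * Y n - L * M) \<le> N (X n - L) * N (Y n) + N L * N (Y n - M)" for n
    by (rule N_mult_diff)
  show "(\<lambda>n. N (X n - L) * N (Y n) + N L * N (Y n - M)) \<longlonglongrightarrow> 0"
  proof -
    have "(\<lambda>n. N (X n - L) * N (Y n) + N L * N (Y n - M)) \<longlonglongrightarrow> 0 * N M + N L * 0"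
      by (intro tendsto_add tendsto_mult tendsto_const tends_N *(2) *[unfolded tends_def])
    then show ?thesis by simp
  qed
qed

lemma tends_unique: "tends X L \<Longrightarrow> tends Y M \<Longrightarrow> (\<And>n. X n \<doteq> Y n) \<Longrightarrow> L \<doteq> M"
proof -
  assume *: "tends X L" "tends Y M" "\<And>n. X n \<doteq> Y n"
  have "(\<lambda>n. N (X n - Y n)) \<longlonglongrightarrow> N (L - M)"
    by (intro tends_N tends_diff *)
  then have "(\<lambda>n. 0) \<longlonglongrightarrow> N (L - M)"
    using *(3) by (simp add: eqv_def)
  then show ?thesis
    by (simp add: eqv_def LIMSEQ_const_iff)
qed

section \<open>Square roots by iteration\<close>

primrec root_approx :: "'c \<Rightarrow> nat \<Rightarrow> 'c" where
  "root_approx d 0 = 0"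
| "root_approx d (Suc n) = (1/2) *\<^sub>R (d + root_approx d n * root_approx d n)"

primrec root_bound :: "nat \<Rightarrow> real" where
  "root_bound 0 = 0"
| "root_bound (Suc n) = (1 + (root_bound n)\<^sup>2) / 2"

lemma root_bound: "0 \<le> root_bound n \<and> root_bound n \<le> 1"
proof (induction n)
  case (Suc n)
  then show ?case by (auto simp: power_le_one)
qed simp

lemma root_bound_mono: "root_bound n \<le> root_bound (Suc n)"
  using zero_le_power2[of "root_bound n - 1"] by (simp add: power2_diff)

text \<open>Majorant argument: the recursion has non-negative coefficients, so norms and increments
  of the iterates are dominated by those of the scalar sequence. The induction carries both bounds
  together, because the norm of an iterate is estimated through its increment and the next increment
  through the norms.\<close>

lemma root_approx_bound:
  assumes "N d \<le> 1"
  shows "N (root_approx d n) \<le> root_bound n \<and>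
    N (root_approx d (Suc n) - root_approx d n) \<le> root_bound (Suc n) - root_bound n"
proof (induction n)
  case 0
  then show ?case using assms by (simp add: N_scaleR)
next
  case (Suc n)
  let ?x = "root_approx d (Suc n)" and ?y = "root_approx d n"
  have "N ?x \<le> root_bound (Suc n)"
    using Suc N_add[of "?x - ?y" ?y] by (simp del: root_approx.simps root_bound.simps)
  moreover have "N (root_approx d (Suc (Suc n)) - ?x) \<le> root_bound (Suc (Suc n)) - root_bound (Suc n)"
  proof -
    have "root_approx d (Suc (Suc n)) - ?x = (1/2) *\<^sub>R (?x * ?x - ?y * ?y)"
    proof -
      have "(1/2) *\<^sub>R (d + a) - (1/2) *\<^sub>R (d + b) = (1/2) *\<^sub>R (a - b)" for a b
        by (simp add: algebra_simps)
      then show ?thesis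
        by (metis root_approx.simps(2))
    qed
    \<comment> \<open>The symmetrised difference of squares holds without commutation of the two
      iterates.\<close>
    also have "?x * ?x - ?y * ?y = (1/2) *\<^sub>R ((?x - ?y) * (?x + ?y) + (?x + ?y) * (?x - ?y))"
    proof -
      have "(a - b) * (a + b) + (a + b) * (a - b) = (a * a - b * b) + (a * a - b * b)" for a b :: 'c
        by (simp add: algebra_simps)
      then show ?thesis
        by (simp only: scaleR_half_double)
    qed
    finally have "N (root_approx d (Suc (Suc n)) - ?x)
        = (1/4) * N ((?x - ?y) * (?x + ?y) + (?x + ?y) * (?x - ?y))"
      by (simp add: N_scaleR del: root_approx.simps)
    also have "\<dots> \<le> (1/4) * (N (?x - ?y) * N (?x + ?y) + N (?x + ?y) * N (?x - ?y))"
      by (intro mult_left_mono order_trans[OF N_add add_mono] N_mult) simp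
    also have "\<dots> = (1/2) * (N (?x - ?y) * N (?x + ?y))"
      by simp
    also have "\<dots> \<le> (1/2) * ((root_bound (Suc n) - root_bound n) * (root_bound (Suc n) + root_bound n))"
      using Suc \<open>N ?x \<le> root_bound (Suc n)\<close> root_bound_mono[of n]
      by (intro mult_left_mono mult_mono order_trans[OF N_add add_mono]) (auto simp del: root_approx.simps root_bound.simps)
    also have "\<dots> = root_bound (Suc (Suc n)) - root_bound (Suc n)"
      by (simp only: root_bound.simps(2)[of "Suc n"] root_bound.simps(2)[of n]) (simp add: power2_eq_square field_simps)
    finally show ?thesis .
  qed
  ultimately show ?case by blast
qed

lemma root_approx_dist:
  assumes "N d \<le> 1" "n \<le> m"
  shows "N (root_approx d m - root_approx d n) \<le> root_bound m - root_bound n"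
  using assms(2)
proof (induction m rule: dec_induct)
  case (step m)
  then show ?case
    using N_add[of "root_approx d (Suc m) - root_approx d m" "root_approx d m - root_approx d n"]
      root_approx_bound[OF assms(1), of m] by (simp del: root_approx.simps root_bound.simps)
qed simp

lemma root_bound_convergent: "\<exists>l. root_bound \<longlonglongrightarrow> l"
proof -
  have "incseq root_bound"
    by (rule incseq_SucI) (rule root_bound_mono)
  moreover have "\<forall>n. root_bound n \<le> 1"
    using root_bound by blast
  ultimately show ?thesis
    using incseq_convergent by metis
qed

lemma tends_complete:
  assumes "\<And>m n. n \<le> m \<Longrightarrow> N (X m - X n) \<le> f m - f n" "f \<longlonglongrightarrow> (l::real)"
  shows "\<exists>L. tends X L"
  unfolding tends_def
proof (rule N_complete)
  fix e :: real
  assume "e > 0"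
  then obtain M where M: "\<And>m n. m \<ge> M \<Longrightarrow> n \<ge> M \<Longrightarrow> \<bar>f m - f n\<bar> < e"
    using LIMSEQ_imp_Cauchy[OF assms(2)] unfolding Cauchy_def dist_real_def by blast
  have "N (X m - X n) < e" if "m \<ge> M" "n \<ge> M" for m n
  proof (cases "m \<le> n")
    case True
    then show ?thesis
      using M[OF that] assms(1)[of m n] N_minus_commute[of "X m" "X n"] by linarith
  next
    case False
    then show ?thesis
      using M[OF that] assms(1)[of n m] by linarith
  qed
  then show "\<exists>M. \<forall>m\<ge>M. \<forall>n\<ge>M. N (X m - X n) < e" by blast
qed

section \<open>Commutation up to distance 0\<close>

definition commuting :: "'c \<Rightarrow> 'c \<Rightarrow> bool" where
  "commuting x y \<longleftrightarrow> x * y \<doteq> y * x"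

lemma commuting_self [simp]: "commuting x x"
  by (simp add: commuting_def)

lemma commuting_sym: "commuting x y \<Longrightarrow> commuting y x"
  by (simp add: commuting_def eqv_sym)

lemma commuting_zero: "commuting z 0"
  by (simp add: commuting_def)

lemma commuting_one: "commuting z 1"
  by (simp add: commuting_def)

lemma commuting_add: "commuting z x \<Longrightarrow> commuting z y \<Longrightarrow> commuting z (x + y)"
  by (simp add: commuting_def distrib_left distrib_right eqv_add)

lemma commuting_scaleR: "commuting z x \<Longrightarrow> commuting z (r *\<^sub>R x)"
  by (simp add: commuting_def eqv_scaleR)

lemma commuting_diff: "commuting z x \<Longrightarrow> commuting z y \<Longrightarrow> commuting z (x - y)"
  by (simp add: commuting_def left_diff_distrib right_diff_distrib eqv_diff)

lemma commuting_mult: "commuting z x \<Longrightarrow> commuting z y \<Longrightarrow> commuting z (x * y)"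
proof -
  assume "commuting z x" "commuting z y"
  then have "z * x * y \<doteq> x * z * y" "x * (z * y) \<doteq> x * (y * z)"
    by (auto simp: commuting_def intro!: eqv_mult)
  then show ?thesis
    unfolding commuting_def using eqv_trans by (simp add: mult.assoc)
qed

lemma commuting_cong: "commuting z x \<Longrightarrow> x \<doteq> y \<Longrightarrow> commuting z y"
  unfolding commuting_def
  by (rule eqv_trans[OF eqv_trans[OF eqv_mult[OF eqv_refl eqv_sym]]]) (auto intro: eqv_mult)

lemma commuting_tends:
  assumes "\<And>n. commuting z (X n)" "tends X x"
  shows "commuting z x"
  unfolding commuting_def
  using tends_unique[OF tends_mult[OF tends_const assms(2)] tends_mult[OF assms(2) tends_const]]
    assms(1) unfolding commuting_def by blast

text \<open>The iteration \<open>e \<mapsto> (d + e\<^sup>2) / 2\<close> converges to \<open>1 - sqrt (1 - d)\<close>; it is dominated by the scalar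
  iteration for \<open>d = 1\<close>.\<close>

lemma sqrt_one_minus:
  assumes "st d = d" "N d \<le> 1"
  obtains w where "st w = w" "w * w \<doteq> 1 - d" "N (1 - w) \<le> 1"
    "\<forall>z. commuting z d \<longrightarrow> commuting z w"
proof -
  obtain l where l: "root_bound \<longlonglongrightarrow> l"
    using root_bound_convergent by blast
  obtain L where L: "tends (root_approx d) L"
    using tends_complete[OF root_approx_dist[OF assms(2)] l] by blast
  \<comment> \<open>A limit is determined only up to \<doteq>, so \<open>L\<close> itself need not
    be fixed by \<open>st\<close>.\<close>
  define e where "e = (1/2) *\<^sub>R (L + st L)"
  have sa: "st (root_approx d n) = root_approx d n" for n
    by (induction n) (simp_all add: st_add st_mult st_scaleR assms)
  have "tends (\<lambda>n. (1/2) *\<^sub>R (root_approx d n + st (root_approx d n))) e"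
    unfolding e_def by (intro tends_scaleR tends_add tends_st L)
  then have e: "tends (root_approx d) e"
    by (simp add: sa scaleR_half_double)
  have ste: "st e = e"
    by (simp add: e_def st_add st_scaleR add.commute)
  have "e \<doteq> (1/2) *\<^sub>R (d + e * e)"
  proof (rule tends_unique)
    show "tends (\<lambda>n. root_approx d (Suc n)) e"
      by (rule tends_Suc[OF e])
    show "tends (\<lambda>n. (1/2) *\<^sub>R (d + root_approx d n * root_approx d n)) ((1/2) *\<^sub>R (d + e * e))"
      by (intro tends_scaleR tends_add tends_mult tends_const e)
  qed simp
  then have "2 *\<^sub>R e \<doteq> 2 *\<^sub>R ((1/2) *\<^sub>R (d + e * e))"
    by (rule eqv_scaleR)
  then have "1 - 2 *\<^sub>R e + e * e \<doteq> 1 - (d + e * e) + e * e"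
    by (intro eqv_add eqv_diff) auto
  moreover have "(1 - e) * (1 - e) = 1 - 2 *\<^sub>R e + e * e"
    by (simp add: algebra_simps scaleR_2)
  ultimately have "(1 - e) * (1 - e) \<doteq> 1 - d"
    by simp
  moreover have "N e \<le> 1"
    using root_approx_bound[OF assms(2)] root_bound
    by (intro LIMSEQ_le_const2[OF tends_N[OF e]]) (meson order_trans)
  moreover have "commuting z (1 - e)" if "commuting z d" for z
  proof -
    have "commuting z (root_approx d n)" for n
      by (induction n) (auto intro!: commuting_zero commuting_scaleR commuting_add commuting_mult that)
    then show ?thesis
      by (intro commuting_diff commuting_one) (rule commuting_tends[OF _ e])
  qed
  ultimately show thesis
    by (intro that[of "1 - e"]) (auto simp: st_diff ste)
qed

section \<open>The imaginary unit and unitary combinations\<close>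

lemma j_mult_left: "j * (x * y) = x * (j * y)"
  by (metis j_central mult.assoc)

lemma j_j_mult [simp]: "j * (j * x) = - x"
  by (simp add: j_square flip: mult.assoc)

lemma j_mult_square: "j * x * (j * x) = - (x * x)"
proof -
  have "j * x * (j * x) = j * (x * j) * x"
    by (simp only: mult.assoc)
  also have "x * j = j * x"
    by (rule j_central[symmetric])
  finally show ?thesis
    by (simp add: mult.assoc)
qed

lemma N_j: "N j \<le> 1"
proof -
  have "(N j)\<^sup>2 \<le> 1"
    using N_star_mult[of j] N_one by (simp add: st_j j_square)
  then show ?thesis
    by (simp add: abs_square_le_1)
qed

text \<open>If \<open>s\<^sup>2 + w\<^sup>2 = 1\<close> with \<open>s\<close>, \<open>w\<close> commuting, then \<open>s + i w\<close> is unitary.\<close>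

lemma unitary_parts:
  assumes "st s = s" "st w = w" "commuting s w" "s * s + w * w \<doteq> 1"
  shows "N s \<le> 1" "N w \<le> 1"
proof -
  let ?u = "s + j * w"
  have st_u: "st ?u = s - j * w"
    using assms by (simp add: st_add st_mult st_j flip: j_central)
  have "j * w * (j * w) = - (w * w)"
    by (rule j_mult_square)
  then have "st ?u * ?u = (s * s + w * w) + j * (s * w - w * s)"
    by (simp add: st_u algebra_simps j_mult_left[of s w])
  moreover have "s * w - w * s \<doteq> 0"
    using assms(3) by (simp add: commuting_def eqv_def)
  then have "j * (s * w - w * s) \<doteq> j * 0"
    by (intro eqv_mult) auto
  then have "(s * s + w * w) + j * (s * w - w * s) \<doteq> 1 + j * 0"
    by (intro eqv_add assms)
  ultimately have "N (st ?u * ?u) = N 1"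
    using N_cong by fastforce
  then have "(N ?u)\<^sup>2 \<le> 1"
    using N_star_mult[of ?u] N_one by simp
  then have u: "N ?u \<le> 1"
    by (simp add: abs_square_le_1)
  have "s = (1/2) *\<^sub>R (?u + st ?u)"
    by (simp add: st_u scaleR_half_double)
  then have "N s = N (?u + st ?u) / 2"
    by (metis N_half)
  also have "\<dots> \<le> (1 + 1) / 2"
    using u by (intro divide_right_mono order_trans[OF N_add add_mono]) auto
  finally show "N s \<le> 1" by simp
  have "w = (1/2) *\<^sub>R (- j * (?u - st ?u))"
  proof -
    have "?u - st ?u = j * w + j * w"
      by (simp add: st_u)
    moreover have "- j * (j * w) = w"
      by simp
    ultimately have "- j * (?u - st ?u) = w + w"
      by (simp only: distrib_left)
    then show ?thesis
      by (simp only: scaleR_half_double)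
  qed
  then have "N w = N (- j * (?u - st ?u)) / 2"
    by (metis N_half)
  also have "\<dots> \<le> (1 * (1 + 1)) / 2"
    using u N_j
    by (intro divide_right_mono order_trans[OF N_mult mult_mono] order_trans[OF N_diff add_mono]) auto
  finally show "N w \<le> 1" by simp
qed

lemma N_one_minus_square:
  assumes "st s = s" "N s \<le> 1"
  shows "N (1 - s * s) \<le> 1"
proof -
  have Ns: "N (s * s) \<le> 1"
    using order_trans[OF N_mult mult_mono[OF assms(2,2)]] by simp
  have ss: "st (s * s) = s * s"
    using assms by (simp add: st_mult)
  obtain w where w: "st w = w" "w * w \<doteq> 1 - s * s" "N (1 - w) \<le> 1"
    "\<forall>z. commuting z (s * s) \<longrightarrow> commuting z w"
    by (rule sqrt_one_minus[OF ss Ns])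
  \<comment> \<open>So \<open>s + j * w\<close> is unitary and \<open>w\<close> a contraction; then
    \<open>w * w\<close>, which is \<doteq> to \<open>1 - s * s\<close>, is one as well.\<close>
  have "s * s + w * w \<doteq> s * s + (1 - s * s)"
    by (intro eqv_add w) auto
  then have "N w \<le> 1"
    using assms(1) w(1) by (intro unitary_parts(2)[of s w] w w(4)[rule_format] commuting_mult) simp_all
  moreover have "N (1 - s * s) = N (w * w)"
    using w(2) N_cong eqv_sym by blast
  ultimately show ?thesis
    using order_trans[OF N_mult[of w w] mult_mono[of "N w" 1 "N w" 1]] by simp
qed

section \<open>The cone of positive elements\<close>

definition pos :: "'c \<Rightarrow> bool" where
  "pos h \<longleftrightarrow> st h = h \<and> (\<exists>t\<ge>0. N (t *\<^sub>R 1 - h) \<le> t)"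

lemma pos_st: "pos h \<Longrightarrow> st h = h"
  by (simp add: pos_def)

lemma posI: "st h = h \<Longrightarrow> N (t *\<^sub>R 1 - h) \<le> t \<Longrightarrow> pos h"
  unfolding pos_def using N_nonneg order_trans by blast

lemma pos_cong: "pos h \<Longrightarrow> h \<doteq> g \<Longrightarrow> st g = g \<Longrightarrow> pos g"
proof -
  assume *: "pos h" "h \<doteq> g" "st g = g"
  have "N (t *\<^sub>R 1 - g) = N (t *\<^sub>R 1 - h)" for t
    by (intro N_cong eqv_diff eqv_refl eqv_sym[OF *(2)])
  then show ?thesis
    using * by (auto simp: pos_def)
qed

lemma pos_add: "pos h \<Longrightarrow> pos g \<Longrightarrow> pos (h + g)"
proof -
  assume "pos h" "pos g"
  then obtain t u where *: "st h = h" "st g = g" "N (t *\<^sub>R 1 - h) \<le> t" "N (u *\<^sub>R 1 - g) \<le> u"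
    by (auto simp: pos_def)
  show ?thesis
    using * N_add[of "t *\<^sub>R 1 - h" "u *\<^sub>R 1 - g"]
    by (intro posI[of _ "t + u"]) (auto simp: st_add algebra_simps)
qed

lemma pos_scaleR: "pos h \<Longrightarrow> r \<ge> 0 \<Longrightarrow> pos (r *\<^sub>R h)"
proof -
  assume "pos h" "r \<ge> 0"
  then obtain t where *: "st h = h" "N (t *\<^sub>R 1 - h) \<le> t"
    by (auto simp: pos_def)
  have "(r * t) *\<^sub>R 1 - r *\<^sub>R h = r *\<^sub>R (t *\<^sub>R 1 - h)"
    by (simp add: algebra_simps)
  then show ?thesis
    using * \<open>r \<ge> 0\<close>
    by (intro posI[of _ "r * t"]) (auto simp: st_scaleR N_scaleR mult_left_mono)
qed

lemma pos_zero: "pos 0"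
  by (rule posI[of _ 0]) auto

lemma pos_null: "st h = h \<Longrightarrow> h \<doteq> 0 \<Longrightarrow> pos h"
  using pos_cong[OF pos_zero] eqv_sym by blast

text \<open>Normalised to \<open>N s = 1\<close>, the claim is the bound of
  \<open>N_one_minus_square\<close> with \<open>t = 1\<close>. The case \<open>N s = 0\<close> is
  separate because of the division.\<close>

lemma pos_square: "st s = s \<Longrightarrow> pos (s * s)"
proof (cases "N s = 0")
  case True
  assume s: "st s = s"
  have "s * s \<doteq> 0 * 0"
    using True by (intro eqv_mult) (auto simp: eqv_def)
  then show ?thesis
    using s by (intro pos_null) (auto simp: st_mult)
next
  case False
  assume s: "st s = s"
  let ?r = "N s"
  have r: "?r > 0"
    using False N_nonneg[of s] by linarith
  let ?s = "(1 / ?r) *\<^sub>R s"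
  have "N (1 - ?s * ?s) \<le> 1"
    using r s by (intro N_one_minus_square) (auto simp: st_scaleR N_scaleR)
  then have "pos (?s * ?s)"
    using s by (intro posI[of _ 1]) (auto simp: st_mult st_scaleR)
  then have "pos ((?r * ?r) *\<^sub>R (?s * ?s))"
    by (rule pos_scaleR) simp
  then show ?thesis
    using r by simp
qed

text \<open>The bound \<open>N (t *\<^sub>R 1 - h) \<le> t\<close> says that
  \<open>1 - (1/t) *\<^sub>R h\<close> is a contraction, so \<open>sqrt_one_minus\<close> provides a
  root of \<open>(1/t) *\<^sub>R h\<close>, rescaled by \<open>sqrt t\<close>. The root commutes
  with whatever commutes with \<open>h\<close>; applied twice, this makes roots of commuting
  elements commute.\<close>

lemma pos_sqrt:
  assumes "pos h"
  obtains s where "st s = s" "s * s \<doteq> h" "pos s" "\<forall>z. commuting z h \<longrightarrow> commuting z s"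
proof -
  obtain t where t: "t \<ge> 0" "st h = h" "N (t *\<^sub>R 1 - h) \<le> t"
    using assms by (auto simp: pos_def)
  show thesis
  proof (cases "t = 0")
    case True
    then have "h \<doteq> 0"
      using t N_nonneg[of h] by (simp add: eqv_def)
    then show ?thesis
      by (intro that[of 0]) (auto simp: eqv_sym pos_zero commuting_zero)
  next
    case False
    then have t0: "t > 0"
      using t by simp
    let ?d = "1 - (1/t) *\<^sub>R h"
    have "?d = (1/t) *\<^sub>R (t *\<^sub>R 1 - h)"
      using t0 by (simp add: scaleR_diff_right)
    then have d: "N ?d \<le> 1"
      using t t0 by (simp add: N_scaleR)
    have std: "st ?d = ?d"
      by (simp add: st_diff st_scaleR t(2))
    obtain w where w: "st w = w" "w * w \<doteq> 1 - ?d" "N (1 - w) \<le> 1"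
      "\<forall>z. commuting z ?d \<longrightarrow> commuting z w"
      by (rule sqrt_one_minus[OF std d])
    let ?s = "sqrt t *\<^sub>R w"
    have "t *\<^sub>R (w * w) \<doteq> t *\<^sub>R (1 - ?d)"
      by (rule eqv_scaleR[OF w(2)])
    then have "?s * ?s \<doteq> h"
      using t0 by simp
    moreover have "pos w"
      using w by (intro posI[of _ 1]) auto
    then have "pos ?s"
      using t by (intro pos_scaleR) auto
    moreover have "commuting z ?s" if "commuting z h" for z
      by (intro commuting_scaleR w(4)[rule_format] commuting_diff commuting_one that)
    ultimately show ?thesis
      using w(1) by (intro that[of ?s]) (auto simp: st_scaleR)
  qed
qed

lemma commuting_sqrts:
  assumes "pos h" "pos g" "commuting h g"
  obtains s w where "st s = s" "st w = w" "s * s \<doteq> h" "w * w \<doteq> g" "commuting s w"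
proof -
  obtain s where s: "st s = s" "s * s \<doteq> h" "pos s" "\<forall>z. commuting z h \<longrightarrow> commuting z s"
    by (rule pos_sqrt[OF assms(1)])
  obtain w where w: "st w = w" "w * w \<doteq> g" "pos w" "\<forall>z. commuting z g \<longrightarrow> commuting z w"
    by (rule pos_sqrt[OF assms(2)])
  have "commuting s g"
    by (rule commuting_sym[OF s(4)[rule_format, OF commuting_sym[OF assms(3)]]])
  then have "commuting s w"
    by (rule w(4)[rule_format])
  with s w show ?thesis
    by (intro that[of s w])
qed

text \<open>With commuting roots \<open>s\<close> and \<open>w\<close>, the product is the square of
  \<open>s * w\<close>; \<open>?q\<close> is the exactly self-adjoint version of
  \<open>s * w\<close>.\<close>

lemma pos_mult_commuting:
  assumes "pos h" "pos g" "h * g = g * h"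
  shows "pos (h * g)"
proof -
  obtain s w where s: "st s = s" "st w = w" "s * s \<doteq> h" "w * w \<doteq> g" "commuting s w"
    by (rule commuting_sqrts[OF assms(1,2)]) (simp_all add: commuting_def assms(3))
  let ?q = "(1/2) *\<^sub>R (s * w + w * s)"
  have "?q \<doteq> s * w" "?q \<doteq> w * s"
    using s(5) eqv_average by (auto simp: commuting_def)
  then have "?q * ?q \<doteq> (s * w) * (w * s)"
    by (rule eqv_mult)
  also have "\<dots> = s * (w * w) * s"
    by (simp add: mult.assoc)
  also have "\<dots> \<doteq> s * g * s"
    by (intro eqv_mult s) auto
  also have "\<dots> \<doteq> s * s * g"
  proof -
    have "commuting s g"
      using commuting_cong[OF commuting_mult[OF s(5) s(5)] s(4)] .
    then have "s * (g * s) \<doteq> s * (s * g)"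
      unfolding commuting_def by (intro eqv_mult[OF eqv_refl] eqv_sym[of "s * g"])
    then show ?thesis
      by (simp only: mult.assoc)
  qed
  also have "\<dots> \<doteq> h * g"
    by (intro eqv_mult s) auto
  finally have "?q * ?q \<doteq> h * g" .
  moreover have "pos (?q * ?q)"
    using s by (intro pos_square) (simp add: st_scaleR st_add st_mult add.commute)
  moreover have "st (h * g) = h * g"
    using assms by (simp add: st_mult pos_st)
  ultimately show ?thesis
    using pos_cong by blast
qed

lemma pos_one: "pos 1"
  using pos_square[of 1] by simp

lemma pos_power: "pos h \<Longrightarrow> pos (h ^ n)"
  by (induction n) (auto intro!: pos_mult_commuting pos_one simp: power_commutes)

text \<open>Commuting roots of \<open>p\<close> and \<open>1 - p\<close> are the two parts of a
  unitary, so both are contractions.\<close>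

lemma pos_le_one:
  assumes "pos p" "pos (1 - p)"
  shows "N p \<le> 1"
proof -
  have "commuting p (1 - p)"
    by (intro commuting_diff commuting_one) simp
  then obtain s w where s: "st s = s" "st w = w" "s * s \<doteq> p" "w * w \<doteq> 1 - p" "commuting s w"
    by (rule commuting_sqrts[OF assms])
  have "s * s + w * w \<doteq> p + (1 - p)"
    by (intro eqv_add s)
  then have "N s \<le> 1"
    using s by (intro unitary_parts[of s w]) auto
  moreover have "N p = N (s * s)"
    using s N_cong eqv_sym by blast
  ultimately show ?thesis
    using order_trans[OF N_mult[of s s] mult_mono[of "N s" 1 "N s" 1]] by simp
qed

lemma pos_scalar_minus: "st h = h \<Longrightarrow> N h \<le> r \<Longrightarrow> pos (r *\<^sub>R 1 - h)"
  by (intro posI[of _ r]) (auto simp: st_diff st_scaleR)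

text \<open>For \<open>r > N q\<close>, \<open>r - p\<close> is the sum of the positive elements
  \<open>r - q\<close> and \<open>q - p\<close>, so \<open>pos_le_one\<close> applies to
  \<open>p / r\<close>. Taking \<open>r\<close> strictly larger allows the division even if
  \<open>N q = 0\<close>.\<close>

lemma N_mono:
  assumes "pos p" "pos (q - p)"
  shows "N p \<le> N q"
proof -
  have "N p \<le> r" if r: "r > N q" for r
  proof -
    have r0: "r > 0"
      using r N_nonneg[of q] by linarith
    have "st q = q"
      using pos_st[OF pos_add[OF assms]] by simp
    then have "pos ((r *\<^sub>R 1 - q) + (q - p))"
      using r by (intro pos_add assms pos_scalar_minus) auto
    then have "pos ((1/r) *\<^sub>R ((r *\<^sub>R 1 - q) + (q - p)))"
      using r0 by (intro pos_scaleR) auto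
    then have "pos (1 - (1/r) *\<^sub>R p)"
      using r0 by (simp add: scaleR_diff_right)
    then have "N ((1/r) *\<^sub>R p) \<le> 1"
      using r0 assms by (intro pos_le_one pos_scaleR) auto
    then show ?thesis
      using r0 by (simp add: N_scaleR)
  qed
  then show ?thesis
    by (rule dense_ge)
qed

text \<open>The witness \<open>t\<close> in \<open>pos\<close> may vary along the sequence. Any
  \<open>t\<close> above the norm of a positive element is a witness, so a common bound of the
  convergent norms serves all members and hence the limit.\<close>

lemma pos_tends:
  assumes "tends X L" "\<And>n. pos (X n)" "st L = L"
  shows "pos L"
proof -
  obtain B where B: "\<And>n. N (X n) \<le> B"
    using convergent_imp_Bseq[OF convergentI[OF tends_N[OF assms(1)]]] by (auto simp: Bseq_def)
  have *: "N (t *\<^sub>R 1 - h) \<le> t" if "pos h" "N h \<le> t" for h t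
  proof -
    have "pos (t *\<^sub>R 1 - h)"
      using that by (intro pos_scalar_minus) (auto simp: pos_st)
    moreover have "pos (t *\<^sub>R 1 - (t *\<^sub>R 1 - h))"
      using that by simp
    ultimately have "N (t *\<^sub>R 1 - h) \<le> N (t *\<^sub>R 1)"
      by (rule N_mono)
    also have "\<dots> \<le> t"
      using that N_one order_trans[OF N_nonneg that(2)] by (simp add: N_scaleR mult_left_le)
    finally show ?thesis .
  qed
  have "N (B *\<^sub>R 1 - L) \<le> B"
    by (rule LIMSEQ_le_const2[OF tends_N[OF tends_diff[OF tends_const assms(1)]]])
      (use * B assms(2) in blast)
  then show ?thesis
    by (rule posI[OF assms(3)])
qed

section \<open>Positivity of \<open>st y * y\<close>\<close>

lemma N_square_sa: "st g = g \<Longrightarrow> N (g * g) = (N g)\<^sup>2"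
  using N_star_mult[of g] by simp

text \<open>Bernoulli's inequality for \<open>1 + g\<close>, multiplied by \<open>g\<close>. Each
  further factor \<open>1 + g\<close> adds \<open>(1 + g) ^ n * (g * g)\<close>, which by
  \<open>Q\<close> dominates \<open>g * g\<close>.\<close>

lemma one_plus_power_ge:
  assumes g: "pos g"
  shows "pos ((1 + g) ^ n * g - real n *\<^sub>R (g * g))"
proof -
  have c: "(1 + g) ^ n * g ^ m = g ^ m * (1 + g) ^ n" for n m
  proof -
    have "g ^ m * (1 + g) = (1 + g) * g ^ m" for m
      by (simp add: distrib_left distrib_right power_commutes)
    then show ?thesis
      by (metis power_commuting_commutes)
  qed
  have P: "pos ((1 + g) ^ n * g ^ m)" for n m
    by (intro pos_mult_commuting pos_power pos_add pos_one g c)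
  have Q: "pos ((1 + g) ^ n * (g * g) - g * g)" for n
  proof (induction n)
    case (Suc n)
    have "(1 + g) ^ Suc n * (g * g) - g * g = ((1 + g) ^ n * (g * g) - g * g) + (1 + g) ^ n * g ^ 3"
      by (simp add: power_Suc2 algebra_simps power3_eq_cube del: power_Suc)
    then show ?case
      using pos_add[OF Suc P[of n 3]] by (simp only:)
  qed (simp add: pos_zero)
  show ?thesis
  proof (induction n)
    case (Suc n)
    have "(1 + g) ^ Suc n * g - real (Suc n) *\<^sub>R (g * g)
        = ((1 + g) ^ n * g - real n *\<^sub>R (g * g)) + ((1 + g) ^ n * (g * g) - g * g)"
      by (simp add: power_Suc2 algebra_simps del: power_Suc)
    then show ?case
      using pos_add[OF Suc Q[of n]] by (simp only:)
  qed (simp add: g)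
qed

text \<open>Since \<open>z\<^sup>* (1 - z z\<^sup>*)\<^sup>n = (1 + g)\<^sup>n z\<^sup>*\<close> for \<open>g = - z\<^sup>* z\<close>, a bound on \<open>1 - z z\<^sup>*\<close>
  bounds \<open>(1 + g)\<^sup>n g\<close>, which dominates \<open>n g\<^sup>2\<close> for positive \<open>g\<close>.\<close>

lemma no_negative_squares:
  assumes g: "pos (- (st z * z))"
  shows "N z = 0"
proof (rule ccontr)
  assume z: "N z \<noteq> 0"
  define y where "y = (1 / N z) *\<^sub>R z"
  have y1: "N y = 1"
    using z by (simp add: y_def N_scaleR)
  define g where "g = - (st y * y)"
  define k where "k = y * st y"
  have "g = (1 / (N z)\<^sup>2) *\<^sub>R (- (st z * z))"
    by (simp add: g_def y_def st_scaleR power2_eq_square)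
  then have g: "pos g"
    using pos_scaleR[OF assms, of "1 / (N z)\<^sup>2"] by simp
  \<comment> \<open>\<open>b\<close> is the real part of \<open>y\<close> and \<open>c\<close> the
    negative of its imaginary part. The identity
    \<open>st y * y + y * st y = 2 *\<^sub>R (b * b + c * c)\<close> turns positivity of
    \<open>g = - (st y * y)\<close> into positivity of \<open>k = y * st y\<close>.\<close>
  define b where "b = (1/2) *\<^sub>R (y + st y)"
  define c where "c = (1/2) *\<^sub>R (j * (y - st y))"
  have b: "st b = b"
    by (simp add: b_def st_scaleR st_add add.commute)
  have c: "st c = c"
    by (simp add: c_def st_scaleR st_mult st_diff st_j j_central algebra_simps)
  have "2 *\<^sub>R (b * b + c * c) = (1/2) *\<^sub>R ((y + st y) * (y + st y) - (y - st y) * (y - st y))"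
  proof -
    have "2 *\<^sub>R (((1/2) *\<^sub>R u) * ((1/2) *\<^sub>R u) + ((1/2) *\<^sub>R v) * ((1/2) *\<^sub>R v))
        = (1/2) *\<^sub>R (u * u + v * v)" for u v :: 'c
      by (simp add: scaleR_right_distrib)
    then show ?thesis
      by (simp only: b_def c_def j_mult_square diff_conv_add_uminus)
  qed
  also have "(y + st y) * (y + st y) - (y - st y) * (y - st y) = (st y * y + k) + (st y * y + k)"
    by (simp add: k_def algebra_simps)
  finally have "2 *\<^sub>R (b * b + c * c) = st y * y + k"
    by (simp only: scaleR_half_double)
  then have k_eq: "k = 2 *\<^sub>R (b * b + c * c) + g"
    by (simp add: g_def)
  have "pos k"
    unfolding k_eq by (intro pos_add pos_scaleR pos_square b c g) simp
  moreover have "N k \<le> 1"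
    using N_mult[of y "st y"] y1 by (simp add: k_def)
  ultimately have "N (1 - k) \<le> 1"
    using N_mono[of "1 - k" 1] pos_scalar_minus[of k 1] N_one by (simp add: pos_st)
  then have kn: "N ((1 - k) ^ n) \<le> 1" for n
    by (rule N_power)
  have "st y * (1 - k) ^ n = (1 + g) ^ n * st y" for n
  proof (induction n)
    case (Suc n)
    have "st y * (1 - k) = (1 + g) * st y"
      by (simp add: k_def g_def algebra_simps)
    then show ?case
      by (metis Suc mult.assoc power_Suc)
  qed simp
  then have "(1 + g) ^ n * g = - (st y * (1 - k) ^ n * y)" for n
    by (simp add: g_def mult.assoc)
  then have "N ((1 + g) ^ n * g) \<le> N (st y) * N ((1 - k) ^ n) * N y" for n
    by (simp only: N_minus) (intro order_trans[OF N_mult] mult_right_mono N_mult N_nonneg)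
  then have bound: "N ((1 + g) ^ n * g) \<le> 1" for n
    using kn[of n] y1 by (auto intro: order_trans)
  have "real n * N (g * g) \<le> 1" for n
  proof -
    have "N (real n *\<^sub>R (g * g)) \<le> N ((1 + g) ^ n * g)"
      by (intro N_mono pos_scaleR pos_square one_plus_power_ge g pos_st) simp
    then show ?thesis
      using bound[of n] by (simp add: N_scaleR)
  qed
  moreover have "N (g * g) = 1"
    using N_square_sa[OF pos_st[OF g]] N_star_mult[of y] y1 by (simp add: g_def)
  ultimately have "real 2 \<le> 1"
    by (metis mult.right_neutral)
  then show False by simp
qed

text \<open>Kaplansky: with \<open>a = \<bar>h\<bar>\<close> and \<open>n = a - h\<close>, the element \<open>z = y n\<close> has \<open>z\<^sup>* z = n h n = - n a n \<le> 0\<close>.\<close>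

theorem pos_star_mult: "pos (st y * y)"
proof -
  define h where "h = st y * y"
  have h: "st h = h"
    by (simp add: h_def st_mult)
  obtain a where a: "st a = a" "a * a \<doteq> h * h" "pos a" "\<forall>z. commuting z (h * h) \<longrightarrow> commuting z a"
    by (rule pos_sqrt[OF pos_square[OF h]])
  have ha: "commuting h a"
    by (intro a(4)[rule_format] commuting_mult) simp_all
  obtain r where r: "st r = r" "r * r \<doteq> a" "pos r" "\<forall>z. commuting z a \<longrightarrow> commuting z r"
    by (rule pos_sqrt[OF a(3)])
  define n where "n = a - h"
  have n: "st n = n"
    by (simp add: n_def st_diff a h)
  have "commuting n a"
    unfolding n_def by (metis commuting_diff commuting_self commuting_sym ha)
  then have nr: "commuting n r"
    by (rule r(4)[rule_format])
  have "h * n = h * a - h * h"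
    by (simp add: n_def algebra_simps)
  also have "\<dots> \<doteq> a * h - a * a"
    using ha by (intro eqv_diff) (auto simp: commuting_def eqv_sym a)
  also have "\<dots> = - (a * n)"
    by (simp add: n_def algebra_simps)
  finally have hn: "h * n \<doteq> - (a * n)" .
  have "st (y * n) * (y * n) = n * (h * n)"
    by (simp add: st_mult n h_def mult.assoc)
  also have "\<dots> \<doteq> n * (- (a * n))"
    by (intro eqv_mult hn) simp
  also have "\<dots> \<doteq> n * (- (r * r * n))"
    by (intro eqv_mult eqv_minus eqv_sym[OF r(2)]) simp_all
  also have "\<dots> = - ((n * r) * (r * n))"
    by (simp add: mult.assoc)
  finally have z: "st (y * n) * (y * n) \<doteq> - ((n * r) * (r * n))" .
  \<comment> \<open>\<open>n\<close> and \<open>r\<close> commute and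
    \<open>r * r \<doteq> a\<close>, so \<open>n * a * n \<doteq> q * q\<close> with
    \<open>q\<close> exactly self-adjoint. Hence the negative of \<open>st (y * n) * (y * n)\<close>
    is positive.\<close>
  define q where "q = (1/2) *\<^sub>R (n * r + r * n)"
  have q: "q \<doteq> n * r" "q \<doteq> r * n"
    unfolding q_def using nr eqv_average by (auto simp: commuting_def)
  have stq: "st q = q"
    by (simp add: q_def st_scaleR st_add st_mult n r add.commute)
  have "- (st (y * n) * (y * n)) \<doteq> - (- ((n * r) * (r * n)))"
    using z by (rule eqv_minus)
  also have "\<dots> \<doteq> q * q"
    by (simp add: eqv_mult eqv_sym[OF q(1)] eqv_sym[OF q(2)])
  finally have zq: "- (st (y * n) * (y * n)) \<doteq> q * q" .
  have "pos (- (st (y * n) * (y * n)))"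
    by (rule pos_cong[OF pos_square[OF stq] eqv_sym[OF zq]]) (simp add: st_minus st_mult)
  then have "N (y * n) = 0"
    by (rule no_negative_squares)
  then have "N (- (st (y * n) * (y * n))) = 0"
    using N_star_mult[of "y * n"] by simp
  then have "N (q * q) = 0"
    using N_cong[OF zq] by simp
  then have "N q = 0"
    using N_square_sa[OF stq] by simp
  then have rn: "r * n \<doteq> 0"
    using N_cong[OF q(2)] by (simp add: eqv_def)
  have "a * n \<doteq> r * r * n"
    by (intro eqv_mult eqv_sym[OF r(2)]) simp
  also have "\<dots> \<doteq> r * 0"
    using eqv_mult[OF eqv_refl rn, of r] by (simp add: mult.assoc)
  finally have an: "a * n \<doteq> 0" by simp
  \<comment> \<open>\<open>n\<close> is twice the negative part of \<open>h\<close>. It is null,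
    because both terms on the right are; so \<open>h\<close> coincides with the positive
    \<open>a\<close>.\<close>
  have "n * n = a * n - h * n"
    by (simp add: n_def algebra_simps)
  also have "\<dots> \<doteq> a * n - (- (a * n))"
    by (intro eqv_diff hn) simp
  also have "\<dots> \<doteq> 0 - (- 0)"
    by (intro eqv_diff eqv_minus an)
  finally have "N (n * n) = 0"
    by (simp add: eqv_def)
  then have "a \<doteq> h"
    using N_square_sa[OF n] by (simp add: n_def eqv_def)
  then show ?thesis
    using pos_cong[OF a(3) _ h] by (simp add: h_def)
qed

lemma pos_conjugate:
  assumes "pos h"
  shows "pos (st c * h * c)"
proof -
  obtain s where s: "st s = s" "s * s \<doteq> h" "pos s" "\<forall>z. commuting z h \<longrightarrow> commuting z s"
    by (rule pos_sqrt[OF assms])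
  have "st c * (s * s) * c \<doteq> st c * h * c"
    by (intro eqv_mult s(2) eqv_refl)
  moreover have "st c * (s * s) * c = st (s * c) * (s * c)"
    by (simp add: st_mult s(1) mult.assoc)
  moreover have "st (st c * h * c) = st c * h * c"
    by (simp add: st_mult pos_st[OF assms] mult.assoc)
  ultimately show ?thesis
    using pos_cong[OF pos_star_mult[of "s * c"]] by simp
qed

text \<open>For \<open>0 \<le> h \<le> 1\<close> and \<open>g = 1 - h\<close>, the element
  \<open>1 - g ^ m\<close> is the sum of \<open>h * g ^ i\<close> over \<open>i < m\<close> and so
  dominates \<open>m\<close> times \<open>h * g ^ m\<close>; the norm of \<open>h * g ^ m\<close> is
  therefore O(1/m). With \<open>h\<close> a multiple of \<open>x * st x\<close> this controls
  \<open>g ^ m * x\<close>. The factorisation \<open>e = x * y\<close> is what keeps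
  \<open>e\<close> inside an algebra without unit.\<close>

lemma approximate_unit:
  assumes "0 < \<delta>"
  obtains e y where "st e = e" "N e \<le> 1" "N (e * x - x) \<le> \<delta>" "e = x * y"
proof -
  \<comment> \<open>The summand 1 avoids division by 0, and the factor \<open>r\<close> makes
    \<open>h\<close> a contraction.\<close>
  define r where "r = 1 / ((N x)\<^sup>2 + 1)"
  have r: "r > 0" "r * (N x)\<^sup>2 \<le> 1"
    by (auto simp: r_def add_nonneg_pos)
  define h where "h = r *\<^sub>R (x * st x)"
  define g where "g = 1 - h"
  have h: "pos h"
    unfolding h_def using pos_star_mult[of "st x"] r by (intro pos_scaleR) auto
  have "N h \<le> r * (N x)\<^sup>2"
    using N_mult[of x "st x"] r by (simp add: h_def N_scaleR power2_eq_square mult_left_mono)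
  then have g: "pos g"
    using pos_scalar_minus[of h 1] r pos_st[OF h] by (simp add: g_def)
  have gh: "g ^ m * h = h * g ^ m" for m
    by (rule power_commuting_commutes) (simp add: g_def algebra_simps)
  have Ng: "N (g ^ m) \<le> 1" for m
    using h g by (intro N_power pos_le_one) (auto simp: g_def)
  have Q: "pos ((1 - g ^ m) - real m *\<^sub>R (h * g ^ m))" for m
  proof (induction m)
    case (Suc m)
    have "g ^ Suc m = g ^ m - h * g ^ m"
      by (simp add: g_def left_diff_distrib)
    then have "(1 - g ^ Suc m) - real (Suc m) *\<^sub>R (h * g ^ Suc m)
        = ((1 - g ^ m) - real m *\<^sub>R (h * g ^ m)) + real (Suc m) *\<^sub>R (h * (h * g ^ m))"
    proof -
      have "(1 - (a - h * a)) - real (Suc m) *\<^sub>R (h * (a - h * a))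
          = ((1 - a) - real m *\<^sub>R (h * a)) + real (Suc m) *\<^sub>R (h * (h * a))" for a
        by (simp add: algebra_simps)
      then show ?thesis
        by (simp only: \<open>g ^ Suc m = g ^ m - h * g ^ m\<close>)
    qed
    moreover have "pos (h * (h * g ^ m))"
      by (intro pos_mult_commuting h pos_power g) (metis gh mult.assoc)+
    ultimately show ?case
      using pos_add[OF Suc pos_scaleR, of "h * (h * g ^ m)" "real (Suc m)"] by (simp only: of_nat_0_le_iff)
  qed (simp add: pos_zero)
  have H: "pos (h * g ^ m)" for m
    by (intro pos_mult_commuting h pos_power g) (metis gh)
  have M: "real m * N (h * g ^ m) \<le> 2" for m
  proof -
    have "N (real m *\<^sub>R (h * g ^ m)) \<le> N (1 - g ^ m)"
      by (intro N_mono Q pos_scaleR H) auto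
    also have "\<dots> \<le> 2"
      using order_trans[OF N_diff add_mono[OF N_one Ng[of m]]] by simp
    finally show ?thesis
      by (simp add: N_scaleR)
  qed
  \<comment> \<open>The exponent \<open>Suc m + Suc m\<close> below cancels the constant 2 of
    \<open>M\<close>, so the squared error is at most \<open>1 / (r * real (Suc m))\<close>.\<close>
  obtain m where m: "real (Suc m) > 1 / (r * \<delta>\<^sup>2)"
    using reals_Archimedean2 by (meson less_trans lessI of_nat_less_iff)
  define e where "e = 1 - g ^ Suc m"
  have ste: "st e = e"
    using pos_st[OF pos_power[OF g]] by (simp add: e_def st_diff del: power_Suc)
  have "pos e"
    using pos_add[OF Q[of "Suc m"] pos_scaleR[OF H[of "Suc m"], of "real (Suc m)"]]
    by (simp only: e_def diff_add_cancel of_nat_0_le_iff)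
  then have "N e \<le> 1"
    using pos_power[OF g, of "Suc m"] by (intro pos_le_one) (auto simp: e_def simp del: power_Suc)
  moreover have "N (e * x - x) \<le> \<delta>"
  proof -
    let ?y = "g ^ Suc m * x"
    have "e * x - x = - ?y"
      by (simp add: e_def left_diff_distrib del: power_Suc)
    then have "(N (e * x - x))\<^sup>2 = N (st (st ?y) * st ?y)"
      using N_star_mult[of "st ?y"] by simp
    also have "st (st ?y) * st ?y = (1 / r) *\<^sub>R (g ^ Suc m * h * g ^ Suc m)"
      using r pos_st[OF pos_power[OF g, of "Suc m"]]
      by (simp add: st_mult h_def mult.assoc del: power_Suc)
    also have "\<dots> = (1 / r) *\<^sub>R (h * g ^ (Suc m + Suc m))"
      by (simp only: gh power_add mult.assoc)
    also have "N \<dots> \<le> 1 / (r * real (Suc m))"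
    proof -
      let ?q = "N (h * g ^ (Suc m + Suc m))"
      have "real (Suc m) * ?q \<le> 1"
        using M[of "Suc m + Suc m"] by (simp only: of_nat_add distrib_right)
      then have "?q \<le> 1 / real (Suc m)"
        by (simp only: pos_le_divide_eq of_nat_0_less_iff zero_less_Suc mult.commute)
      then have "(1 / r) * ?q \<le> (1 / r) * (1 / real (Suc m))"
        using r by (intro mult_left_mono) auto
      then show ?thesis
        using r by (simp only: N_scaleR) (simp del: of_nat_Suc power_Suc power_Suc2 add_Suc add_Suc_right)
    qed
    also have "\<dots> \<le> \<delta>\<^sup>2"
      using m r assms by (simp add: field_simps del: of_nat_Suc)
    finally show ?thesis
      using assms by (simp add: power2_le_iff_abs_le abs_le_square_iff)
  qed
  moreover have "\<exists>v. 1 - g ^ n = x * v" for n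
  proof (induction n)
    case 0
    show ?case by (intro exI[of _ 0]) simp
  next
    case (Suc n)
    then obtain v where "1 - g ^ n = x * v" by blast
    moreover have "1 - g ^ Suc n = (1 - g ^ n) + h * g ^ n"
      by (simp add: g_def left_diff_distrib)
    ultimately have "1 - g ^ Suc n = x * (v + r *\<^sub>R (st x * g ^ n))"
      by (simp add: h_def distrib_left mult.assoc)
    then show ?case by blast
  qed
  ultimately show thesis
    using that ste e_def by metis
qed

end

section \<open>The unitization of a C*-algebra\<close>

context cstar_algebra
begin

section \<open>Arithmetic in a C*-algebra with carrier\<close>

lemma smult_in [simp, intro]: "x \<in> carrier A \<Longrightarrow> c \<odot> x \<in> carrier A"
  using smult_closed[of c x] by (simp add: complex_ring_def)

lemma smult_add_left: "x \<in> carrier A \<Longrightarrow> (c + d) \<odot> x = c \<odot> x \<oplus> d \<odot> x"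
  using smult_l_distr[of c d x] by (simp add: complex_ring_def)

lemma smult_add_right: "\<lbrakk>x \<in> carrier A; y \<in> carrier A\<rbrakk> \<Longrightarrow> c \<odot> (x \<oplus> y) = c \<odot> x \<oplus> c \<odot> y"
  using smult_r_distr[of c x y] by (simp add: complex_ring_def)

lemma smult_mult: "x \<in> carrier A \<Longrightarrow> (c * d) \<odot> x = c \<odot> (d \<odot> x)"
  using smult_assoc1[of c d x] by (simp add: complex_ring_def)

lemma smult_1 [simp]: "x \<in> carrier A \<Longrightarrow> 1 \<odot> x = x"
  using smult_one[of x] by (simp add: complex_ring_def)

lemma smult_0 [simp]: "x \<in> carrier A \<Longrightarrow> 0 \<odot> x = \<zero>"
  using smult_l_null[of x] by (simp add: complex_ring_def)

lemma smult_zero [simp]: "c \<odot> \<zero> = \<zero>"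
  using smult_r_null[of c] by (simp add: complex_ring_def)

lemma smult_minus_one: "x \<in> carrier A \<Longrightarrow> (- 1) \<odot> x = \<ominus> x"
  using smult_add_left[of x "- 1" 1] by (intro minus_equality[symmetric]) simp_all

lemma smult_minus: "x \<in> carrier A \<Longrightarrow> (- c) \<odot> x = \<ominus> (c \<odot> x)"
  using smult_mult[of x "- 1" c] by (simp add: smult_minus_one)

declare mult_closed [simp, intro] adj_closed [simp, intro] adj_adj [simp] nrm_nonneg [simp]

lemma zero_mult [simp]: "x \<in> carrier A \<Longrightarrow> \<zero> \<otimes> x = \<zero>"
  using mult_smult_left[of \<zero> x 0] by simp

lemma mult_zero [simp]: "x \<in> carrier A \<Longrightarrow> x \<otimes> \<zero> = \<zero>"
  using mult_smult_right[of x \<zero> 0] by simp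

lemma adj_zero [simp]: "\<zero>\<^sup>\<star> = \<zero>"
  using adj_smult[of \<zero> 0] by simp

lemma nrm_zero [simp]: "\<parallel>\<zero>\<parallel> = 0"
  by (simp add: nrm_eq_0)

lemma nrm_adj: "x \<in> carrier A \<Longrightarrow> \<parallel>x\<^sup>\<star>\<parallel> = \<parallel>x\<parallel>"
proof -
  have *: "\<parallel>x\<parallel> \<le> \<parallel>x\<^sup>\<star>\<parallel>" if "x \<in> carrier A" for x
  proof (cases "\<parallel>x\<parallel> = 0")
    case False
    have "\<parallel>x\<parallel> * \<parallel>x\<parallel> \<le> \<parallel>x\<^sup>\<star>\<parallel> * \<parallel>x\<parallel>"
      using cstar_identity[OF that] nrm_mult[of "x\<^sup>\<star>" x] that by (simp add: power2_eq_square)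
    then show ?thesis
      using False nrm_nonneg[OF that] by (simp add: less_le)
  qed (use that in simp)
  assume "x \<in> carrier A"
  then show ?thesis
    using *[of x] *[of "x\<^sup>\<star>"] by simp
qed

lemma nrm_minus_commute: "\<lbrakk>x \<in> carrier A; y \<in> carrier A\<rbrakk> \<Longrightarrow> \<parallel>x \<ominus> y\<parallel> = \<parallel>y \<ominus> x\<parallel>"
  using nrm_a_inv[of "x \<ominus> y"] by (simp add: a_minus_def minus_add a_comm)

text \<open>A pair \<open>(c, a)\<close> stands for the element \<open>c + a\<close> of the unitization of \<open>A\<close>.\<close>

definition uadd :: "complex \<times> 'a \<Rightarrow> complex \<times> 'a \<Rightarrow> complex \<times> 'a" where
  "uadd p q = (fst p + fst q, snd p \<oplus> snd q)"

definition umult :: "complex \<times> 'a \<Rightarrow> complex \<times> 'a \<Rightarrow> complex \<times> 'a" where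
  "umult p q = (fst p * fst q, fst p \<odot> snd q \<oplus> (fst q \<odot> snd p \<oplus> snd p \<otimes> snd q))"

definition uscale :: "complex \<Rightarrow> complex \<times> 'a \<Rightarrow> complex \<times> 'a" where
  "uscale c p = (c * fst p, c \<odot> snd p)"

definition uadj :: "complex \<times> 'a \<Rightarrow> complex \<times> 'a" where
  "uadj p = (cnj (fst p), (snd p)\<^sup>\<star>)"

definition uact :: "complex \<times> 'a \<Rightarrow> 'a \<Rightarrow> 'a" where
  "uact p x = fst p \<odot> x \<oplus> snd p \<otimes> x"

text \<open>Left multiplication alone does not separate points when the algebra already has a unit
  \<open>e\<close>: the pair \<open>(- 1, e)\<close> acts as 0. The maximum of its operator norm and
  \<open>cmod (fst p)\<close> is a C*-norm whether or not there is a unit.\<close>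

definition ubound :: "complex \<times> 'a \<Rightarrow> real \<Rightarrow> bool" where
  "ubound p K \<longleftrightarrow> cmod (fst p) \<le> K \<and> (\<forall>x\<in>carrier A. \<parallel>uact p x\<parallel> \<le> K * \<parallel>x\<parallel>)"

definition unrm :: "complex \<times> 'a \<Rightarrow> real" where
  "unrm p = Inf {K. ubound p K}"

abbreviation ucarrier :: "(complex \<times> 'a) set" where
  "ucarrier \<equiv> UNIV \<times> carrier A"

section \<open>Algebra of the unitization and its action on the algebra\<close>

lemma umult_assoc:
  "\<lbrakk>p \<in> ucarrier; q \<in> ucarrier; r \<in> ucarrier\<rbrakk> \<Longrightarrow> umult (umult p q) r = umult p (umult q r)"
  by (cases p; cases q; cases r)
    (simp add: umult_def smult_add_right mult_add_left mult_add_right mult_smult_left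
      mult_smult_right mult_assoc a_ac mult.commute flip: smult_mult)

lemma umult_uadd_left:
  "\<lbrakk>p \<in> ucarrier; q \<in> ucarrier; r \<in> ucarrier\<rbrakk> \<Longrightarrow> umult (uadd p q) r = uadd (umult p r) (umult q r)"
  by (cases p; cases q; cases r)
    (simp add: umult_def uadd_def smult_add_left smult_add_right mult_add_left a_ac distrib_right)

lemma umult_uadd_right:
  "\<lbrakk>p \<in> ucarrier; q \<in> ucarrier; r \<in> ucarrier\<rbrakk> \<Longrightarrow> umult r (uadd p q) = uadd (umult r p) (umult r q)"
  by (cases p; cases q; cases r)
    (simp add: umult_def uadd_def smult_add_left smult_add_right mult_add_right a_ac distrib_left)

lemma uadj_umult:
  "\<lbrakk>p \<in> ucarrier; q \<in> ucarrier\<rbrakk> \<Longrightarrow> uadj (umult p q) = umult (uadj q) (uadj p)"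
  by (cases p; cases q) (simp add: uadj_def umult_def adj_add adj_smult adj_mult a_ac)

lemma uact_in [simp]: "p \<in> ucarrier \<Longrightarrow> x \<in> carrier A \<Longrightarrow> uact p x \<in> carrier A"
  by (cases p) (simp add: uact_def)

lemma uact_uadd:
  "\<lbrakk>p \<in> ucarrier; q \<in> ucarrier; x \<in> carrier A\<rbrakk> \<Longrightarrow> uact (uadd p q) x = uact p x \<oplus> uact q x"
  by (cases p; cases q) (simp add: uact_def uadd_def smult_add_left mult_add_left a_ac)

lemma uact_umult:
  "\<lbrakk>p \<in> ucarrier; q \<in> ucarrier; x \<in> carrier A\<rbrakk> \<Longrightarrow> uact (umult p q) x = uact p (uact q x)"
  by (cases p; cases q)
    (simp add: uact_def umult_def smult_add_right smult_mult mult_add_left mult_add_right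
      mult_smult_left mult_smult_right mult_assoc a_ac)

lemma uact_uscale:
  "\<lbrakk>p \<in> ucarrier; x \<in> carrier A\<rbrakk> \<Longrightarrow> uact (uscale c p) x = c \<odot> uact p x"
  by (cases p) (simp add: uact_def uscale_def smult_add_right smult_mult mult_smult_left)

lemma uact_adjoint:
  "\<lbrakk>p \<in> ucarrier; x \<in> carrier A; y \<in> carrier A\<rbrakk> \<Longrightarrow> (uact p x)\<^sup>\<star> \<otimes> y = x\<^sup>\<star> \<otimes> uact (uadj p) y"
  by (cases p)
    (simp add: uact_def uadj_def adj_add adj_smult adj_mult mult_add_left mult_add_right
      mult_smult_left mult_smult_right mult_assoc)

section \<open>The C*-norm of the unitization\<close>

lemma ubound_sum: "p \<in> ucarrier \<Longrightarrow> ubound p (cmod (fst p) + \<parallel>snd p\<parallel>)"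
proof (cases p)
  case (Pair c a)
  assume "p \<in> ucarrier"
  then have a: "a \<in> carrier A"
    by (simp add: Pair)
  have "\<parallel>uact p x\<parallel> \<le> (cmod c + \<parallel>a\<parallel>) * \<parallel>x\<parallel>" if "x \<in> carrier A" for x
    using a that nrm_triangle[of "c \<odot> x" "a \<otimes> x"] nrm_mult[of a x]
    by (simp add: Pair uact_def nrm_smult distrib_right)
  then show ?thesis
    using a by (simp add: ubound_def Pair)
qed

lemma ubound_nonneg: "ubound p K \<Longrightarrow> 0 \<le> K"
  unfolding ubound_def using norm_ge_zero order_trans by blast

lemma unrm_le: "ubound p K \<Longrightarrow> unrm p \<le> K"
  unfolding unrm_def by (intro cInf_lower) (auto intro: bdd_belowI ubound_nonneg)

lemma ubound_unrm:
  assumes "p \<in> ucarrier"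
  shows "ubound p (unrm p)"
proof -
  have ne: "{K. ubound p K} \<noteq> {}"
    using ubound_sum[OF assms] by blast
  have "cmod (fst p) \<le> unrm p"
    unfolding unrm_def by (intro cInf_greatest ne) (simp add: ubound_def)
  moreover have "\<parallel>uact p x\<parallel> \<le> unrm p * \<parallel>x\<parallel>" if x: "x \<in> carrier A" for x
  proof (cases "\<parallel>x\<parallel> = 0")
    case True
    then have "x = \<zero>"
      using x by (simp add: nrm_eq_0)
    then show ?thesis
      using assms by (cases p) (simp add: uact_def)
  next
    case False
    then have x0: "\<parallel>x\<parallel> > 0"
      using nrm_nonneg[OF x] by linarith
    have "\<parallel>uact p x\<parallel> / \<parallel>x\<parallel> \<le> unrm p"
      unfolding unrm_def using x x0
      by (intro cInf_greatest ne) (simp add: ubound_def pos_divide_le_eq)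
    then show ?thesis
      using x0 by (simp add: pos_divide_le_eq)
  qed
  ultimately show ?thesis
    by (simp add: ubound_def)
qed

lemma fst_le_unrm: "p \<in> ucarrier \<Longrightarrow> cmod (fst p) \<le> unrm p"
  using ubound_unrm[of p] by (simp add: ubound_def)

lemma uact_le: "\<lbrakk>p \<in> ucarrier; x \<in> carrier A\<rbrakk> \<Longrightarrow> \<parallel>uact p x\<parallel> \<le> unrm p * \<parallel>x\<parallel>"
  using ubound_unrm[of p] by (simp add: ubound_def)

lemma unrm_nonneg: "p \<in> ucarrier \<Longrightarrow> 0 \<le> unrm p"
  using ubound_nonneg[OF ubound_unrm] .

lemma unrm_uadd:
  assumes "p \<in> ucarrier" "q \<in> ucarrier"
  shows "unrm (uadd p q) \<le> unrm p + unrm q"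
proof (rule unrm_le)
  have "\<parallel>uact (uadd p q) x\<parallel> \<le> (unrm p + unrm q) * \<parallel>x\<parallel>" if x: "x \<in> carrier A" for x
    using nrm_triangle[of "uact p x" "uact q x"] uact_le[of p x] uact_le[of q x] assms x
    by (simp add: uact_uadd distrib_right)
  moreover have "cmod (fst p + fst q) \<le> unrm p + unrm q"
    using fst_le_unrm[OF assms(1)] fst_le_unrm[OF assms(2)] norm_triangle_ineq[of "fst p" "fst q"] by linarith
  ultimately show "ubound (uadd p q) (unrm p + unrm q)"
    by (simp add: ubound_def) (simp add: uadd_def)
qed

lemma unrm_umult:
  assumes "p \<in> ucarrier" "q \<in> ucarrier"
  shows "unrm (umult p q) \<le> unrm p * unrm q"
proof (rule unrm_le)
  have "\<parallel>uact (umult p q) x\<parallel> \<le> (unrm p * unrm q) * \<parallel>x\<parallel>" if x: "x \<in> carrier A" for x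
  proof -
    have "\<parallel>uact p (uact q x)\<parallel> \<le> unrm p * \<parallel>uact q x\<parallel>"
      using assms x by (intro uact_le) auto
    also have "\<dots> \<le> unrm p * (unrm q * \<parallel>x\<parallel>)"
      using assms x by (intro mult_left_mono uact_le unrm_nonneg)
    finally show ?thesis
      using assms x by (simp add: uact_umult mult.assoc)
  qed
  moreover have "cmod (fst p * fst q) \<le> unrm p * unrm q"
    using assms by (simp add: norm_mult mult_mono fst_le_unrm unrm_nonneg)
  ultimately show "ubound (umult p q) (unrm p * unrm q)"
    by (simp add: ubound_def) (simp add: umult_def)
qed

lemma unrm_uscale:
  assumes "p \<in> ucarrier"
  shows "unrm (uscale c p) = cmod c * unrm p"
proof -
  have le: "unrm (uscale c p) \<le> cmod c * unrm p" if "p \<in> ucarrier" for c p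
  proof (rule unrm_le)
    have "\<parallel>uact (uscale c p) x\<parallel> \<le> (cmod c * unrm p) * \<parallel>x\<parallel>" if x: "x \<in> carrier A" for x
      using mult_left_mono[OF uact_le[OF \<open>p \<in> ucarrier\<close> x], of "cmod c"] \<open>p \<in> ucarrier\<close> x
      by (simp add: uact_uscale nrm_smult mult.assoc)
    then show "ubound (uscale c p) (cmod c * unrm p)"
      using fst_le_unrm[OF \<open>p \<in> ucarrier\<close>]
      by (simp add: ubound_def) (simp add: uscale_def norm_mult mult_left_mono)
  qed
  have in_u: "uscale c p \<in> ucarrier"
    using assms by (cases p) (simp add: uscale_def)
  show ?thesis
  proof (cases "c = 0")
    case True
    then show ?thesis
      using le[OF assms, of c] unrm_nonneg[OF in_u] by simp
  next
    case False
    then have "uscale (1 / c) (uscale c p) = p"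
      using assms by (cases p) (simp add: uscale_def flip: smult_mult)
    then have "unrm p \<le> cmod (1 / c) * unrm (uscale c p)"
      using le[OF in_u, of "1 / c"] by simp
    then show ?thesis
      using False le[OF assms, of c] by (simp add: norm_divide field_simps)
  qed
qed

lemma uadj_in: "p \<in> ucarrier \<Longrightarrow> uadj p \<in> ucarrier"
  by (cases p) (simp add: uadj_def)

lemma umult_in: "p \<in> ucarrier \<Longrightarrow> q \<in> ucarrier \<Longrightarrow> umult p q \<in> ucarrier"
  by (cases p; cases q) (simp add: umult_def)

text \<open>The squared norm of \<open>uact p x\<close> is the norm of
  \<open>x\<^sup>\<star> \<otimes> uact (umult (uadj p) p) x\<close>, which is at most
  \<open>unrm (umult (uadj p) p)\<close> times the squared norm of \<open>x\<close>; the scalar part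
  satisfies the C*-identity by itself. This gives \<ge>, from it
  \<open>unrm (uadj p) \<le> unrm p\<close>, and from that \<le>.\<close>

lemma unrm_star:
  assumes p: "p \<in> ucarrier"
  shows "unrm (umult (uadj p) p) = (unrm p)\<^sup>2"
proof -
  have ge: "(unrm p)\<^sup>2 \<le> unrm (umult (uadj p) p)" if p: "p \<in> ucarrier" for p
  proof -
    let ?q = "umult (uadj p) p"
    have q: "?q \<in> ucarrier"
      using p by (intro umult_in uadj_in)
    have "(cmod (fst p))\<^sup>2 \<le> unrm ?q"
      using fst_le_unrm[OF q] by (simp add: umult_def uadj_def norm_mult power2_eq_square)
    then have 1: "cmod (fst p) \<le> sqrt (unrm ?q)"
      by (rule real_le_rsqrt)
    have 2: "\<parallel>uact p x\<parallel> \<le> sqrt (unrm ?q) * \<parallel>x\<parallel>" if x: "x \<in> carrier A" for x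
    proof -
      have "\<parallel>uact p x\<parallel>\<^sup>2 = \<parallel>x\<^sup>\<star> \<otimes> uact ?q x\<parallel>"
      proof -
        have "\<parallel>uact p x\<parallel>\<^sup>2 = \<parallel>(uact p x)\<^sup>\<star> \<otimes> uact p x\<parallel>"
          using p x by (simp only: cstar_identity uact_in)
        also have "(uact p x)\<^sup>\<star> \<otimes> uact p x = x\<^sup>\<star> \<otimes> uact (uadj p) (uact p x)"
          using p x by (intro uact_adjoint uact_in)
        finally show ?thesis
          using p x by (simp only: uact_umult uadj_in)
      qed
      also have "\<dots> \<le> \<parallel>x\<^sup>\<star>\<parallel> * \<parallel>uact ?q x\<parallel>"
        by (intro nrm_mult adj_closed uact_in x q)
      also have "\<dots> \<le> \<parallel>x\<parallel> * (unrm ?q * \<parallel>x\<parallel>)"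
        unfolding nrm_adj[OF x] by (intro mult_left_mono uact_le q x nrm_nonneg)
      also have "\<dots> = (sqrt (unrm ?q) * \<parallel>x\<parallel>)\<^sup>2"
        by (simp only: power_mult_distrib real_sqrt_pow2[OF unrm_nonneg[OF q]]) (simp only: power2_eq_square mult.left_commute)
      finally show ?thesis
        by (rule power2_le_imp_le) (intro mult_nonneg_nonneg real_sqrt_ge_zero unrm_nonneg q nrm_nonneg x)
    qed
    have "unrm p \<le> sqrt (unrm ?q)"
      using 1 2 by (intro unrm_le) (simp add: ubound_def)
    then have "(unrm p)\<^sup>2 \<le> (sqrt (unrm ?q))\<^sup>2"
      by (intro power_mono unrm_nonneg p)
    then show ?thesis
      by (simp only: real_sqrt_pow2[OF unrm_nonneg[OF q]])
  qed
  have le: "unrm p \<le> unrm (uadj p)" if p: "p \<in> ucarrier" for p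
  proof (cases "unrm p = 0")
    case False
    have "unrm p * unrm p \<le> unrm (uadj p) * unrm p"
      using ge[OF p] unrm_umult[OF uadj_in[OF p] p] by (simp add: power2_eq_square)
    then show ?thesis
      using False unrm_nonneg[OF p] by (simp add: less_le)
  qed (simp add: unrm_nonneg uadj_in p)
  have "uadj (uadj p) = p"
    using p by (cases p) (simp add: uadj_def)
  then have "unrm (uadj p) \<le> unrm p"
    using le[OF uadj_in[OF p]] by simp
  then have "unrm (umult (uadj p) p) \<le> unrm p * unrm p"
    using order_trans[OF unrm_umult[OF uadj_in[OF p] p] mult_right_mono] unrm_nonneg[OF p] by blast
  then show ?thesis
    using ge[OF p] by (simp add: power2_eq_square)
qed

text \<open>The lower bound comes from testing left multiplication on the adjoint of
  \<open>a\<close>.\<close>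

lemma unrm_embed:
  assumes a: "a \<in> carrier A"
  shows "unrm (0, a) = \<parallel>a\<parallel>"
proof (rule antisym)
  show "unrm (0, a) \<le> \<parallel>a\<parallel>"
    using unrm_le[OF ubound_sum[of "(0, a)"]] a by simp
  show "\<parallel>a\<parallel> \<le> unrm (0, a)"
  proof (cases "\<parallel>a\<parallel> = 0")
    case False
    have "\<parallel>a\<parallel> * \<parallel>a\<parallel> = \<parallel>uact (0, a) (a\<^sup>\<star>)\<parallel>"
      using cstar_identity[of "a\<^sup>\<star>"] a by (simp add: uact_def nrm_adj power2_eq_square)
    also have "\<dots> \<le> unrm (0, a) * \<parallel>a\<parallel>"
      using uact_le[of "(0, a)" "a\<^sup>\<star>"] a by (simp add: nrm_adj)
    finally show ?thesis
      using False nrm_nonneg[OF a] by (simp add: less_le)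
  qed (use a unrm_nonneg[of "(0, a)"] in simp)
qed

text \<open>Subtracting the scalar part, itself bounded by \<open>unrm p\<close>, costs a factor 2.
  The bound makes the coordinates of a Cauchy sequence Cauchy.\<close>

lemma snd_le_unrm:
  assumes "p \<in> ucarrier"
  shows "\<parallel>snd p\<parallel> \<le> 2 * unrm p"
proof (cases p)
  case (Pair c a)
  then have a: "a \<in> carrier A"
    using assms by simp
  have "(0, a) = uadd p (- c, \<zero>)"
    using a by (simp add: uadd_def Pair)
  then have "\<parallel>a\<parallel> \<le> unrm p + unrm (- c, \<zero>)"
    using unrm_uadd[OF assms, of "(- c, \<zero>)"] by (simp add: flip: unrm_embed[OF a])
  moreover have "unrm (- c, \<zero>) \<le> cmod c"
    using unrm_le[OF ubound_sum[of "(- c, \<zero>)"]] by simp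
  ultimately show ?thesis
    using fst_le_unrm[OF assms] by (simp add: Pair)
qed

lemma unrm_le_sum: "p \<in> ucarrier \<Longrightarrow> unrm p \<le> cmod (fst p) + \<parallel>snd p\<parallel>"
  by (rule unrm_le[OF ubound_sum])

lemma Cauchy_limit:
  assumes X: "\<And>n. X n \<in> carrier A"
    and C: "\<And>e. e > 0 \<Longrightarrow> \<exists>M. \<forall>m\<ge>M. \<forall>n\<ge>M. \<parallel>X m \<ominus> X n\<parallel> < e"
  obtains L where "L \<in> carrier A" "(\<lambda>n. \<parallel>X n \<ominus> L\<parallel>) \<longlonglongrightarrow> 0"
proof -
  interpret Metric_space "carrier A" "cdist A"
    by (rule Metric_space_cdist)
  have "MCauchy X"
    unfolding MCauchy_def using X C by (auto simp: cdist_def)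
  then obtain L where L: "limitin mtopology X L sequentially"
    using complete unfolding mcomplete_def by blast
  then have LA: "L \<in> carrier A" and *: "\<And>e. e > 0 \<Longrightarrow> \<forall>\<^sub>F n in sequentially. X n \<in> carrier A \<and> cdist A (X n) L < e"
    by (auto simp: limitin_metric)
  have "(\<lambda>n. \<parallel>X n \<ominus> L\<parallel>) \<longlonglongrightarrow> 0"
  proof (rule tendstoI)
    fix e :: real assume "e > 0"
    from *[OF this] show "\<forall>\<^sub>F n in sequentially. dist \<parallel>X n \<ominus> L\<parallel> 0 < e"
      by eventually_elim (auto simp: cdist_def LA X)
  qed
  then show thesis
    using that LA by blast
qed

end

section \<open>Transfer to a real algebra type\<close>

text \<open>Witness for the non-emptiness of \<open>calg\<close>, available on every element
  type.\<close>

lemma cstar_algebra_trivial: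
  "cstar_algebra \<lparr>carrier = {x}, mult = \<lambda>_ _. x, one = x, zero = x, add = \<lambda>_ _. x,
    smult = \<lambda>_ _. x, adj = \<lambda>_. x, nrm = \<lambda>_. 0\<rparr>" (is "cstar_algebra ?A")
proof -
  have "abelian_group ?A"
    by (rule abelian_groupI) auto
  then have m: "module complex_ring ?A"
    by (intro moduleI cring_complex_ring) auto
  have "Metric_space (carrier ?A) (cdist ?A)"
    by unfold_locales (auto simp: cdist_def)
  then have "Metric_space.mcomplete (carrier ?A) (cdist ?A)"
    by (auto simp: Metric_space.mcomplete_def Metric_space.MCauchy_def Metric_space.limitin_metric
        cdist_def intro!: always_eventually)
  then show ?thesis
    by (intro cstar_algebra.intro m cstar_algebra_axioms.intro) auto
qed

text \<open>Elements of the product of the unitizations of all C*-algebras on a type form a ring on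
  a whole type, so that type-class reasoning applies to each single C*-algebra.\<close>

typedef 'a calg = "{A :: 'a cstar. cstar_algebra A}"
  by (rule exI, rule CollectI, rule cstar_algebra_trivial)

lemma cstar_Rep_calg: "cstar_algebra (Rep_calg A)"
  using Rep_calg by blast

lemma zero_Rep_calg: "\<zero>\<^bsub>Rep_calg A\<^esub> \<in> carrier (Rep_calg A)"
  using cstar_Rep_calg[of A] by (auto intro!: abelian_monoid.zero_closed abelian_group.axioms(1)
      module.axioms(2) cstar_algebra.axioms(1))

typedef 'a uprod = "{f :: 'a calg \<Rightarrow> complex \<times> 'a. \<forall>A. f A \<in> UNIV \<times> carrier (Rep_calg A)}"
proof
  show "(\<lambda>A. (0, \<zero>\<^bsub>Rep_calg A\<^esub>)) \<in> {f :: 'a calg \<Rightarrow> complex \<times> 'a. \<forall>A. f A \<in> UNIV \<times> carrier (Rep_calg A)}"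
    by (simp add: zero_Rep_calg)
qed

setup_lifting type_definition_uprod

lemma Rep_uprod_in: "Rep_uprod f A \<in> UNIV \<times> carrier (Rep_calg A)"
  using Rep_uprod by blast

lemma uprod_eqI: "(\<And>A. Rep_uprod f A = Rep_uprod g A) \<Longrightarrow> f = g"
  by (simp add: Rep_uprod_inject[symmetric] fun_eq_iff)

context cstar_algebra
begin

lemma uadd_in: "p \<in> ucarrier \<Longrightarrow> q \<in> ucarrier \<Longrightarrow> uadd p q \<in> ucarrier"
  by (cases p; cases q) (simp add: uadd_def)

lemma uscale_in: "p \<in> ucarrier \<Longrightarrow> uscale c p \<in> ucarrier"
  by (cases p) (simp add: uscale_def)

lemma uadd_commute: "p \<in> ucarrier \<Longrightarrow> q \<in> ucarrier \<Longrightarrow> uadd p q = uadd q p"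
  by (cases p; cases q) (simp add: uadd_def a_comm)

lemma uadd_assoc:
  "p \<in> ucarrier \<Longrightarrow> q \<in> ucarrier \<Longrightarrow> r \<in> ucarrier \<Longrightarrow> uadd (uadd p q) r = uadd p (uadd q r)"
  by (cases p; cases q; cases r) (simp add: uadd_def a_assoc)

lemma uadd_zero: "p \<in> ucarrier \<Longrightarrow> uadd (0, \<zero>) p = p"
  by (cases p) (simp add: uadd_def)

lemma uadd_uminus: "p \<in> ucarrier \<Longrightarrow> uadd (uscale (- 1) p) p = (0, \<zero>)"
  by (cases p) (simp add: uadd_def uscale_def smult_minus_one l_neg)

lemma uscale_uadd:
  "p \<in> ucarrier \<Longrightarrow> q \<in> ucarrier \<Longrightarrow> uscale c (uadd p q) = uadd (uscale c p) (uscale c q)"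
  by (cases p; cases q) (simp add: uadd_def uscale_def smult_add_right distrib_left)

lemma uscale_add: "p \<in> ucarrier \<Longrightarrow> uscale (c + d) p = uadd (uscale c p) (uscale d p)"
  by (cases p) (simp add: uadd_def uscale_def smult_add_left distrib_right)

lemma uscale_mult: "p \<in> ucarrier \<Longrightarrow> uscale (c * d) p = uscale c (uscale d p)"
  by (cases p) (simp add: uscale_def smult_mult)

lemma uscale_one: "p \<in> ucarrier \<Longrightarrow> uscale 1 p = p"
  by (cases p) (simp add: uscale_def)

lemma umult_one_left: "p \<in> ucarrier \<Longrightarrow> umult (1, \<zero>) p = p"
  by (cases p) (simp add: umult_def)

lemma umult_one_right: "p \<in> ucarrier \<Longrightarrow> umult p (1, \<zero>) = p"
  by (cases p) (simp add: umult_def)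

lemma umult_uscale_left:
  "p \<in> ucarrier \<Longrightarrow> q \<in> ucarrier \<Longrightarrow> umult (uscale c p) q = uscale c (umult p q)"
  by (cases p; cases q)
    (simp add: umult_def uscale_def smult_add_right mult_smult_left ac_simps flip: smult_mult)

lemma umult_uscale_right:
  "p \<in> ucarrier \<Longrightarrow> q \<in> ucarrier \<Longrightarrow> umult p (uscale c q) = uscale c (umult p q)"
  by (cases p; cases q)
    (simp add: umult_def uscale_def smult_add_right mult_smult_right ac_simps flip: smult_mult)

end

instantiation uprod :: (type) real_algebra_1
begin

lift_definition zero_uprod :: "'a uprod" is "\<lambda>A. (0, \<zero>\<^bsub>Rep_calg A\<^esub>)"
  by (simp add: zero_Rep_calg)

lift_definition one_uprod :: "'a uprod" is "\<lambda>A. (1, \<zero>\<^bsub>Rep_calg A\<^esub>)"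
  by (simp add: zero_Rep_calg)

lift_definition plus_uprod :: "'a uprod \<Rightarrow> 'a uprod \<Rightarrow> 'a uprod" is
  "\<lambda>f g A. cstar_algebra.uadd (Rep_calg A) (f A) (g A)"
  using cstar_algebra.uadd_in[OF cstar_Rep_calg] by blast

lift_definition times_uprod :: "'a uprod \<Rightarrow> 'a uprod \<Rightarrow> 'a uprod" is
  "\<lambda>f g A. cstar_algebra.umult (Rep_calg A) (f A) (g A)"
  using cstar_algebra.umult_in[OF cstar_Rep_calg] by blast

lift_definition scaleR_uprod :: "real \<Rightarrow> 'a uprod \<Rightarrow> 'a uprod" is
  "\<lambda>r f A. cstar_algebra.uscale (Rep_calg A) (complex_of_real r) (f A)"
  using cstar_algebra.uscale_in[OF cstar_Rep_calg] by blast

definition uminus_uprod :: "'a uprod \<Rightarrow> 'a uprod" where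
  "uminus_uprod f = (- 1) *\<^sub>R f"

definition minus_uprod :: "'a uprod \<Rightarrow> 'a uprod \<Rightarrow> 'a uprod" where
  "minus_uprod f g = f + - g"

instance
proof
  fix a b c :: "'a uprod" and r s :: real
  note [simp] = plus_uprod.rep_eq times_uprod.rep_eq scaleR_uprod.rep_eq zero_uprod.rep_eq
    one_uprod.rep_eq
  note [simp] = cstar_Rep_calg Rep_uprod_in and [simp del] = mem_Times_iff
  show "a + b + c = a + (b + c)"
    by (rule uprod_eqI) (simp add: cstar_algebra.uadd_assoc)
  show "a + b = b + a"
    by (rule uprod_eqI) (simp add: cstar_algebra.uadd_commute)
  show "0 + a = a"
    by (rule uprod_eqI) (simp add: cstar_algebra.uadd_zero)
  show "- a + a = 0"
    by (rule uprod_eqI) (simp add: uminus_uprod_def cstar_algebra.uadd_uminus)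
  show "a - b = a + - b"
    by (rule minus_uprod_def)
  show "r *\<^sub>R (a + b) = r *\<^sub>R a + r *\<^sub>R b"
    by (rule uprod_eqI) (simp add: cstar_algebra.uscale_uadd)
  show "(r + s) *\<^sub>R a = r *\<^sub>R a + s *\<^sub>R a"
    by (rule uprod_eqI) (simp add: cstar_algebra.uscale_add)
  show "r *\<^sub>R s *\<^sub>R a = (r * s) *\<^sub>R a"
    by (rule uprod_eqI) (simp add: cstar_algebra.uscale_mult)
  show "1 *\<^sub>R a = a"
    by (rule uprod_eqI) (simp add: cstar_algebra.uscale_one)
  show "a * b * c = a * (b * c)"
    by (rule uprod_eqI) (simp add: cstar_algebra.umult_assoc)
  show "(a + b) * c = a * c + b * c"
    by (rule uprod_eqI) (simp add: cstar_algebra.umult_uadd_left)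
  show "a * (b + c) = a * b + a * c"
    by (rule uprod_eqI) (simp add: cstar_algebra.umult_uadd_right)
  show "1 * a = a"
    by (rule uprod_eqI) (simp add: cstar_algebra.umult_one_left)
  show "a * 1 = a"
    by (rule uprod_eqI) (simp add: cstar_algebra.umult_one_right)
  show "r *\<^sub>R a * b = r *\<^sub>R (a * b)"
    by (rule uprod_eqI) (simp add: cstar_algebra.umult_uscale_left)
  show "a * r *\<^sub>R b = r *\<^sub>R (a * b)"
    by (rule uprod_eqI) (simp add: cstar_algebra.umult_uscale_right)
  have "Rep_uprod (0 :: 'a uprod) \<noteq> Rep_uprod 1"
    by (simp add: fun_eq_iff)
  then show "(0 :: 'a uprod) \<noteq> 1"
    by metis
qed

end

lift_definition ustar :: "'a uprod \<Rightarrow> 'a uprod" is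
  "\<lambda>f A. cstar_algebra.uadj (Rep_calg A) (f A)"
  using cstar_algebra.uadj_in[OF cstar_Rep_calg] by blast

text \<open>Complex scalars act on \<open>uprod\<close> only through multiplication by this central
  element.\<close>

lift_definition uimag :: "'a uprod" is "\<lambda>A. (\<i>, \<zero>\<^bsub>Rep_calg A\<^esub>)"
  by (simp add: zero_Rep_calg)

context cstar_algebra
begin

lemma uadj_uadd: "p \<in> ucarrier \<Longrightarrow> q \<in> ucarrier \<Longrightarrow> uadj (uadd p q) = uadd (uadj p) (uadj q)"
  by (cases p; cases q) (simp add: uadj_def uadd_def adj_add)

lemma uadj_uadj: "p \<in> ucarrier \<Longrightarrow> uadj (uadj p) = p"
  by (cases p) (simp add: uadj_def)

lemma uadj_uscale:
  "p \<in> ucarrier \<Longrightarrow> uadj (uscale (complex_of_real r) p) = uscale (complex_of_real r) (uadj p)"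
  by (cases p) (simp add: uadj_def uscale_def adj_smult)

lemma uimag_left: "p \<in> ucarrier \<Longrightarrow> umult (\<i>, \<zero>) p = uscale \<i> p"
  by (cases p) (simp add: umult_def uscale_def)

lemma uimag_right: "p \<in> ucarrier \<Longrightarrow> umult p (\<i>, \<zero>) = uscale \<i> p"
  by (cases p) (simp add: umult_def uscale_def)

lemma Cauchy_limit_u:
  assumes X: "\<And>n. X n \<in> ucarrier"
    and C: "\<And>e. e > 0 \<Longrightarrow> \<exists>M. \<forall>m\<ge>M. \<forall>n\<ge>M. unrm (uadd (X m) (uscale (- 1) (X n))) < e"
  obtains L where "L \<in> ucarrier" "(\<lambda>n. unrm (uadd (X n) (uscale (- 1) L))) \<longlonglongrightarrow> 0"
proof -
  have diff: "uadd p (uscale (- 1) q) = (fst p - fst q, snd p \<ominus> snd q)"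
    if "p \<in> ucarrier" "q \<in> ucarrier" for p q
    using that by (cases p; cases q) (simp add: uadd_def uscale_def smult_minus_one a_minus_def)
  have snd_in: "snd (X n) \<in> carrier A" for n
    using X[of n] by (simp add: mem_Times_iff)
  have diff_in: "uadd p (uscale (- 1) q) \<in> ucarrier" if "p \<in> ucarrier" "q \<in> ucarrier" for p q
    using that by (intro uadd_in uscale_in)
  have "Cauchy (\<lambda>n. fst (X n))"
  proof (rule CauchyI)
    fix e :: real assume "e > 0"
    then obtain M where M: "\<And>m n. m \<ge> M \<Longrightarrow> n \<ge> M \<Longrightarrow> unrm (uadd (X m) (uscale (- 1) (X n))) < e"
      using C by blast
    have "norm (fst (X m) - fst (X n)) < e" if "m \<ge> M" "n \<ge> M" for m n
      using fst_le_unrm[OF diff_in[OF X[of m] X[of n]]] M[OF that] by (simp only: diff[OF X X] fst_conv)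
    then show "\<exists>M. \<forall>m\<ge>M. \<forall>n\<ge>M. norm (fst (X m) - fst (X n)) < e"
      by blast
  qed
  then obtain c where c: "(\<lambda>n. fst (X n)) \<longlonglongrightarrow> c"
    using Cauchy_convergent convergentD by blast
  obtain a where a: "a \<in> carrier A" "(\<lambda>n. \<parallel>snd (X n) \<ominus> a\<parallel>) \<longlonglongrightarrow> 0"
  proof (rule Cauchy_limit[of "\<lambda>n. snd (X n)", OF snd_in])
    fix e :: real assume "e > 0"
    then obtain M where M: "\<And>m n. m \<ge> M \<Longrightarrow> n \<ge> M \<Longrightarrow> unrm (uadd (X m) (uscale (- 1) (X n))) < e / 2"
      using C[of "e / 2"] by (metis half_gt_zero)
    have "\<parallel>snd (X m) \<ominus> snd (X n)\<parallel> < e" if "m \<ge> M" "n \<ge> M" for m n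
      using snd_le_unrm[OF diff_in[OF X[of m] X[of n]]] M[OF that] by (simp only: diff[OF X X] snd_conv)
    then show "\<exists>M. \<forall>m\<ge>M. \<forall>n\<ge>M. \<parallel>snd (X m) \<ominus> snd (X n)\<parallel> < e"
      by blast
  qed
  have ca: "(c, a) \<in> ucarrier"
    using a by simp
  have le: "unrm (uadd (X n) (uscale (- 1) (c, a))) \<le> cmod (fst (X n) - c) + \<parallel>snd (X n) \<ominus> a\<parallel>" for n
    using unrm_le_sum[OF diff_in[OF X[of n] ca]] by (simp only: diff[OF X ca] fst_conv snd_conv)
  have lim: "(\<lambda>n. cmod (fst (X n) - c) + \<parallel>snd (X n) \<ominus> a\<parallel>) \<longlonglongrightarrow> 0"
    by (intro tendsto_add_zero tendsto_norm_zero LIM_zero c a(2))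
  have "(\<lambda>n. unrm (uadd (X n) (uscale (- 1) (c, a)))) \<longlonglongrightarrow> 0"
    by (rule tendsto_sandwich[OF always_eventually always_eventually tendsto_const lim])
      (intro allI unrm_nonneg diff_in X ca le)+
  then show thesis
    using that ca by blast
qed

end

text \<open>\<open>calg\<close> collects records of the unextended type \<open>'a cstar\<close>;
  fixing that type here makes \<open>Abs_calg A\<close> available.\<close>

locale cstar_alg = cstar_algebra A for A :: "'a cstar" (structure)
begin

definition coord :: "'a uprod \<Rightarrow> complex \<times> 'a" where
  "coord f = Rep_uprod f (Abs_calg A)"

definition upnorm :: "'a uprod \<Rightarrow> real" where
  "upnorm f = unrm (coord f)"

lemma Rep_Abs [simp]: "Rep_calg (Abs_calg A) = A"
  by (rule Abs_calg_inverse) (rule CollectI, rule cstar_algebra_axioms)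

lemma coord_in: "coord f \<in> ucarrier"
  using Rep_uprod_in[of f "Abs_calg A"] by (simp add: coord_def)

lemma coord_ops:
  "coord 0 = (0, \<zero>)" "coord 1 = (1, \<zero>)" "coord uimag = (\<i>, \<zero>)"
  "coord (f + g) = uadd (coord f) (coord g)"
  "coord (f * g) = umult (coord f) (coord g)"
  "coord (r *\<^sub>R f) = uscale (complex_of_real r) (coord f)"
  "coord (ustar f) = uadj (coord f)"
  by (simp_all add: coord_def zero_uprod.rep_eq one_uprod.rep_eq uimag.rep_eq plus_uprod.rep_eq
      times_uprod.rep_eq scaleR_uprod.rep_eq ustar.rep_eq)

lemma coord_diff: "coord (f - g) = uadd (coord f) (uscale (- 1) (coord g))"
proof -
  have "f - g = f + (- 1) *\<^sub>R g"
    by simp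
  then show ?thesis
    by (simp only: coord_ops of_real_minus of_real_1)
qed

lemma coord_surj: "p \<in> ucarrier \<Longrightarrow> \<exists>f. coord f = p"
proof -
  assume p: "p \<in> ucarrier"
  define f where "f = (\<lambda>B. if B = Abs_calg A then p else Rep_uprod 0 B)"
  have "f \<in> {f. \<forall>A. f A \<in> UNIV \<times> carrier (Rep_calg A)}"
    using p Rep_uprod_in[of 0] by (simp add: f_def del: mem_Times_iff) blast
  then have "Rep_uprod (Abs_uprod f) = f"
    by (rule Abs_uprod_inverse)
  then have "coord (Abs_uprod f) = p"
    by (simp add: coord_def f_def)
  then show ?thesis ..
qed

text \<open>The identities for \<open>ustar\<close> and \<open>uimag\<close> are required as
  equations, so they are checked in every factor; the conditions on the seminorm concern the factor
  of \<open>A\<close> only.\<close>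

sublocale up: cstar_seminorm upnorm ustar uimag
proof
  fix x y :: "'a uprod" and r :: real
  note L = cstar_Rep_calg Rep_uprod_in
  note [simp del] = mem_Times_iff
  note [simp] = plus_uprod.rep_eq times_uprod.rep_eq scaleR_uprod.rep_eq zero_uprod.rep_eq
    one_uprod.rep_eq ustar.rep_eq uimag.rep_eq
  show "upnorm (x + y) \<le> upnorm x + upnorm y"
    by (simp add: upnorm_def coord_ops unrm_uadd coord_in)
  show "upnorm (r *\<^sub>R x) = \<bar>r\<bar> * upnorm x"
    by (simp add: upnorm_def coord_ops unrm_uscale coord_in)
  show "upnorm (x * y) \<le> upnorm x * upnorm y"
    by (simp add: upnorm_def coord_ops unrm_umult coord_in)
  show "upnorm 1 \<le> 1"
    using unrm_le_sum[of "(1, \<zero>)"] by (simp add: upnorm_def coord_ops)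
  show "upnorm (ustar x * x) = (upnorm x)\<^sup>2"
    by (simp add: upnorm_def coord_ops unrm_star coord_in)
  show "ustar (x + y) = ustar x + ustar y"
    by (rule uprod_eqI) (simp add: cstar_algebra.uadj_uadd L)
  show "ustar (x * y) = ustar y * ustar x"
    by (rule uprod_eqI) (simp add: cstar_algebra.uadj_umult L)
  show "ustar (ustar x) = x"
    by (rule uprod_eqI) (simp add: cstar_algebra.uadj_uadj L)
  show "ustar (r *\<^sub>R x) = r *\<^sub>R ustar x"
    by (rule uprod_eqI) (simp add: cstar_algebra.uadj_uscale L)
  have "ustar uimag = (- 1) *\<^sub>R (uimag :: 'a uprod)"
    by (rule uprod_eqI, subst scaleR_uprod.rep_eq) (simp add: cstar_algebra.uadj_def cstar_algebra.uscale_def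
        cstar_algebra.adj_zero cstar_algebra.smult_zero L)
  then show "ustar uimag = - (uimag :: 'a uprod)"
    by simp
  show "uimag * x = x * uimag"
    by (rule uprod_eqI) (simp add: cstar_algebra.uimag_left cstar_algebra.uimag_right L)
  have "uimag * uimag = (- 1) *\<^sub>R (1 :: 'a uprod)"
  proof (rule uprod_eqI)
    fix B :: "'a calg"
    interpret B: cstar_algebra "Rep_calg B"
      by (rule cstar_Rep_calg)
    show "Rep_uprod (uimag * uimag) B = Rep_uprod ((- 1) *\<^sub>R 1) B"
      by (subst scaleR_uprod.rep_eq) (simp add: B.umult_def B.uscale_def)
  qed
  then show "uimag * uimag = - (1 :: 'a uprod)"
    by simp
next
  fix X :: "nat \<Rightarrow> 'a uprod"
  assume C: "\<And>e. e > 0 \<Longrightarrow> \<exists>M. \<forall>m\<ge>M. \<forall>n\<ge>M. upnorm (X m - X n) < e"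
  obtain L where L: "L \<in> ucarrier" "(\<lambda>n. unrm (uadd (coord (X n)) (uscale (- 1) L))) \<longlonglongrightarrow> 0"
    by (rule Cauchy_limit_u[of "\<lambda>n. coord (X n)", OF coord_in]) (use C in \<open>simp_all add: upnorm_def coord_diff\<close>)
  obtain f where "coord f = L"
    using coord_surj[OF L(1)] by blast
  then show "\<exists>L. (\<lambda>n. upnorm (X n - L)) \<longlonglongrightarrow> 0"
    using L(2) by (auto simp: upnorm_def coord_diff)
qed

end

section \<open>Positive elements and completely positive maps\<close>

definition positive_elem :: "('a, 'm) cstar_scheme \<Rightarrow> 'a \<Rightarrow> bool" where
  "positive_elem A h \<longleftrightarrow> (\<exists>y\<in>carrier A. h = y\<^sup>\<star>\<^bsub>A\<^esub> \<otimes>\<^bsub>A\<^esub> y)"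

context cstar_alg
begin

text \<open>The other factors are filled with 0, so that \<open>emb\<close> respects sums, products
  and adjoints exactly and not just up to \<doteq>.\<close>

definition emb :: "'a \<Rightarrow> 'a uprod" where
  "emb a = Abs_uprod (\<lambda>B. if B = Abs_calg A then (0, a) else Rep_uprod 0 B)"

lemma Rep_emb:
  assumes "a \<in> carrier A"
  shows "Rep_uprod (emb a) B = (if B = Abs_calg A then (0, a) else (0, \<zero>\<^bsub>Rep_calg B\<^esub>))"
proof -
  have "(\<lambda>B. if B = Abs_calg A then (0, a) else Rep_uprod 0 B)
      \<in> {f. \<forall>A. f A \<in> UNIV \<times> carrier (Rep_calg A)}"
    using assms Rep_uprod_in[of 0] by (simp del: mem_Times_iff) blast
  then show ?thesis
    unfolding emb_def by (subst Abs_uprod_inverse) (auto simp: zero_uprod.rep_eq)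
qed

lemma coord_emb: "a \<in> carrier A \<Longrightarrow> coord (emb a) = (0, a)"
  by (simp add: coord_def Rep_emb)

lemma upnorm_emb [simp]: "a \<in> carrier A \<Longrightarrow> upnorm (emb a) = \<parallel>a\<parallel>"
  by (simp add: upnorm_def coord_emb unrm_embed)

lemma uprod_eqI': "coord f = coord g \<Longrightarrow>
    (\<And>B. B \<noteq> Abs_calg A \<Longrightarrow> cstar_algebra (Rep_calg B) \<Longrightarrow> Rep_uprod f B = Rep_uprod g B) \<Longrightarrow> f = g"
proof (rule uprod_eqI)
  fix B
  assume "coord f = coord g"
    "\<And>B. B \<noteq> Abs_calg A \<Longrightarrow> cstar_algebra (Rep_calg B) \<Longrightarrow> Rep_uprod f B = Rep_uprod g B"
  then show "Rep_uprod f B = Rep_uprod g B"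
    using cstar_Rep_calg[of B] by (cases "B = Abs_calg A") (simp_all add: coord_def)
qed

lemma emb_add: "\<lbrakk>a \<in> carrier A; b \<in> carrier A\<rbrakk> \<Longrightarrow> emb (a \<oplus> b) = emb a + emb b"
proof (rule uprod_eqI')
  assume ab: "a \<in> carrier A" "b \<in> carrier A"
  then show "coord (emb (a \<oplus> b)) = coord (emb a + emb b)"
    by (simp add: coord_ops coord_emb uadd_def)
  fix B :: "'a calg" assume B: "B \<noteq> Abs_calg A" "cstar_algebra (Rep_calg B)"
  interpret B: cstar_algebra "Rep_calg B" by fact
  show "Rep_uprod (emb (a \<oplus> b)) B = Rep_uprod (emb a + emb b) B"
    using ab B(1) by (simp add: Rep_emb plus_uprod.rep_eq B.uadd_def)
qed

lemma mult_emb: "a \<in> carrier A \<Longrightarrow> f * emb a = emb (uact (coord f) a)"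
proof (rule uprod_eqI')
  assume a: "a \<in> carrier A"
  then show "coord (f * emb a) = coord (emb (uact (coord f) a))"
    using coord_in[of f] by (cases "coord f") (simp add: coord_ops coord_emb umult_def uact_def)
  fix B :: "'a calg" assume B: "B \<noteq> Abs_calg A" "cstar_algebra (Rep_calg B)"
  interpret B: cstar_algebra "Rep_calg B" by fact
  show "Rep_uprod (f * emb a) B = Rep_uprod (emb (uact (coord f) a)) B"
    using a B(1) coord_in[of f] Rep_uprod_in[of f B]
    by (cases "coord f"; cases "Rep_uprod f B") (simp add: Rep_emb times_uprod.rep_eq B.umult_def uact_in)
qed

lemma emb_mult: "\<lbrakk>a \<in> carrier A; b \<in> carrier A\<rbrakk> \<Longrightarrow> emb (a \<otimes> b) = emb a * emb b"
  by (simp add: mult_emb coord_emb uact_def)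

lemma emb_adj: "a \<in> carrier A \<Longrightarrow> emb (a\<^sup>\<star>) = ustar (emb a)"
proof (rule uprod_eqI')
  assume a: "a \<in> carrier A"
  then show "coord (emb (a\<^sup>\<star>)) = coord (ustar (emb a))"
    by (simp add: coord_ops coord_emb uadj_def)
  fix B :: "'a calg" assume B: "B \<noteq> Abs_calg A" "cstar_algebra (Rep_calg B)"
  interpret B: cstar_algebra "Rep_calg B" by fact
  show "Rep_uprod (emb (a\<^sup>\<star>)) B = Rep_uprod (ustar (emb a)) B"
    using a B(1) by (simp add: Rep_emb ustar.rep_eq B.uadj_def)
qed

lemma emb_smult_real: "a \<in> carrier A \<Longrightarrow> emb (complex_of_real r \<odot> a) = r *\<^sub>R emb a"
proof (rule uprod_eqI')
  assume a: "a \<in> carrier A"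
  then show "coord (emb (complex_of_real r \<odot> a)) = coord (r *\<^sub>R emb a)"
    by (simp add: coord_ops coord_emb uscale_def)
  fix B :: "'a calg" assume B: "B \<noteq> Abs_calg A" "cstar_algebra (Rep_calg B)"
  interpret B: cstar_algebra "Rep_calg B" by fact
  show "Rep_uprod (emb (complex_of_real r \<odot> a)) B = Rep_uprod (r *\<^sub>R emb a) B"
    using a B(1) by (simp add: Rep_emb scaleR_uprod.rep_eq B.uscale_def)
qed

lemma emb_smult_ii: "a \<in> carrier A \<Longrightarrow> emb (\<i> \<odot> a) = uimag * emb a"
  by (simp add: mult_emb coord_ops uact_def)

lemma emb_a_inv: "a \<in> carrier A \<Longrightarrow> emb (\<ominus> a) = - emb a"
  using emb_smult_real[of a "- 1"] by (simp add: smult_minus_one)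

lemma emb_minus: "\<lbrakk>a \<in> carrier A; b \<in> carrier A\<rbrakk> \<Longrightarrow> emb (a \<ominus> b) = emb a - emb b"
  by (simp add: a_minus_def emb_add emb_a_inv)

lemma eq_iff_nrm: "\<lbrakk>a \<in> carrier A; b \<in> carrier A\<rbrakk> \<Longrightarrow> \<parallel>a \<ominus> b\<parallel> = 0 \<longleftrightarrow> a = b"
  using Metric_space.zero[OF Metric_space_cdist, of a b] by (simp add: cdist_def)

lemma emb_eqv_iff: "\<lbrakk>a \<in> carrier A; b \<in> carrier A\<rbrakk> \<Longrightarrow> up.eqv (emb a) (emb b) \<longleftrightarrow> a = b"
  by (simp add: up.eqv_def eq_iff_nrm flip: emb_minus)

lemma emb_inject: "\<lbrakk>a \<in> carrier A; b \<in> carrier A\<rbrakk> \<Longrightarrow> emb a = emb b \<longleftrightarrow> a = b"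
  using emb_eqv_iff[of a b] up.eqv_refl[of "emb a"] by auto

text \<open>\<open>A\<close> is an ideal of its unitization. Applied to the factorisation of the
  approximate unit through \<open>emb x\<close>, this brings the approximate unit back into
  \<open>A\<close>.\<close>

lemma emb_mult_right: "a \<in> carrier A \<Longrightarrow> \<exists>b\<in>carrier A. emb a * f = emb b"
proof -
  assume a: "a \<in> carrier A"
  have "emb a * f = ustar (ustar f * emb (a\<^sup>\<star>))"
    using a by (simp add: up.st_mult emb_adj)
  also have "\<dots> = emb ((uact (coord (ustar f)) (a\<^sup>\<star>))\<^sup>\<star>)"
    using a by (simp only: mult_emb adj_closed emb_adj[OF uact_in[OF coord_in]])
  finally show ?thesis
    using a uact_in[OF coord_in] by blast
qed

lemma tends_emb_iff: "\<lbrakk>\<And>n. X n \<in> carrier A; a \<in> carrier A\<rbrakk> \<Longrightarrow>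
    up.tends (\<lambda>n. emb (X n)) (emb a) \<longleftrightarrow> (\<lambda>n. \<parallel>X n \<ominus> a\<parallel>) \<longlonglongrightarrow> 0"
  by (simp add: up.tends_def flip: emb_minus)

lemma positive_elem_in: "positive_elem A h \<Longrightarrow> h \<in> carrier A"
  by (auto simp: positive_elem_def)

text \<open>From left to right, the root \<open>s\<close> of \<open>emb h\<close> may a priori have
  a scalar part \<open>c\<close>. As \<open>c * c\<close> is the scalar part of
  \<open>s * s\<close>, which is \<doteq> to \<open>emb h\<close>, it vanishes, and the root lies in
  \<open>A\<close>.\<close>

lemma pos_emb_iff:
  assumes h: "h \<in> carrier A"
  shows "up.pos (emb h) \<longleftrightarrow> positive_elem A h"
proof
  assume "positive_elem A h"
  then obtain y where "y \<in> carrier A" "h = y\<^sup>\<star> \<otimes> y"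
    by (auto simp: positive_elem_def)
  then show "up.pos (emb h)"
    using up.pos_star_mult by (simp add: emb_mult emb_adj)
next
  assume "up.pos (emb h)"
  then obtain s where s: "ustar s = s" "up.eqv (s * s) (emb h)" "up.pos s"
      "\<forall>z. up.commuting z (emb h) \<longrightarrow> up.commuting z s"
    by (rule up.pos_sqrt)
  obtain c a where ca: "coord s = (c, a)"
    by fastforce
  have a: "a \<in> carrier A"
    using coord_in[of s] ca by simp
  have in_u: "coord (s * s - emb h) \<in> ucarrier"
    by (rule coord_in)
  have "cmod (fst (coord (s * s - emb h))) \<le> 0"
    using fst_le_unrm[OF in_u] s(2) by (simp only: up.eqv_def upnorm_def)
  then have "c = 0"
    using h by (simp add: coord_diff coord_ops coord_emb ca umult_def uadd_def uscale_def)
  then have "up.eqv s (emb a)"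
    using a ca unrm_embed[of \<zero>]
    by (simp add: up.eqv_def upnorm_def coord_diff coord_emb uadd_def uscale_def smult_minus_one r_neg)
  then have sa: "up.eqv (s * s) (emb (a\<^sup>\<star> \<otimes> a))"
    using a up.eqv_st[of s "emb a"] by (auto simp: emb_mult emb_adj s(1) intro: up.eqv_mult)
  have "up.eqv (emb h) (emb (a\<^sup>\<star> \<otimes> a))"
    by (rule up.eqv_trans[OF up.eqv_sym[OF s(2)] sa])
  then have "h = a\<^sup>\<star> \<otimes> a"
    using a h by (simp add: emb_eqv_iff)
  then show "positive_elem A h"
    using a by (auto simp: positive_elem_def)
qed

lemma positive_add: "positive_elem A h \<Longrightarrow> positive_elem A g \<Longrightarrow> positive_elem A (h \<oplus> g)"
  using up.pos_add[of "emb h" "emb g"] pos_emb_iff positive_elem_in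
  by (metis emb_add add.m_closed)

lemma positive_adj: "positive_elem A h \<Longrightarrow> h\<^sup>\<star> = h"
  by (auto simp: positive_elem_def adj_mult)

lemma positive_limit:
  assumes "\<And>n. positive_elem A (X n)" "h \<in> carrier A" "up.tends (\<lambda>n. emb (X n)) (emb h)" "h\<^sup>\<star> = h"
  shows "positive_elem A h"
proof -
  have "up.pos (emb h)"
  proof (rule up.pos_tends[OF assms(3)])
    show "up.pos (emb (X n))" for n
      using assms(1) positive_elem_in pos_emb_iff by blast
    show "ustar (emb h) = emb h"
      using assms by (simp flip: emb_adj)
  qed
  then show ?thesis
    using assms(2) pos_emb_iff by blast
qed

lemma approximate_unit:
  assumes x: "x \<in> carrier A" and "0 < \<delta>"
  obtains e where "e \<in> carrier A" "e\<^sup>\<star> = e" "\<parallel>e\<parallel> \<le> 1" "\<parallel>e \<otimes> x \<ominus> x\<parallel> \<le> \<delta>"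
proof -
  obtain f y where f: "ustar f = f" "upnorm f \<le> 1" "upnorm (f * emb x - emb x) \<le> \<delta>" "f = emb x * y"
    by (rule up.approximate_unit[OF \<open>0 < \<delta>\<close>])
  obtain e where e: "e \<in> carrier A" "f = emb e"
    using emb_mult_right[OF x, of y] f(4) by blast
  have "e\<^sup>\<star> = e"
    using f(1) e by (simp add: emb_inject flip: emb_adj)
  moreover have "\<parallel>e\<parallel> \<le> 1"
    using f(2) upnorm_emb[OF e(1)] by (simp only: e(2))
  moreover have "emb (e \<otimes> x \<ominus> x) = f * emb x - emb x"
    using e x by (simp add: emb_minus emb_mult)
  then have "\<parallel>e \<otimes> x \<ominus> x\<parallel> \<le> \<delta>"
    using f(3) upnorm_emb[of "e \<otimes> x \<ominus> x"] e x by simp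
  ultimately show thesis
    using that e(1) by blast
qed

text \<open>Completing the square: with \<open>d\<close> the sum of the squares of \<open>v\<close>
  and \<open>v'\<close>, the element in question is the square of the column
  \<open>(u - v c, u' - v' c)\<close> plus a conjugate of \<open>1 - d\<close> by \<open>c\<close>,
  and \<open>d\<close> has norm at most 1. The columns have length 2 because they come from 2 by 2
  matrices.\<close>

lemma Cauchy_Schwarz:
  assumes u: "u \<in> carrier A" "u' \<in> carrier A" and v: "v \<in> carrier A" "v' \<in> carrier A"
    and le: "\<parallel>v\<^sup>\<star> \<otimes> v \<oplus> v'\<^sup>\<star> \<otimes> v'\<parallel> \<le> 1"
    and c: "c = v\<^sup>\<star> \<otimes> u \<oplus> v'\<^sup>\<star> \<otimes> u'"
  shows "positive_elem A ((u\<^sup>\<star> \<otimes> u \<oplus> u'\<^sup>\<star> \<otimes> u') \<ominus> c\<^sup>\<star> \<otimes> c)"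
proof -
  have cA: "c \<in> carrier A"
    using u v c by simp
  let ?u = "emb u" and ?u' = "emb u'" and ?v = "emb v" and ?v' = "emb v'" and ?c = "emb c"
  define d where "d = ustar ?v * ?v + ustar ?v' * ?v'"
  have "d = emb (v\<^sup>\<star> \<otimes> v \<oplus> v'\<^sup>\<star> \<otimes> v')"
    using v by (simp add: d_def emb_add emb_mult emb_adj)
  then have "upnorm d \<le> 1"
    using v le by simp
  then have "up.pos (1 - d)"
    using up.pos_scalar_minus[of d 1] by (simp add: d_def up.st_add up.st_mult)
  then have conj: "up.pos (ustar ?c * (1 - d) * ?c)"
    by (rule up.pos_conjugate)
  have ce: "?c = ustar ?v * ?u + ustar ?v' * ?u'"
    using u v by (simp add: c emb_add emb_mult emb_adj)
  have ce': "ustar ?c = ustar ?u * ?v + ustar ?u' * ?v'"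
    by (simp add: ce up.st_add up.st_mult)
  have "(ustar ?u * ?u + ustar ?u' * ?u') - ustar ?c * ?c
      = (ustar (?u - ?v * ?c) * (?u - ?v * ?c) + ustar (?u' - ?v' * ?c) * (?u' - ?v' * ?c))
        + ustar ?c * (1 - d) * ?c"
  proof -
    have "ustar (?u - ?v * ?c) * (?u - ?v * ?c) + ustar (?u' - ?v' * ?c) * (?u' - ?v' * ?c)
      = (ustar ?u * ?u + ustar ?u' * ?u') - (ustar ?u * ?v + ustar ?u' * ?v') * ?c
        - ustar ?c * (ustar ?v * ?u + ustar ?v' * ?u') + ustar ?c * d * ?c"
      by (simp add: up.st_diff up.st_mult d_def algebra_simps)
    then show ?thesis
      by (simp only: ce[symmetric] ce'[symmetric]) (simp add: algebra_simps)
  qed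
  moreover have "up.pos \<dots>"
    by (intro up.pos_add up.pos_star_mult conj)
  ultimately have "up.pos (emb ((u\<^sup>\<star> \<otimes> u \<oplus> u'\<^sup>\<star> \<otimes> u') \<ominus> c\<^sup>\<star> \<otimes> c))"
    using u cA by (simp add: emb_add emb_mult emb_adj emb_minus)
  then show ?thesis
    using u cA pos_emb_iff by simp
qed

end


abbreviation (in cstar_alg) dst :: "'a \<Rightarrow> 'a \<Rightarrow> real" where
  "dst x y \<equiv> \<parallel>x \<ominus> y\<parallel>"

lemma LIMSEQ_zero_squeeze:
  fixes f g :: "nat \<Rightarrow> real"
  assumes "g \<longlonglongrightarrow> 0" "\<And>n. n \<ge> k \<Longrightarrow> 0 \<le> f n" "\<And>n. n \<ge> k \<Longrightarrow> f n \<le> g n"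
  shows "f \<longlonglongrightarrow> 0"
  using assms by (intro tendsto_sandwich[OF _ _ tendsto_const assms(1)]) (auto simp: eventually_sequentially)

lemma linear_mapD:
  assumes "linear_map A B f"
  shows "x \<in> carrier A \<Longrightarrow> f x \<in> carrier B"
    "\<lbrakk>x \<in> carrier A; y \<in> carrier A\<rbrakk> \<Longrightarrow> f (x \<oplus>\<^bsub>A\<^esub> y) = f x \<oplus>\<^bsub>B\<^esub> f y"
    "x \<in> carrier A \<Longrightarrow> f (c \<odot>\<^bsub>A\<^esub> x) = c \<odot>\<^bsub>B\<^esub> f x"
  using assms by (auto simp: linear_map_def)

section \<open>Single c.p.c. maps\<close>

locale cpc_map = A: cstar_alg A + B: cstar_alg B
  for A :: "'a cstar" (structure) and B :: "'b cstar" and f :: "'a \<Rightarrow> 'b" +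
  assumes cpc: "cpc A B f"
begin

lemma linear: "linear_map A B f"
  using cpc by (simp add: cpc_def completely_positive_def)

lemma closed [simp]: "x \<in> carrier A \<Longrightarrow> f x \<in> carrier B"
  by (rule linear_mapD(1)[OF linear])

lemma add: "\<lbrakk>x \<in> carrier A; y \<in> carrier A\<rbrakk> \<Longrightarrow> f (x \<oplus> y) = f x \<oplus>\<^bsub>B\<^esub> f y"
  by (rule linear_mapD(2)[OF linear])

lemma smult: "x \<in> carrier A \<Longrightarrow> f (c \<odot> x) = c \<odot>\<^bsub>B\<^esub> f x"
  by (rule linear_mapD(3)[OF linear])

lemma contractive: "x \<in> carrier A \<Longrightarrow> \<parallel>f x\<parallel>\<^bsub>B\<^esub> \<le> \<parallel>x\<parallel>"
  using cpc by (simp add: cpc_def)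

lemma zero: "f \<zero> = \<zero>\<^bsub>B\<^esub>"
  using smult[of "\<zero>" 0] by simp

lemma minus: "\<lbrakk>x \<in> carrier A; y \<in> carrier A\<rbrakk> \<Longrightarrow> f (x \<ominus> y) = f x \<ominus>\<^bsub>B\<^esub> f y"
  using smult[of y "- 1"] add[of x "\<ominus> y"]
  by (simp add: A.smult_minus_one B.smult_minus_one a_minus_def)

lemma contractive_minus:
  "\<lbrakk>x \<in> carrier A; y \<in> carrier A\<rbrakk> \<Longrightarrow> \<parallel>f x \<ominus>\<^bsub>B\<^esub> f y\<parallel>\<^bsub>B\<^esub> \<le> \<parallel>x \<ominus> y\<parallel>"
  using contractive[of "x \<ominus> y"] by (simp add: minus)

text \<open>The matrix \<open>Y\<close> with first row \<open>(x, e)\<close> and second row 0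
  produces the Gram matrix of \<open>x\<close> and \<open>e\<close>. The image under
  \<open>f\<close> is again a Gram matrix, with \<open>(u, u')\<close> and \<open>(v, v')\<close>
  the columns of \<open>Z\<close>.\<close>

lemma two_positive:
  assumes x: "x \<in> carrier A" and e: "e \<in> carrier A"
  obtains u u' v v' where "u \<in> carrier B" "u' \<in> carrier B" "v \<in> carrier B" "v' \<in> carrier B"
    "f (x\<^sup>\<star> \<otimes> x) = u\<^sup>\<star>\<^bsub>B\<^esub> \<otimes>\<^bsub>B\<^esub> u \<oplus>\<^bsub>B\<^esub> u'\<^sup>\<star>\<^bsub>B\<^esub> \<otimes>\<^bsub>B\<^esub> u'"
    "f (x\<^sup>\<star> \<otimes> e) = u\<^sup>\<star>\<^bsub>B\<^esub> \<otimes>\<^bsub>B\<^esub> v \<oplus>\<^bsub>B\<^esub> u'\<^sup>\<star>\<^bsub>B\<^esub> \<otimes>\<^bsub>B\<^esub> v'"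
    "f (e\<^sup>\<star> \<otimes> x) = v\<^sup>\<star>\<^bsub>B\<^esub> \<otimes>\<^bsub>B\<^esub> u \<oplus>\<^bsub>B\<^esub> v'\<^sup>\<star>\<^bsub>B\<^esub> \<otimes>\<^bsub>B\<^esub> u'"
    "f (e\<^sup>\<star> \<otimes> e) = v\<^sup>\<star>\<^bsub>B\<^esub> \<otimes>\<^bsub>B\<^esub> v \<oplus>\<^bsub>B\<^esub> v'\<^sup>\<star>\<^bsub>B\<^esub> \<otimes>\<^bsub>B\<^esub> v'"
proof -
  have two: "{..<2::nat} = {0, 1}"
    by auto
  define Y where "Y = (\<lambda>(i, k)\<in>{..<2::nat} \<times> {..<2::nat}.
      if i = 0 then if k = 0 then x else e else \<zero>)"
  define X where "X = mat_mult 2 A (mat_adj 2 A Y) Y"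
  have "Y \<in> matrices 2 A"
    using x e by (auto simp: Y_def matrices_def)
  then have "positive_matrix 2 A X"
    by (auto simp: positive_matrix_def X_def)
  then have "positive_matrix 2 B (amplification 2 f X)"
    using cpc by (simp add: cpc_def completely_positive_def)
  then obtain Z where Z: "Z \<in> matrices 2 B" and eq: "amplification 2 f X = mat_mult 2 B (mat_adj 2 B Z) Z"
    by (auto simp: positive_matrix_def)
  have Zin: "Z (i, k) \<in> carrier B" if "i < 2" "k < 2" for i k
    using Z that by (auto simp: matrices_def PiE_iff)
  have Z4: "Z (0, 0) \<in> carrier B" "Z (0, Suc 0) \<in> carrier B" "Z (Suc 0, 0) \<in> carrier B" "Z (Suc 0, Suc 0) \<in> carrier B"
    by (intro Zin; simp)+
  have XA: "X (i, k) = (if i = 0 then x else e)\<^sup>\<star> \<otimes> (if k = 0 then x else e)" if "i < 2" "k < 2" for i k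
  proof -
    have "X (i, k) = (\<Oplus>l\<in>{0, 1}. mat_adj 2 A Y (i, l) \<otimes> Y (l, k))"
      unfolding two[symmetric] using that by (simp add: X_def mat_mult_def)
    also have "\<dots> = mat_adj 2 A Y (i, 0) \<otimes> Y (0, k) \<oplus> mat_adj 2 A Y (i, 1) \<otimes> Y (1, k)"
      using that x e by (subst A.finsum_insert) (auto simp: mat_adj_def Y_def Pi_def)
    finally show ?thesis
      using that x e by (auto simp: mat_adj_def Y_def)
  qed
  have ZB: "mat_mult 2 B (mat_adj 2 B Z) Z (i, k) =
      (Z (0, i))\<^sup>\<star>\<^bsub>B\<^esub> \<otimes>\<^bsub>B\<^esub> Z (0, k) \<oplus>\<^bsub>B\<^esub> (Z (1, i))\<^sup>\<star>\<^bsub>B\<^esub> \<otimes>\<^bsub>B\<^esub> Z (1, k)" if "i < 2" "k < 2" for i k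
  proof -
    have "mat_mult 2 B (mat_adj 2 B Z) Z (i, k) = (\<Oplus>\<^bsub>B\<^esub>l\<in>{0, 1}. mat_adj 2 B Z (i, l) \<otimes>\<^bsub>B\<^esub> Z (l, k))"
      unfolding two[symmetric] using that by (simp add: mat_mult_def)
    also have "\<dots> = mat_adj 2 B Z (i, 0) \<otimes>\<^bsub>B\<^esub> Z (0, k) \<oplus>\<^bsub>B\<^esub> mat_adj 2 B Z (i, 1) \<otimes>\<^bsub>B\<^esub> Z (1, k)"
      using that Zin by (subst B.finsum_insert) (auto simp: mat_adj_def Pi_def)
    finally show ?thesis
      using that by (simp add: mat_adj_def)
  qed
  have key: "f ((if i = 0 then x else e)\<^sup>\<star> \<otimes> (if k = 0 then x else e)) =
      (Z (0, i))\<^sup>\<star>\<^bsub>B\<^esub> \<otimes>\<^bsub>B\<^esub> Z (0, k) \<oplus>\<^bsub>B\<^esub> (Z (1, i))\<^sup>\<star>\<^bsub>B\<^esub> \<otimes>\<^bsub>B\<^esub> Z (1, k)" if "i < 2" "k < 2" for i k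
  proof -
    have "amplification 2 f X (i, k) = f (X (i, k))"
      using that by (simp add: amplification_def)
    then show ?thesis
      using that by (simp add: eq ZB XA)
  qed
  show thesis
    using key[of 0 0] key[of 0 1] key[of 1 0] key[of 1 1] Z4
    by (intro that[of "Z (0, 0)" "Z (1, 0)" "Z (0, 1)" "Z (1, 1)"]) simp_all
qed

lemma positive: "positive_elem A h \<Longrightarrow> positive_elem B (f h)"
proof -
  assume "positive_elem A h"
  then obtain x where x: "x \<in> carrier A" "h = x\<^sup>\<star> \<otimes> x"
    by (auto simp: positive_elem_def)
  obtain u u' v v' where "u \<in> carrier B" "u' \<in> carrier B"
    "f (x\<^sup>\<star> \<otimes> x) = u\<^sup>\<star>\<^bsub>B\<^esub> \<otimes>\<^bsub>B\<^esub> u \<oplus>\<^bsub>B\<^esub> u'\<^sup>\<star>\<^bsub>B\<^esub> \<otimes>\<^bsub>B\<^esub> u'"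
    using two_positive[OF x(1) x(1)] by metis
  then show ?thesis
    using x(2) B.positive_add by (auto simp: positive_elem_def)
qed

lemma approximate_unit_sequence:
  assumes x: "x \<in> carrier A"
  shows "\<exists>e. (\<forall>n. e n \<in> carrier A) \<and> (\<forall>n. (e n)\<^sup>\<star> = e n) \<and> (\<forall>n. \<parallel>e n\<parallel> \<le> 1) \<and>
    (\<lambda>n. \<parallel>e n \<otimes> x \<ominus> x\<parallel>) \<longlonglongrightarrow> 0"
proof -
  have "\<exists>e. e \<in> carrier A \<and> e\<^sup>\<star> = e \<and> \<parallel>e\<parallel> \<le> 1 \<and> \<parallel>e \<otimes> x \<ominus> x\<parallel> \<le> inverse (real (Suc n))" for n
    by (rule A.approximate_unit[OF x, of "inverse (real (Suc n))"]) auto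
  then obtain e where e: "\<And>n. e n \<in> carrier A \<and> (e n)\<^sup>\<star> = e n \<and> \<parallel>e n\<parallel> \<le> 1
      \<and> \<parallel>e n \<otimes> x \<ominus> x\<parallel> \<le> inverse (real (Suc n))"
    by metis
  have "(\<lambda>n. \<parallel>e n \<otimes> x \<ominus> x\<parallel>) \<longlonglongrightarrow> 0"
    by (rule LIMSEQ_zero_squeeze[OF LIMSEQ_inverse_real_of_nat]) (use e x in auto)
  then show ?thesis
    using e by blast
qed

lemma tends_comp:
  assumes "\<And>n. X n \<in> carrier A" "a \<in> carrier A" "(\<lambda>n. \<parallel>X n \<ominus> a\<parallel>) \<longlonglongrightarrow> 0"
  shows "B.up.tends (\<lambda>n. B.emb (f (X n))) (B.emb (f a))"
proof -
  have "(\<lambda>n. \<parallel>f (X n) \<ominus>\<^bsub>B\<^esub> f a\<parallel>\<^bsub>B\<^esub>) \<longlonglongrightarrow> 0"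
    by (rule LIMSEQ_zero_squeeze[OF assms(3)]) (use assms contractive_minus in auto)
  then show ?thesis
    using assms by (simp add: B.tends_emb_iff)
qed

text \<open>Off the diagonal, \<open>two_positive\<close> exhibits
  \<open>f (x\<^sup>\<star> \<otimes> e)\<close> and \<open>f (e \<otimes> x)\<close> as adjoints of
  each other for self-adjoint \<open>e\<close>; along an approximate unit the factor
  \<open>e\<close> disappears.\<close>

lemma adj:
  assumes x: "x \<in> carrier A"
  shows "f (x\<^sup>\<star>) = (f x)\<^sup>\<star>\<^bsub>B\<^esub>"
proof -
  obtain e where e: "\<And>n. e n \<in> carrier A" "\<And>n. (e n)\<^sup>\<star> = e n" "\<And>n. \<parallel>e n\<parallel> \<le> 1"
    "(\<lambda>n. \<parallel>e n \<otimes> x \<ominus> x\<parallel>) \<longlonglongrightarrow> 0"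
    using approximate_unit_sequence[OF x] by blast
  have *: "f (x\<^sup>\<star> \<otimes> e n) = (f (e n \<otimes> x))\<^sup>\<star>\<^bsub>B\<^esub>" for n
  proof -
    obtain u u' v v' where *: "u \<in> carrier B" "u' \<in> carrier B" "v \<in> carrier B" "v' \<in> carrier B"
      "f (x\<^sup>\<star> \<otimes> e n) = u\<^sup>\<star>\<^bsub>B\<^esub> \<otimes>\<^bsub>B\<^esub> v \<oplus>\<^bsub>B\<^esub> u'\<^sup>\<star>\<^bsub>B\<^esub> \<otimes>\<^bsub>B\<^esub> v'"
      "f ((e n)\<^sup>\<star> \<otimes> x) = v\<^sup>\<star>\<^bsub>B\<^esub> \<otimes>\<^bsub>B\<^esub> u \<oplus>\<^bsub>B\<^esub> v'\<^sup>\<star>\<^bsub>B\<^esub> \<otimes>\<^bsub>B\<^esub> u'"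
      using two_positive[OF x e(1)[of n]] by metis
    then show ?thesis
      by (simp add: e(2) B.adj_add B.adj_mult)
  qed
  have "(\<lambda>n. \<parallel>x\<^sup>\<star> \<otimes> e n \<ominus> x\<^sup>\<star>\<parallel>) \<longlonglongrightarrow> 0"
  proof -
    have "A.up.tends (\<lambda>n. A.emb (e n \<otimes> x)) (A.emb x)"
      using e x by (simp add: A.tends_emb_iff)
    then have "A.up.tends (\<lambda>n. A.emb (x\<^sup>\<star> \<otimes> e n)) (A.emb (x\<^sup>\<star>))"
      using A.up.tends_st[of "\<lambda>n. A.emb (e n \<otimes> x)" "A.emb x"] e(1,2) x
      by (simp add: A.adj_mult flip: A.emb_adj)
    then show ?thesis
      using e x by (simp add: A.tends_emb_iff)
  qed
  then have 1: "B.up.tends (\<lambda>n. B.emb (f (x\<^sup>\<star> \<otimes> e n))) (B.emb (f (x\<^sup>\<star>)))"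
    using e x by (intro tends_comp) auto
  have "B.up.tends (\<lambda>n. ustar (B.emb (f (e n \<otimes> x)))) (ustar (B.emb (f x)))"
    using e x by (intro tends_comp B.up.tends_st) auto
  then have "B.up.tends (\<lambda>n. B.emb (f (x\<^sup>\<star> \<otimes> e n))) (B.emb ((f x)\<^sup>\<star>\<^bsub>B\<^esub>))"
    using e x by (simp add: * B.emb_adj)
  then have "B.up.eqv (B.emb (f (x\<^sup>\<star>))) (B.emb ((f x)\<^sup>\<star>\<^bsub>B\<^esub>))"
    by (rule B.up.tends_unique[OF 1]) simp
  then show ?thesis
    using x by (simp add: B.emb_eqv_iff)
qed

text \<open>Contractivity bounds \<open>f (e\<^sup>\<star> \<otimes> e)\<close> by 1, so
  \<open>Cauchy_Schwarz\<close> applies to the columns from \<open>two_positive\<close>. It gives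
  the inequality with \<open>f (e \<otimes> x)\<close> in place of \<open>f x\<close>, and
  closedness of the cone allows passing to the limit along the approximate unit.\<close>

theorem Kadison_Schwarz:
  assumes x: "x \<in> carrier A"
  shows "positive_elem B (f (x\<^sup>\<star> \<otimes> x) \<ominus>\<^bsub>B\<^esub> (f x)\<^sup>\<star>\<^bsub>B\<^esub> \<otimes>\<^bsub>B\<^esub> f x)"
proof -
  obtain e where e: "\<And>n. e n \<in> carrier A" "\<And>n. (e n)\<^sup>\<star> = e n" "\<And>n. \<parallel>e n\<parallel> \<le> 1"
    "(\<lambda>n. \<parallel>e n \<otimes> x \<ominus> x\<parallel>) \<longlonglongrightarrow> 0"
    using approximate_unit_sequence[OF x] by blast
  let ?c = "\<lambda>n. f (e n \<otimes> x)"
  have pos: "positive_elem B (f (x\<^sup>\<star> \<otimes> x) \<ominus>\<^bsub>B\<^esub> (?c n)\<^sup>\<star>\<^bsub>B\<^esub> \<otimes>\<^bsub>B\<^esub> ?c n)" for n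
  proof -
    obtain u u' v v' where *: "u \<in> carrier B" "u' \<in> carrier B" "v \<in> carrier B" "v' \<in> carrier B"
      "f (x\<^sup>\<star> \<otimes> x) = u\<^sup>\<star>\<^bsub>B\<^esub> \<otimes>\<^bsub>B\<^esub> u \<oplus>\<^bsub>B\<^esub> u'\<^sup>\<star>\<^bsub>B\<^esub> \<otimes>\<^bsub>B\<^esub> u'"
      "f ((e n)\<^sup>\<star> \<otimes> x) = v\<^sup>\<star>\<^bsub>B\<^esub> \<otimes>\<^bsub>B\<^esub> u \<oplus>\<^bsub>B\<^esub> v'\<^sup>\<star>\<^bsub>B\<^esub> \<otimes>\<^bsub>B\<^esub> u'"
      "f ((e n)\<^sup>\<star> \<otimes> e n) = v\<^sup>\<star>\<^bsub>B\<^esub> \<otimes>\<^bsub>B\<^esub> v \<oplus>\<^bsub>B\<^esub> v'\<^sup>\<star>\<^bsub>B\<^esub> \<otimes>\<^bsub>B\<^esub> v'"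
      using two_positive[OF x e(1)[of n]] by metis
    have "\<parallel>(e n)\<^sup>\<star> \<otimes> e n\<parallel> \<le> 1"
      using e(1,3) A.nrm_nonneg[OF e(1)[of n]] by (simp only: A.cstar_identity[OF e(1)] power_le_one)
    then have "\<parallel>f ((e n)\<^sup>\<star> \<otimes> e n)\<parallel>\<^bsub>B\<^esub> \<le> 1"
      using contractive[of "(e n)\<^sup>\<star> \<otimes> e n"] e(1) by (meson A.adj_closed A.mult_closed order_trans)
    then have "positive_elem B ((u\<^sup>\<star>\<^bsub>B\<^esub> \<otimes>\<^bsub>B\<^esub> u \<oplus>\<^bsub>B\<^esub> u'\<^sup>\<star>\<^bsub>B\<^esub> \<otimes>\<^bsub>B\<^esub> u') \<ominus>\<^bsub>B\<^esub> (?c n)\<^sup>\<star>\<^bsub>B\<^esub> \<otimes>\<^bsub>B\<^esub> ?c n)"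
      using * by (intro B.Cauchy_Schwarz[of u u' v v']) (simp_all add: e(2))
    then show ?thesis
      by (simp only: *(5))
  qed
  have c: "B.up.tends (\<lambda>n. B.emb (?c n)) (B.emb (f x))"
    using e x by (intro tends_comp) auto
  show ?thesis
  proof (rule B.positive_limit[OF pos])
    show "f (x\<^sup>\<star> \<otimes> x) \<ominus>\<^bsub>B\<^esub> (f x)\<^sup>\<star>\<^bsub>B\<^esub> \<otimes>\<^bsub>B\<^esub> f x \<in> carrier B"
      using x by simp
    have "B.up.tends (\<lambda>n. B.emb (f (x\<^sup>\<star> \<otimes> x)) - ustar (B.emb (?c n)) * B.emb (?c n))
        (B.emb (f (x\<^sup>\<star> \<otimes> x)) - ustar (B.emb (f x)) * B.emb (f x))"
      by (intro B.up.tends_diff B.up.tends_mult B.up.tends_st B.up.tends_const c)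
    then show "B.up.tends (\<lambda>n. B.emb (f (x\<^sup>\<star> \<otimes> x) \<ominus>\<^bsub>B\<^esub> (?c n)\<^sup>\<star>\<^bsub>B\<^esub> \<otimes>\<^bsub>B\<^esub> ?c n))
        (B.emb (f (x\<^sup>\<star> \<otimes> x) \<ominus>\<^bsub>B\<^esub> (f x)\<^sup>\<star>\<^bsub>B\<^esub> \<otimes>\<^bsub>B\<^esub> f x))"
      using x e by (simp add: B.emb_minus B.emb_mult B.emb_adj)
    have "ustar (B.emb (f (x\<^sup>\<star> \<otimes> x) \<ominus>\<^bsub>B\<^esub> (f x)\<^sup>\<star>\<^bsub>B\<^esub> \<otimes>\<^bsub>B\<^esub> f x))
        = B.emb (f (x\<^sup>\<star> \<otimes> x) \<ominus>\<^bsub>B\<^esub> (f x)\<^sup>\<star>\<^bsub>B\<^esub> \<otimes>\<^bsub>B\<^esub> f x)"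
    proof -
      have "(f (x\<^sup>\<star> \<otimes> x))\<^sup>\<star>\<^bsub>B\<^esub> = f (x\<^sup>\<star> \<otimes> x)"
        using x by (intro B.positive_adj positive) (auto simp: positive_elem_def)
      then show ?thesis
        using x by (simp add: B.emb_minus B.emb_mult B.up.st_diff B.up.st_mult flip: B.emb_adj)
    qed
    then show "(f (x\<^sup>\<star> \<otimes> x) \<ominus>\<^bsub>B\<^esub> (f x)\<^sup>\<star>\<^bsub>B\<^esub> \<otimes>\<^bsub>B\<^esub> f x)\<^sup>\<star>\<^bsub>B\<^esub>
        = f (x\<^sup>\<star> \<otimes> x) \<ominus>\<^bsub>B\<^esub> (f x)\<^sup>\<star>\<^bsub>B\<^esub> \<otimes>\<^bsub>B\<^esub> f x"
      using x by (simp add: B.emb_inject flip: B.emb_adj)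
  qed
qed

end

section \<open>The norm of a sequence algebra modulo null sequences\<close>

locale cstar_sequence =
  fixes F :: "nat \<Rightarrow> 'b cstar"
  assumes cstar_F: "\<And>n. cstar_algebra (F n)"
begin

sublocale F: cstar_alg "F n" for n
  by (rule cstar_alg.intro) (rule cstar_F)

abbreviation "P \<equiv> cstar_prod F"
abbreviation "Q \<equiv> F_infinity F"
abbreviation "cl \<equiv> seq_class F"

section \<open>Bounded sequences and null sequences\<close>

lemma prod_in_iff: "a \<in> carrier P \<longleftrightarrow> (\<forall>n. a n \<in> carrier (F n)) \<and> (\<exists>K. \<forall>n. nrm (F n) (a n) \<le> K)"
  by (simp add: cstar_prod_def)

lemma prodI: "\<lbrakk>\<And>n. a n \<in> carrier (F n); \<And>n. nrm (F n) (a n) \<le> K\<rbrakk> \<Longrightarrow> a \<in> carrier P"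
  by (auto simp: prod_in_iff)

lemma prod_in: "a \<in> carrier P \<Longrightarrow> a n \<in> carrier (F n)"
  by (simp add: prod_in_iff)

lemma prod_bounded: "a \<in> carrier P \<Longrightarrow> \<exists>K. \<forall>n. nrm (F n) (a n) \<le> K"
  by (simp add: prod_in_iff)

lemma prod_ops:
  "a \<oplus>\<^bsub>P\<^esub> b = (\<lambda>n. a n \<oplus>\<^bsub>F n\<^esub> b n)" "\<zero>\<^bsub>P\<^esub> = (\<lambda>n. \<zero>\<^bsub>F n\<^esub>)"
  "c \<odot>\<^bsub>P\<^esub> a = (\<lambda>n. c \<odot>\<^bsub>F n\<^esub> a n)" "a\<^sup>\<star>\<^bsub>P\<^esub> = (\<lambda>n. (a n)\<^sup>\<star>\<^bsub>F n\<^esub>)"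
  "nrm P a = (SUP n. nrm (F n) (a n))"
  by (simp_all add: cstar_prod_def)

lemma prod_add_in: "\<lbrakk>a \<in> carrier P; b \<in> carrier P\<rbrakk> \<Longrightarrow> (\<lambda>n. a n \<oplus>\<^bsub>F n\<^esub> b n) \<in> carrier P"
proof -
  assume ab: "a \<in> carrier P" "b \<in> carrier P"
  obtain K L where "\<forall>n. nrm (F n) (a n) \<le> K" "\<forall>n. nrm (F n) (b n) \<le> L"
    using prod_bounded[OF ab(1)] prod_bounded[OF ab(2)] by blast
  then have le: "nrm (F n) (a n \<oplus>\<^bsub>F n\<^esub> b n) \<le> K + L" for n
    using F.nrm_triangle[OF prod_in[OF ab(1)] prod_in[OF ab(2)], of n] by (meson add_mono order_trans)
  show ?thesis
    by (rule prodI[OF _ le]) (simp add: prod_in ab)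
qed

lemma prod_smult_in: "a \<in> carrier P \<Longrightarrow> (\<lambda>n. c \<odot>\<^bsub>F n\<^esub> a n) \<in> carrier P"
proof -
  assume a: "a \<in> carrier P"
  obtain K where "\<forall>n. nrm (F n) (a n) \<le> K"
    using prod_bounded[OF a] by blast
  then have le: "nrm (F n) (c \<odot>\<^bsub>F n\<^esub> a n) \<le> cmod c * K" for n
    by (simp add: F.nrm_smult prod_in a mult_left_mono)
  show ?thesis
    by (rule prodI[OF _ le]) (simp add: prod_in a)
qed

lemma prod_adj_in: "a \<in> carrier P \<Longrightarrow> (\<lambda>n. (a n)\<^sup>\<star>\<^bsub>F n\<^esub>) \<in> carrier P"
  by (simp add: prod_in_iff F.nrm_adj)

lemma prod_zero_in: "(\<lambda>n. \<zero>\<^bsub>F n\<^esub>) \<in> carrier P"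
  by (rule prodI[of _ 0]) simp_all

lemma prod_a_inv_in: "a \<in> carrier P \<Longrightarrow> (\<lambda>n. \<ominus>\<^bsub>F n\<^esub> a n) \<in> carrier P"
  using prod_smult_in[of a "- 1"] by (simp add: F.smult_minus_one prod_in)

lemma prod_minus_in: "\<lbrakk>a \<in> carrier P; b \<in> carrier P\<rbrakk> \<Longrightarrow> (\<lambda>n. a n \<ominus>\<^bsub>F n\<^esub> b n) \<in> carrier P"
  using prod_add_in[OF _ prod_a_inv_in] by (simp add: a_minus_def)

sublocale P: abelian_group P
proof (rule abelian_groupI)
  show "\<exists>y\<in>carrier P. y \<oplus>\<^bsub>P\<^esub> x = \<zero>\<^bsub>P\<^esub>" if "x \<in> carrier P" for x
    by (intro bexI[OF _ prod_a_inv_in[OF that]]) (simp add: prod_ops F.l_neg prod_in that)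
qed (simp_all add: prod_ops prod_add_in prod_zero_in prod_in F.a_assoc F.a_comm F.a_lcomm)

lemma prod_a_inv: "a \<in> carrier P \<Longrightarrow> \<ominus>\<^bsub>P\<^esub> a = (\<lambda>n. \<ominus>\<^bsub>F n\<^esub> a n)"
  by (rule P.minus_equality) (simp_all add: prod_ops F.l_neg prod_in prod_a_inv_in)

lemma prod_minus: "\<lbrakk>a \<in> carrier P; b \<in> carrier P\<rbrakk> \<Longrightarrow> a \<ominus>\<^bsub>P\<^esub> b = (\<lambda>n. a n \<ominus>\<^bsub>F n\<^esub> b n)"
  by (simp add: a_minus_def[of P] prod_a_inv prod_ops) (simp add: a_minus_def)

lemma null_iff: "a \<in> null_sequences F \<longleftrightarrow> a \<in> carrier P \<and> (\<lambda>n. nrm (F n) (a n)) \<longlonglongrightarrow> 0"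
  by (simp add: null_sequences_def)

lemma null_bound:
  assumes "a \<in> carrier P" "\<forall>\<^sub>F n in sequentially. nrm (F n) (a n) \<le> f n" "f \<longlonglongrightarrow> 0"
  shows "a \<in> null_sequences F"
proof -
  have "(\<lambda>n. nrm (F n) (a n)) \<longlonglongrightarrow> 0"
    by (rule tendsto_sandwich[OF always_eventually assms(2) tendsto_const assms(3)])
      (simp add: prod_in assms(1))
  then show ?thesis
    using assms(1) by (simp add: null_iff)
qed

lemma null_add: "\<lbrakk>a \<in> null_sequences F; b \<in> null_sequences F\<rbrakk> \<Longrightarrow> (\<lambda>n. a n \<oplus>\<^bsub>F n\<^esub> b n) \<in> null_sequences F"
proof (rule null_bound)
  assume ab: "a \<in> null_sequences F" "b \<in> null_sequences F"
  then show "(\<lambda>n. a n \<oplus>\<^bsub>F n\<^esub> b n) \<in> carrier P"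
    by (simp add: null_iff prod_add_in)
  show "\<forall>\<^sub>F n in sequentially. nrm (F n) (a n \<oplus>\<^bsub>F n\<^esub> b n) \<le> nrm (F n) (a n) + nrm (F n) (b n)"
    using ab by (intro always_eventually allI F.nrm_triangle) (simp_all add: null_iff prod_in)
  show "(\<lambda>n. nrm (F n) (a n) + nrm (F n) (b n)) \<longlonglongrightarrow> 0"
    using ab by (intro tendsto_add_zero) (simp_all add: null_iff)
qed

lemma null_smult: "a \<in> null_sequences F \<Longrightarrow> (\<lambda>n. c \<odot>\<^bsub>F n\<^esub> a n) \<in> null_sequences F"
  by (simp add: null_iff prod_smult_in F.nrm_smult prod_in tendsto_mult_right_zero)

lemma null_zero: "(\<lambda>n. \<zero>\<^bsub>F n\<^esub>) \<in> null_sequences F"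
  by (simp add: null_iff prod_zero_in)

sublocale N: abelian_subgroup "null_sequences F" P
proof (rule abelian_subgroupI3[OF additive_subgroupI P.abelian_group_axioms])
  show "subgroup (null_sequences F) (add_monoid P)"
  proof (rule P.add.subgroupI)
    show "\<ominus>\<^bsub>P\<^esub> a \<in> null_sequences F" if "a \<in> null_sequences F" for a
      using null_smult[OF that, of "- 1"] that
      by (simp add: prod_a_inv null_iff prod_in F.smult_minus_one)
    show "a \<oplus>\<^bsub>P\<^esub> b \<in> null_sequences F" if "a \<in> null_sequences F" "b \<in> null_sequences F" for a b
      using null_add[OF that] by (simp add: prod_ops)
    show "null_sequences F \<noteq> {}"
      using null_zero by blast
  qed (simp add: null_sequences_def)
qed

section \<open>Classes and their operations\<close>

lemma in_class_iff:
  assumes "a \<in> carrier P"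
  shows "b \<in> cl a \<longleftrightarrow> b \<in> carrier P \<and> (\<lambda>n. F.dst n (b n) (a n)) \<longlonglongrightarrow> 0"
proof -
  have "b \<in> cl a \<longleftrightarrow> b \<ominus>\<^bsub>P\<^esub> a \<in> null_sequences F" if "b \<in> carrier P"
    unfolding seq_class_def a_minus_def[of P] by (rule N.a_rcos_module[OF assms that])
  moreover have "b \<in> carrier P" if "b \<in> cl a"
    using N.a_elemrcos_carrier[OF assms] that by (simp add: seq_class_def)
  moreover have "b \<ominus>\<^bsub>P\<^esub> a \<in> null_sequences F \<longleftrightarrow> (\<lambda>n. F.dst n (b n) (a n)) \<longlonglongrightarrow> 0"
    if "b \<in> carrier P"
    by (simp only: prod_minus[OF that assms] null_iff prod_minus_in[OF that assms] simp_thms)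
  ultimately show ?thesis
    by blast
qed

lemma self_in_class: "a \<in> carrier P \<Longrightarrow> a \<in> cl a"
  using N.a_rcos_self by (simp add: seq_class_def)

lemma class_eqI:
  assumes "a \<in> carrier P" "b \<in> carrier P" "(\<lambda>n. F.dst n (b n) (a n)) \<longlonglongrightarrow> 0"
  shows "cl b = cl a"
  using N.a_repr_independence'[OF _ assms(1), of b] in_class_iff[OF assms(1), of b] assms(2,3)
  by (simp add: seq_class_def)

lemma Q_carrier: "carrier Q = cl ` carrier P"
  by (auto simp: F_infinity_def cstar_quotient_def FactRing_def A_RCOSETS_def' seq_class_def)

lemma Q_zero: "\<zero>\<^bsub>Q\<^esub> = cl (\<lambda>n. \<zero>\<^bsub>F n\<^esub>)"
  using N.a_rcos_const[OF null_zero]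
  by (simp add: F_infinity_def cstar_quotient_def FactRing_def seq_class_def)

lemma Q_add: "\<lbrakk>a \<in> carrier P; b \<in> carrier P\<rbrakk> \<Longrightarrow> cl a \<oplus>\<^bsub>Q\<^esub> cl b = cl (\<lambda>n. a n \<oplus>\<^bsub>F n\<^esub> b n)"
  using N.a_rcos_sum[of a b]
  by (simp add: F_infinity_def cstar_quotient_def FactRing_def seq_class_def prod_ops)

text \<open>The operation is a union over representatives; all of them yield the same class, so the
  union collapses.\<close>

lemma Q_smult: "a \<in> carrier P \<Longrightarrow> c \<odot>\<^bsub>Q\<^esub> cl a = cl (\<lambda>n. c \<odot>\<^bsub>F n\<^esub> a n)"
proof -
  assume a: "a \<in> carrier P"
  have "cl (c \<odot>\<^bsub>P\<^esub> b) = cl (\<lambda>n. c \<odot>\<^bsub>F n\<^esub> a n)" if "b \<in> cl a" for b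
  proof -
    have b: "b \<in> carrier P" "(\<lambda>n. F.dst n (b n) (a n)) \<longlonglongrightarrow> 0"
      using that in_class_iff[OF a] by auto
    have "c \<odot>\<^bsub>F n\<^esub> b n \<ominus>\<^bsub>F n\<^esub> c \<odot>\<^bsub>F n\<^esub> a n = c \<odot>\<^bsub>F n\<^esub> (b n \<ominus>\<^bsub>F n\<^esub> a n)" for n
      using prod_in[OF a] prod_in[OF b(1)]
      by (simp add: a_minus_def F.smult_add_right flip: F.smult_minus_one F.smult_mult)
    then show ?thesis
      unfolding prod_ops using a b
      by (intro class_eqI prod_smult_in) (simp_all add: F.nrm_smult prod_in tendsto_mult_right_zero)
  qed
  then have "(\<Union>b\<in>cl a. cl (c \<odot>\<^bsub>P\<^esub> b)) = cl (\<lambda>n. c \<odot>\<^bsub>F n\<^esub> a n)"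
    using self_in_class[OF a] by blast
  then show ?thesis
    by (simp add: F_infinity_def cstar_quotient_def seq_class_def)
qed

lemma Q_adj: "a \<in> carrier P \<Longrightarrow> (cl a)\<^sup>\<star>\<^bsub>Q\<^esub> = cl (\<lambda>n. (a n)\<^sup>\<star>\<^bsub>F n\<^esub>)"
proof -
  assume a: "a \<in> carrier P"
  have "cl (b\<^sup>\<star>\<^bsub>P\<^esub>) = cl (\<lambda>n. (a n)\<^sup>\<star>\<^bsub>F n\<^esub>)" if "b \<in> cl a" for b
  proof -
    have b: "b \<in> carrier P" "(\<lambda>n. F.dst n (b n) (a n)) \<longlonglongrightarrow> 0"
      using that in_class_iff[OF a] by auto
    have "(b n)\<^sup>\<star>\<^bsub>F n\<^esub> \<ominus>\<^bsub>F n\<^esub> (a n)\<^sup>\<star>\<^bsub>F n\<^esub> = (b n \<ominus>\<^bsub>F n\<^esub> a n)\<^sup>\<star>\<^bsub>F n\<^esub>" for n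
      using prod_in[OF a] prod_in[OF b(1)] F.adj_smult[of "a n" n "- 1"]
      by (simp add: a_minus_def F.adj_add F.smult_minus_one)
    then show ?thesis
      unfolding prod_ops using a b
      by (intro class_eqI prod_adj_in) (simp_all add: F.nrm_adj prod_in)
  qed
  then have "(\<Union>b\<in>cl a. cl (b\<^sup>\<star>\<^bsub>P\<^esub>)) = cl (\<lambda>n. (a n)\<^sup>\<star>\<^bsub>F n\<^esub>)"
    using self_in_class[OF a] by blast
  then show ?thesis
    by (simp add: F_infinity_def cstar_quotient_def seq_class_def)
qed

sublocale Q: abelian_group Q
proof (rule abelian_groupI)
  show "\<exists>y\<in>carrier Q. y \<oplus>\<^bsub>Q\<^esub> x = \<zero>\<^bsub>Q\<^esub>" if "x \<in> carrier Q" for x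
  proof -
    obtain a where a: "a \<in> carrier P" "x = cl a"
      using \<open>x \<in> carrier Q\<close> by (auto simp: Q_carrier)
    have "cl (\<lambda>n. \<ominus>\<^bsub>F n\<^esub> a n) \<in> carrier Q"
      using a by (simp add: Q_carrier prod_a_inv_in)
    moreover have "cl (\<lambda>n. \<ominus>\<^bsub>F n\<^esub> a n) \<oplus>\<^bsub>Q\<^esub> x = \<zero>\<^bsub>Q\<^esub>"
      using a by (simp add: Q_add prod_a_inv_in Q_zero F.l_neg prod_in)
    ultimately show ?thesis ..
  qed
qed (auto simp: Q_carrier Q_add Q_zero prod_add_in prod_zero_in prod_in F.a_assoc F.a_comm F.a_lcomm)

lemma Q_minus: "\<lbrakk>a \<in> carrier P; b \<in> carrier P\<rbrakk> \<Longrightarrow> cl a \<ominus>\<^bsub>Q\<^esub> cl b = cl (\<lambda>n. a n \<ominus>\<^bsub>F n\<^esub> b n)"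
proof -
  assume ab: "a \<in> carrier P" "b \<in> carrier P"
  have "\<ominus>\<^bsub>Q\<^esub> cl b = cl (\<lambda>n. \<ominus>\<^bsub>F n\<^esub> b n)"
    using ab by (intro Q.minus_equality) (simp_all add: Q_carrier Q_add prod_a_inv_in Q_zero F.l_neg prod_in)
  then show ?thesis
    using ab by (simp add: a_minus_def Q_add prod_a_inv_in)
qed

section \<open>Quotient norm and metric\<close>

lemma nrm_le_prod: "a \<in> carrier P \<Longrightarrow> nrm (F n) (a n) \<le> nrm P a"
  using prod_bounded[of a] unfolding prod_ops by (intro cSUP_upper) (auto intro: bdd_aboveI2)

lemma prod_nrm_nonneg: "a \<in> carrier P \<Longrightarrow> 0 \<le> nrm P a"
  using order_trans[OF F.nrm_nonneg nrm_le_prod] prod_in by blast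

lemma Q_nrm: "nrm Q X = (INF a\<in>X. nrm P a)"
  by (simp add: F_infinity_def cstar_quotient_def)

lemma class_bdd_below: "a \<in> carrier P \<Longrightarrow> bdd_below ((\<lambda>a. nrm P a) ` cl a)"
  by (intro bdd_belowI2[of _ 0] prod_nrm_nonneg) (simp add: in_class_iff)

lemma Q_nrm_nonneg: "X \<in> carrier Q \<Longrightarrow> 0 \<le> nrm Q X"
proof -
  assume "X \<in> carrier Q"
  then obtain a where a: "a \<in> carrier P" "X = cl a"
    by (auto simp: Q_carrier)
  show ?thesis
    unfolding Q_nrm a(2) using self_in_class[OF a(1)] in_class_iff[OF a(1)] prod_nrm_nonneg
    by (intro cINF_greatest) auto
qed

text \<open>The quotient norm of a class is the limit superior of the norms of the entries.\<close>

lemma Q_nrm_le: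
  assumes a: "a \<in> carrier P" and ev: "\<forall>\<^sub>F n in sequentially. nrm (F n) (a n) \<le> r" and r: "0 \<le> r"
  shows "nrm Q (cl a) \<le> r"
proof -
  obtain M where M: "\<And>n. n \<ge> M \<Longrightarrow> nrm (F n) (a n) \<le> r"
    using ev by (auto simp: eventually_sequentially)
  \<comment> \<open>Replacing the first \<open>M\<close> entries by 0 keeps the class and brings the
    supremum down to \<open>r\<close>.\<close>
  define b where "b = (\<lambda>n. if n \<ge> M then a n else \<zero>\<^bsub>F n\<^esub>)"
  have b_le: "nrm (F n) (b n) \<le> r" for n
    using M r by (simp add: b_def)
  have b: "b \<in> carrier P"
    by (rule prodI[OF _ b_le]) (simp add: b_def prod_in a)
  have "(\<lambda>n. F.dst n (b n) (a n)) \<longlonglongrightarrow> 0"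
  proof (rule tendsto_eventually)
    show "\<forall>\<^sub>F n in sequentially. F.dst n (b n) (a n) = 0"
      using eventually_ge_at_top[of M]
      by eventually_elim (simp add: b_def a_minus_def F.r_neg prod_in a)
  qed
  then have "b \<in> cl a"
    using in_class_iff[OF a] b by blast
  then have "nrm Q (cl a) \<le> nrm P b"
    unfolding Q_nrm by (intro cINF_lower class_bdd_below a)
  also have "\<dots> \<le> r"
    unfolding prod_ops by (intro cSUP_least b_le) simp
  finally show ?thesis .
qed

text \<open>Some representative has norm below \<open>r\<close>, and \<open>a\<close> differs from
  it by a null sequence, which the remaining gap absorbs.\<close>

lemma Q_nrm_less:
  assumes a: "a \<in> carrier P" and less: "nrm Q (cl a) < r"
  shows "\<forall>\<^sub>F n in sequentially. nrm (F n) (a n) < r"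
proof -
  obtain b where b: "b \<in> cl a" "nrm P b < r"
    using less self_in_class[OF a] unfolding Q_nrm
    by (subst (asm) cINF_less_iff) (auto intro: class_bdd_below a)
  then have bP: "b \<in> carrier P" and lim: "(\<lambda>n. F.dst n (b n) (a n)) \<longlonglongrightarrow> 0"
    using in_class_iff[OF a] by auto
  have "\<forall>\<^sub>F n in sequentially. F.dst n (b n) (a n) < r - nrm P b"
    using lim b(2) by (intro order_tendstoD(2)) auto
  then show ?thesis
  proof eventually_elim
    case (elim n)
    have "a n = (a n \<ominus>\<^bsub>F n\<^esub> b n) \<oplus>\<^bsub>F n\<^esub> b n"
      using prod_in[OF a, of n] prod_in[OF bP, of n] by (simp add: a_minus_def F.a_assoc F.l_neg)
    then have "nrm (F n) (a n) \<le> F.dst n (a n) (b n) + nrm (F n) (b n)"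
      using F.nrm_triangle[of "a n \<ominus>\<^bsub>F n\<^esub> b n" n "b n"] prod_in[OF a, of n] prod_in[OF bP, of n] by simp
    also have "F.dst n (a n) (b n) = F.dst n (b n) (a n)"
      by (rule F.nrm_minus_commute[OF prod_in[OF a] prod_in[OF bP]])
    finally show ?case
      using elim nrm_le_prod[OF bP, of n] by linarith
  qed
qed

lemma Q_nrm_cong:
  assumes "a \<in> carrier P" "b \<in> carrier P" "\<And>n. nrm (F n) (a n) = nrm (F n) (b n)"
  shows "nrm Q (cl a) = nrm Q (cl b)"
proof -
  have le: "nrm Q (cl a) \<le> nrm Q (cl b)"
    if "a \<in> carrier P" "b \<in> carrier P" "\<And>n. nrm (F n) (a n) = nrm (F n) (b n)" for a b
  proof (rule dense_ge)
    fix r assume r: "nrm Q (cl b) < r"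
    have "0 \<le> r"
      using Q_nrm_nonneg[of "cl b"] r that(2) by (simp add: Q_carrier)
    moreover have "\<forall>\<^sub>F n in sequentially. nrm (F n) (a n) \<le> r"
      using Q_nrm_less[OF that(2) r] by eventually_elim (simp add: that(3))
    ultimately show "nrm Q (cl a) \<le> r"
      using Q_nrm_le[OF that(1)] by blast
  qed
  show ?thesis
    using le[OF assms] le[OF assms(2,1)] assms(3) by fastforce
qed

lemma Q_triangle:
  assumes a: "a \<in> carrier P" and b: "b \<in> carrier P"
  shows "nrm Q (cl (\<lambda>n. a n \<oplus>\<^bsub>F n\<^esub> b n)) \<le> nrm Q (cl a) + nrm Q (cl b)"
proof (rule field_le_epsilon)
  fix e :: real assume e: "0 < e"
  have nn: "0 \<le> nrm Q (cl a)" "0 \<le> nrm Q (cl b)"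
    by (intro Q_nrm_nonneg; simp add: Q_carrier a b)+
  have "\<forall>\<^sub>F n in sequentially. nrm (F n) (a n) < nrm Q (cl a) + e / 2"
    "\<forall>\<^sub>F n in sequentially. nrm (F n) (b n) < nrm Q (cl b) + e / 2"
    using e by (intro Q_nrm_less a b; simp)+
  then have "\<forall>\<^sub>F n in sequentially. nrm (F n) (a n \<oplus>\<^bsub>F n\<^esub> b n) \<le> nrm Q (cl a) + nrm Q (cl b) + e"
  proof eventually_elim
    case (elim n)
    then show ?case
      using F.nrm_triangle[OF prod_in[OF a] prod_in[OF b], of n] by linarith
  qed
  then show "nrm Q (cl (\<lambda>n. a n \<oplus>\<^bsub>F n\<^esub> b n)) \<le> nrm Q (cl a) + nrm Q (cl b) + e"
    using e nn by (intro Q_nrm_le prod_add_in a b) auto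
qed

text \<open>With this, the closure in \<open>system_limit\<close> is a closure in a metric
  space.\<close>

sublocale Q: Metric_space "carrier Q" "cdist Q"
proof
  fix X Y Z
  have minus_in: "X \<ominus>\<^bsub>Q\<^esub> Y \<in> carrier Q" if "X \<in> carrier Q" "Y \<in> carrier Q" for X Y
    using that by simp
  show "0 \<le> cdist Q X Y"
    by (simp add: cdist_def Q_nrm_nonneg)
  have swap: "nrm Q (cl (\<lambda>n. a n \<ominus>\<^bsub>F n\<^esub> b n)) = nrm Q (cl (\<lambda>n. b n \<ominus>\<^bsub>F n\<^esub> a n))"
    if "a \<in> carrier P" "b \<in> carrier P" for a b
    by (rule Q_nrm_cong[OF prod_minus_in[OF that] prod_minus_in[OF that(2,1)]])
      (rule F.nrm_minus_commute[OF prod_in[OF that(1)] prod_in[OF that(2)]])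
  show "cdist Q X Y = cdist Q Y X"
    using swap by (auto simp: cdist_def Q_carrier Q_minus)
  assume "X \<in> carrier Q" "Y \<in> carrier Q"
  then obtain a b where a: "a \<in> carrier P" "X = cl a" and b: "b \<in> carrier P" "Y = cl b"
    by (auto simp: Q_carrier)
  have dist: "cdist Q (cl a) (cl b) = nrm Q (cl (\<lambda>n. a n \<ominus>\<^bsub>F n\<^esub> b n))"
    if "a \<in> carrier P" "b \<in> carrier P" for a b
    using that by (simp add: cdist_def Q_carrier Q_minus)
  show "cdist Q X Y = 0 \<longleftrightarrow> X = Y"
  proof
    assume "X = Y"
    have "nrm Q (cl (\<lambda>n. \<zero>\<^bsub>F n\<^esub>)) \<le> 0"
      by (rule Q_nrm_le) (simp_all add: prod_zero_in)
    moreover have "0 \<le> nrm Q (cl (\<lambda>n. \<zero>\<^bsub>F n\<^esub>))"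
      by (rule Q_nrm_nonneg) (simp add: Q_carrier prod_zero_in)
    ultimately show "cdist Q X Y = 0"
      unfolding \<open>X = Y\<close> b(2) dist[OF b(1) b(1)] using b(1) by (simp add: a_minus_def F.r_neg prod_in)
  next
    assume "cdist Q X Y = 0"
    then have "nrm Q (cl (\<lambda>n. a n \<ominus>\<^bsub>F n\<^esub> b n)) = 0"
      using a b dist by simp
    then have ev: "\<forall>\<^sub>F n in sequentially. F.dst n (a n) (b n) < e" if "e > 0" for e
      using that by (intro Q_nrm_less prod_minus_in a b) simp
    have "(\<lambda>n. F.dst n (a n) (b n)) \<longlonglongrightarrow> 0"
    proof (rule tendstoI)
      fix e :: real assume "e > 0"
      from ev[OF this] show "\<forall>\<^sub>F n in sequentially. dist (F.dst n (a n) (b n)) 0 < e"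
        by eventually_elim (simp add: prod_in a b)
    qed
    then show "X = Y"
      using a b by (simp add: class_eqI)
  qed
  assume "Z \<in> carrier Q"
  then obtain c where c: "c \<in> carrier P" "Z = cl c"
    by (auto simp: Q_carrier)
  have "a n \<ominus>\<^bsub>F n\<^esub> c n = (a n \<ominus>\<^bsub>F n\<^esub> b n) \<oplus>\<^bsub>F n\<^esub> (b n \<ominus>\<^bsub>F n\<^esub> c n)" for n
    using prod_in[OF a(1), of n] prod_in[OF b(1), of n] prod_in[OF c(1), of n]
    by (simp add: a_minus_def F.a_assoc F.r_neg1)
  then show "cdist Q X Z \<le> cdist Q X Y + cdist Q Y Z"
    unfolding a(2) b(2) c(2) dist[OF a(1) b(1)] dist[OF b(1) c(1)] dist[OF a(1) c(1)]
    using Q_triangle[OF prod_minus_in[OF a(1) b(1)] prod_minus_in[OF b(1) c(1)]] by simp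
qed

end

section \<open>Approximate multiplicativity\<close>

text \<open>Along the isometry \<open>\<Psi>\<close> this yields all axioms of the C*-limit at once,
  completeness and the C*-identity included.\<close>

lemma cstar_algebra_transport:
  fixes A :: "'a cstar" and B :: "'b cstar"
  assumes "cstar_algebra A" and bij: "bij_betw f (carrier A) (carrier B)"
    and add: "\<And>x y. \<lbrakk>x \<in> carrier A; y \<in> carrier A\<rbrakk> \<Longrightarrow> f (x \<oplus>\<^bsub>A\<^esub> y) = f x \<oplus>\<^bsub>B\<^esub> f y"
    and zero: "f \<zero>\<^bsub>A\<^esub> = \<zero>\<^bsub>B\<^esub>"
    and smult: "\<And>c x. x \<in> carrier A \<Longrightarrow> f (c \<odot>\<^bsub>A\<^esub> x) = c \<odot>\<^bsub>B\<^esub> f x"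
    and mult: "\<And>x y. \<lbrakk>x \<in> carrier A; y \<in> carrier A\<rbrakk> \<Longrightarrow> f (x \<otimes>\<^bsub>A\<^esub> y) = f x \<otimes>\<^bsub>B\<^esub> f y"
    and adj: "\<And>x. x \<in> carrier A \<Longrightarrow> f (x\<^sup>\<star>\<^bsub>A\<^esub>) = (f x)\<^sup>\<star>\<^bsub>B\<^esub>"
    and nrm: "\<And>x. x \<in> carrier A \<Longrightarrow> \<parallel>f x\<parallel>\<^bsub>B\<^esub> = \<parallel>x\<parallel>\<^bsub>A\<^esub>"
  shows "cstar_algebra B"
proof -
  interpret A: cstar_algebra A by fact
  have img: "carrier B = f ` carrier A"
    using bij by (simp add: bij_betw_def)
  have inj: "f x = f y \<longleftrightarrow> x = y" if "x \<in> carrier A" "y \<in> carrier A" for x y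
    using bij that by (auto simp: bij_betw_def inj_on_def)
  \<comment> \<open>Oriented backwards, so that simplification moves every operation of
    \<open>B\<close> inside \<open>f\<close>.\<close>
  note ops = add[symmetric] zero[symmetric] smult[symmetric] mult[symmetric] adj[symmetric]
  interpret B: abelian_group B
  proof (rule abelian_groupI)
    show "\<exists>y\<in>carrier B. y \<oplus>\<^bsub>B\<^esub> x = \<zero>\<^bsub>B\<^esub>" if "x \<in> carrier B" for x
    proof -
      obtain a where "a \<in> carrier A" "x = f a"
        using \<open>x \<in> carrier B\<close> img by blast
      then show ?thesis
        by (intro bexI[of _ "f (\<ominus>\<^bsub>A\<^esub> a)"]) (simp_all add: ops img A.l_neg)
    qed
  qed (auto simp: img ops A.a_assoc A.a_comm A.a_lcomm)
  have mod: "module complex_ring B"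
    by (intro moduleI cring_complex_ring B.abelian_group_axioms)
      (auto simp: img ops complex_ring_def A.smult_add_left A.smult_add_right A.smult_mult)
  have minus: "f x \<ominus>\<^bsub>B\<^esub> f y = f (x \<ominus>\<^bsub>A\<^esub> y)" if "x \<in> carrier A" "y \<in> carrier A" for x y
  proof -
    have "\<ominus>\<^bsub>B\<^esub> f y = f (\<ominus>\<^bsub>A\<^esub> y)"
      using that by (intro B.minus_equality) (simp_all add: img ops A.l_neg)
    then show ?thesis
      using that by (simp add: a_minus_def ops)
  qed
  have cdist: "cdist B (f x) (f y) = cdist A x y" if "x \<in> carrier A" "y \<in> carrier A" for x y
    using that by (simp add: cdist_def img minus nrm)
  have cdist0: "cdist B X Y = 0" if "X \<notin> carrier B \<or> Y \<notin> carrier B" for X Y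
    using that by (auto simp: cdist_def)
  interpret MA: Metric_space "carrier A" "cdist A"
    by (rule A.Metric_space_cdist)
  interpret MB: Metric_space "carrier B" "cdist B"
  proof
    fix X Y Z
    show "0 \<le> cdist B X Y"
      by (cases "X \<in> carrier B \<and> Y \<in> carrier B") (auto simp: cdist0 img cdist)
    show "cdist B X Y = cdist B Y X"
      by (cases "X \<in> carrier B \<and> Y \<in> carrier B") (auto simp: cdist0 img cdist MA.commute)
    show "(cdist B X Y = 0) = (X = Y)" if "X \<in> carrier B" "Y \<in> carrier B"
      using that by (auto simp: img cdist inj)
    show "cdist B X Z \<le> cdist B X Y + cdist B Y Z"
      if "X \<in> carrier B" "Y \<in> carrier B" "Z \<in> carrier B"
      using that by (auto simp: img cdist MA.triangle)
  qed
  have "MB.mcomplete"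
    unfolding MB.mcomplete_def
  proof (intro allI impI)
    fix \<sigma> assume \<sigma>: "MB.MCauchy \<sigma>"
    define \<tau> where "\<tau> n = inv_into (carrier A) f (\<sigma> n)" for n
    have \<sigma>B: "\<sigma> n \<in> carrier B" for n
      using \<sigma> by (auto simp: MB.MCauchy_def)
    have \<tau>: "\<tau> n \<in> carrier A" "\<sigma> n = f (\<tau> n)" for n
      using \<sigma>B[of n] by (auto simp: \<tau>_def img inv_into_into f_inv_into_f)
    have "MA.MCauchy \<tau>"
      using \<sigma> \<tau> by (auto simp: MB.MCauchy_def MA.MCauchy_def cdist)
    then obtain x where "limitin MA.mtopology \<tau> x sequentially"
      using A.complete by (auto simp: MA.mcomplete_def)
    then have x: "x \<in> carrier A" "\<And>e. e > 0 \<Longrightarrow> \<forall>\<^sub>F n in sequentially. \<tau> n \<in> carrier A \<and> cdist A (\<tau> n) x < e"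
      by (auto simp: MA.limitin_metric)
    have "limitin MB.mtopology \<sigma> (f x) sequentially"
      unfolding MB.limitin_metric
    proof (intro conjI allI impI)
      show "f x \<in> carrier B"
        using x(1) by (simp add: img)
      fix e :: real assume "e > 0"
      from x(2)[OF this] show "\<forall>\<^sub>F n in sequentially. \<sigma> n \<in> carrier B \<and> cdist B (\<sigma> n) (f x) < e"
        by eventually_elim (simp add: \<tau> img cdist x(1))
    qed
    then show "\<exists>x. limitin MB.mtopology \<sigma> x sequentially" ..
  qed
  then show ?thesis
    by (intro cstar_algebra.intro mod cstar_algebra_axioms.intro)
      (auto simp: img ops inj nrm A.mult_assoc A.mult_add_left A.mult_add_right A.mult_smult_left
        A.mult_smult_right A.adj_add A.adj_smult A.adj_mult A.nrm_eq_0 A.nrm_triangle A.nrm_smult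
        A.nrm_mult A.cstar_identity)
qed

lemma (in cstar_alg) nrm_mult_diff:
  assumes "x \<in> carrier A" "u \<in> carrier A" "y \<in> carrier A" "v \<in> carrier A"
  shows "\<parallel>x \<otimes> u \<ominus> y \<otimes> v\<parallel> \<le> \<parallel>x \<ominus> y\<parallel> * \<parallel>u\<parallel> + \<parallel>y\<parallel> * \<parallel>u \<ominus> v\<parallel>"
  using up.N_mult_diff[of "emb x" "emb u" "emb y" "emb v"] assms
  by (simp flip: emb_mult emb_minus)

lemma (in cstar_alg) nrm_diff_triangle:
  assumes "x \<in> carrier A" "y \<in> carrier A" "z \<in> carrier A"
  shows "\<parallel>x \<ominus> z\<parallel> \<le> \<parallel>x \<ominus> y\<parallel> + \<parallel>y \<ominus> z\<parallel>"
  using Metric_space.triangle[OF Metric_space_cdist assms] assms by (simp add: cdist_def)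

section \<open>Squares and products under the approximations\<close>

context cpc_approximations
begin

sublocale A: cstar_alg A
  using separable by (simp add: separable_cstar_def cstar_alg_def)

sublocale cstar_sequence F
  by (rule cstar_sequence.intro) (use finite_dim in \<open>simp add: finite_dim_cstar_def\<close>)

sublocale \<psi>: cpc_map A "F n" "\<psi> n" for n
  by unfold_locales (rule cpc_down)

sublocale \<phi>: cpc_map "F n" A "\<phi> n" for n
  by unfold_locales (rule cpc_up)

lemma approx_emb: "a \<in> carrier A \<Longrightarrow> A.up.tends (\<lambda>n. A.emb (\<phi> n (\<psi> n a))) (A.emb a)"
  using approx by (simp add: A.tends_emb_iff)

lemma approx_square:
  assumes a: "a \<in> carrier A"
  shows "A.up.tends (\<lambda>n. A.emb (\<phi> n ((\<psi> n a)\<^sup>\<star>\<^bsub>F n\<^esub> \<otimes>\<^bsub>F n\<^esub> \<psi> n a))) (ustar (A.emb a) * A.emb a)"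
proof -
  define R where "R n = A.emb (\<phi> n ((\<psi> n a)\<^sup>\<star>\<^bsub>F n\<^esub> \<otimes>\<^bsub>F n\<^esub> \<psi> n a))" for n
  define S where "S n = A.emb ((\<phi> n (\<psi> n a))\<^sup>\<star>\<^bsub>A\<^esub> \<otimes>\<^bsub>A\<^esub> \<phi> n (\<psi> n a))" for n
  define T where "T n = A.emb (\<phi> n (\<psi> n (a\<^sup>\<star>\<^bsub>A\<^esub> \<otimes>\<^bsub>A\<^esub> a)))" for n
  have S: "A.up.tends S (ustar (A.emb a) * A.emb a)"
    unfolding S_def using a
    by (simp add: A.emb_mult A.emb_adj) (intro A.up.tends_mult A.up.tends_st approx_emb a)
  have "A.up.tends T (A.emb (a\<^sup>\<star>\<^bsub>A\<^esub> \<otimes>\<^bsub>A\<^esub> a))"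
    unfolding T_def using a by (intro approx_emb) simp
  then have T: "A.up.tends T (ustar (A.emb a) * A.emb a)"
    using a by (simp add: A.emb_mult A.emb_adj)
  have TS: "A.up.tends (\<lambda>n. T n - S n) 0"
    using A.up.tends_diff[OF T S] by simp
  \<comment> \<open>The norm respects \<open>0 \<le> R n - S n \<le> T n - S n\<close>, and the
    right-hand side tends to 0.\<close>
  have RS: "A.upnorm (R n - S n) \<le> A.upnorm (T n - S n)" for n
  proof -
    let ?z = "\<psi> n a"
    let ?R = "\<phi> n (?z\<^sup>\<star>\<^bsub>F n\<^esub> \<otimes>\<^bsub>F n\<^esub> ?z)" and ?S = "(\<phi> n ?z)\<^sup>\<star>\<^bsub>A\<^esub> \<otimes>\<^bsub>A\<^esub> \<phi> n ?z"
      and ?T = "\<phi> n (\<psi> n (a\<^sup>\<star>\<^bsub>A\<^esub> \<otimes>\<^bsub>A\<^esub> a))"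
    have in_A: "?R \<in> carrier A" "?S \<in> carrier A" "?T \<in> carrier A"
      using a by simp_all
    have 1: "positive_elem A (?R \<ominus>\<^bsub>A\<^esub> ?S)"
      using a by (intro \<phi>.Kadison_Schwarz) simp
    have "positive_elem (F n) (\<psi> n (a\<^sup>\<star>\<^bsub>A\<^esub> \<otimes>\<^bsub>A\<^esub> a) \<ominus>\<^bsub>F n\<^esub> ?z\<^sup>\<star>\<^bsub>F n\<^esub> \<otimes>\<^bsub>F n\<^esub> ?z)"
      by (rule \<psi>.Kadison_Schwarz[OF a])
    then have "positive_elem A (\<phi> n (\<psi> n (a\<^sup>\<star>\<^bsub>A\<^esub> \<otimes>\<^bsub>A\<^esub> a) \<ominus>\<^bsub>F n\<^esub> ?z\<^sup>\<star>\<^bsub>F n\<^esub> \<otimes>\<^bsub>F n\<^esub> ?z))"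
      by (rule \<phi>.positive)
    then have "A.up.pos (A.emb (?T \<ominus>\<^bsub>A\<^esub> ?R))"
      using a in_A by (simp add: \<phi>.minus A.pos_emb_iff)
    moreover have "A.up.pos (A.emb (?R \<ominus>\<^bsub>A\<^esub> ?S))"
      using 1 in_A by (simp add: A.pos_emb_iff)
    ultimately show ?thesis
      using A.up.N_mono[of "R n - S n" "T n - S n"] in_A
      by (simp add: A.emb_minus R_def S_def T_def)
  qed
  have "A.up.tends (\<lambda>n. R n - S n) 0"
    by (rule A.up.tends_bound[of _ _ "\<lambda>n. A.upnorm (T n - S n)"])
      (use RS TS in \<open>simp_all add: A.up.tends_def\<close>)
  then have "A.up.tends (\<lambda>n. R n - S n + S n) (0 + ustar (A.emb a) * A.emb a)"
    by (rule A.up.tends_add[OF _ S])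
  then show ?thesis
    by (simp add: R_def)
qed

lemma approx_mult:
  assumes a: "a \<in> carrier A" and b: "b \<in> carrier A"
  shows "(\<lambda>n. A.dst (\<phi> n (\<psi> n a \<otimes>\<^bsub>F n\<^esub> \<psi> n b)) (a \<otimes>\<^bsub>A\<^esub> b)) \<longlonglongrightarrow> 0"
proof -
  \<comment> \<open>The defect of multiplicativity for the product of the adjoint of
    \<open>a\<close> with \<open>b\<close>. It is sesquilinear, and its diagonal tends to 0 by
    \<open>approx_square\<close>.\<close>
  define S where "S a b n = A.emb (\<phi> n ((\<psi> n a)\<^sup>\<star>\<^bsub>F n\<^esub> \<otimes>\<^bsub>F n\<^esub> \<psi> n b)) - ustar (A.emb a) * A.emb b" for a b n
  have SS: "A.up.tends (\<lambda>n. S a a n) 0" if "a \<in> carrier A" for a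
    using A.up.tends_diff[OF approx_square[OF that] A.up.tends_const[of "ustar (A.emb a) * A.emb a"]]
    by (simp add: S_def)
  have Sadd: "S (a \<oplus>\<^bsub>A\<^esub> b) (a \<oplus>\<^bsub>A\<^esub> b) n = S a a n + S a b n + S b a n + S b b n"
    if "a \<in> carrier A" "b \<in> carrier A" for a b n
    using that by (simp add: S_def \<psi>.add \<phi>.add F.adj_add F.mult_add_left F.mult_add_right A.emb_add
        A.up.st_add algebra_simps)
  have Sr: "S a (\<i> \<odot>\<^bsub>A\<^esub> b) n = uimag * S a b n" if "a \<in> carrier A" "b \<in> carrier A" for a b n
    using that by (simp add: S_def \<psi>.smult \<phi>.smult F.mult_smult_right A.emb_smult_ii right_diff_distrib
        A.up.j_mult_left)
  have neg: "A.emb ((- \<i>) \<odot>\<^bsub>A\<^esub> x) = - (uimag * A.emb x)" if "x \<in> carrier A" for x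
    using that by (simp add: A.smult_minus A.emb_a_inv A.emb_smult_ii)
  have Sl: "S (\<i> \<odot>\<^bsub>A\<^esub> b) a n = - (uimag * S b a n)" if "a \<in> carrier A" "b \<in> carrier A" for a b n
    using that by (simp add: S_def \<psi>.smult \<phi>.smult F.mult_smult_left F.adj_smult neg A.emb_smult_ii
        A.up.st_mult A.up.st_j A.up.j_central right_diff_distrib mult.assoc)
  \<comment> \<open>Expanding the diagonal at the sum of \<open>a\<close> and \<open>b\<close>
    isolates the symmetric part.\<close>
  have 1: "A.up.tends (\<lambda>n. S a b n + S b a n) 0" if "a \<in> carrier A" "b \<in> carrier A" for a b
  proof -
    have "A.up.tends (\<lambda>n. S (a \<oplus>\<^bsub>A\<^esub> b) (a \<oplus>\<^bsub>A\<^esub> b) n - S a a n - S b b n) (0 - 0 - 0)"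
      by (intro A.up.tends_diff SS A.add.m_closed that)
    then show ?thesis
      using that by (simp add: Sadd algebra_simps)
  qed
  \<comment> \<open>The symmetric part at \<open>\<i> b\<close> is \<i> times the antisymmetric part
    at \<open>b\<close>; the factor \<open>- uimag\<close> undoes the \<i>.\<close>
  have 2: "A.up.tends (\<lambda>n. S a b n - S b a n) 0" if "a \<in> carrier A" "b \<in> carrier A" for a b
  proof -
    have "A.up.tends (\<lambda>n. - uimag * (S a (\<i> \<odot>\<^bsub>A\<^esub> b) n + S (\<i> \<odot>\<^bsub>A\<^esub> b) a n)) (- uimag * 0)"
      using that by (intro A.up.tends_mult A.up.tends_const 1) auto
    then show ?thesis
      using that by (simp add: Sr Sl right_diff_distrib distrib_left)
  qed
  have "A.up.tends (\<lambda>n. (1/2) *\<^sub>R ((S (a\<^sup>\<star>\<^bsub>A\<^esub>) b n + S b (a\<^sup>\<star>\<^bsub>A\<^esub>) n) + (S (a\<^sup>\<star>\<^bsub>A\<^esub>) b n - S b (a\<^sup>\<star>\<^bsub>A\<^esub>) n)))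
      ((1/2) *\<^sub>R (0 + 0))"
    using a b by (intro A.up.tends_scaleR A.up.tends_add 1 2) auto
  then have "A.up.tends (\<lambda>n. S (a\<^sup>\<star>\<^bsub>A\<^esub>) b n) 0"
    by (simp add: scaleR_half_double)
  then show ?thesis
    using a b by (simp add: S_def A.up.tends_def \<psi>.adj A.emb_adj flip: A.emb_mult A.emb_minus)
qed

end

section \<open>The limit of a summable system\<close>

lemma connecting_self: "connecting \<rho> n n = id"
  by (cases n) simp_all

context cpc_approximations
begin

definition \<rho> :: "nat \<Rightarrow> 'b \<Rightarrow> 'b" where
  "\<rho> n = \<psi> (Suc n) \<circ> \<phi> n"

abbreviation "conn \<equiv> connecting \<rho>"

lemma conn_Suc: "n \<le> m \<Longrightarrow> conn (Suc m) n x = \<psi> (Suc m) (\<phi> m (conn m n x))"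
  by (simp add: \<rho>_def)

lemma conn_in_le:
  assumes "n \<le> m" "x \<in> carrier (F n)"
  shows "conn m n x \<in> carrier (F m) \<and> nrm (F m) (conn m n x) \<le> nrm (F n) x"
  using assms(1)
proof (induction m rule: dec_induct)
  case base
  then show ?case
    using assms(2) by (simp add: connecting_self)
next
  case (step m)
  then have "nrm (F (Suc m)) (\<psi> (Suc m) (\<phi> m (conn m n x))) \<le> nrm A (\<phi> m (conn m n x))"
    by (intro \<psi>.contractive) simp
  also have "\<dots> \<le> nrm (F m) (conn m n x)"
    using step by (intro \<phi>.contractive) simp
  finally show ?case
    using step by (simp only: conn_Suc) simp
qed

lemma conn_in [simp]: "n \<le> m \<Longrightarrow> x \<in> carrier (F n) \<Longrightarrow> conn m n x \<in> carrier (F m)"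
  using conn_in_le by blast

lemma conn_le: "n \<le> m \<Longrightarrow> x \<in> carrier (F n) \<Longrightarrow> nrm (F m) (conn m n x) \<le> nrm (F n) x"
  using conn_in_le by blast

section \<open>The isometry into the sequence algebra\<close>

definition \<Psi> :: "'a \<Rightarrow> (nat \<Rightarrow> 'b) set" where
  "\<Psi> a = cl (\<lambda>n. \<psi> n a)"

lemma \<psi>_prod: "a \<in> carrier A \<Longrightarrow> (\<lambda>n. \<psi> n a) \<in> carrier P"
  by (rule prodI[of _ "nrm A a"]) (simp_all add: \<psi>.contractive)

lemma \<Psi>_in: "a \<in> carrier A \<Longrightarrow> \<Psi> a \<in> carrier Q"
  by (simp add: \<Psi>_def Q_carrier \<psi>_prod)

lemma \<Psi>_add: "\<lbrakk>a \<in> carrier A; b \<in> carrier A\<rbrakk> \<Longrightarrow> \<Psi> (a \<oplus>\<^bsub>A\<^esub> b) = \<Psi> a \<oplus>\<^bsub>Q\<^esub> \<Psi> b"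
  by (simp add: \<Psi>_def Q_add \<psi>_prod \<psi>.add)

lemma \<Psi>_minus: "\<lbrakk>a \<in> carrier A; b \<in> carrier A\<rbrakk> \<Longrightarrow> \<Psi> (a \<ominus>\<^bsub>A\<^esub> b) = \<Psi> a \<ominus>\<^bsub>Q\<^esub> \<Psi> b"
  by (simp add: \<Psi>_def Q_minus \<psi>_prod \<psi>.minus)

lemma \<Psi>_smult: "a \<in> carrier A \<Longrightarrow> \<Psi> (c \<odot>\<^bsub>A\<^esub> a) = c \<odot>\<^bsub>Q\<^esub> \<Psi> a"
  by (simp add: \<Psi>_def Q_smult \<psi>_prod \<psi>.smult)

lemma \<Psi>_adj: "a \<in> carrier A \<Longrightarrow> \<Psi> (a\<^sup>\<star>\<^bsub>A\<^esub>) = (\<Psi> a)\<^sup>\<star>\<^bsub>Q\<^esub>"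
  by (simp add: \<Psi>_def Q_adj \<psi>_prod \<psi>.adj)

lemma \<Psi>_zero: "\<Psi> \<zero>\<^bsub>A\<^esub> = \<zero>\<^bsub>Q\<^esub>"
  by (simp add: \<Psi>_def Q_zero \<psi>.zero)

lemma approx_nrm: "a \<in> carrier A \<Longrightarrow> (\<lambda>n. nrm A (\<phi> n (\<psi> n a))) \<longlonglongrightarrow> nrm A a"
  using A.up.tends_N[OF approx_emb, of a] by simp

text \<open>For the lower bound, an eventual bound on the norms of \<open>\<psi> n a\<close> passes
  through the contractions \<open>\<phi> n\<close> to \<open>\<phi> n (\<psi> n a)\<close>, and from
  there to the limit \<open>a\<close>.\<close>

lemma \<Psi>_nrm:
  assumes a: "a \<in> carrier A"
  shows "nrm Q (\<Psi> a) = nrm A a"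
proof (rule antisym)
  show "nrm Q (\<Psi> a) \<le> nrm A a"
    unfolding \<Psi>_def using a by (intro Q_nrm_le \<psi>_prod) (simp_all add: \<psi>.contractive)
  show "nrm A a \<le> nrm Q (\<Psi> a)"
  proof (rule dense_ge)
    fix r assume "nrm Q (\<Psi> a) < r"
    then have "\<forall>\<^sub>F n in sequentially. nrm (F n) (\<psi> n a) < r"
      unfolding \<Psi>_def by (rule Q_nrm_less[OF \<psi>_prod[OF a]])
    then have "\<forall>\<^sub>F n in sequentially. nrm A (\<phi> n (\<psi> n a)) \<le> r"
    proof eventually_elim
      case (elim n)
      then show ?case
        using \<phi>.contractive[of "\<psi> n a" n] a by simp
    qed
    then show "nrm A a \<le> r"
      by (rule tendsto_upperbound[OF approx_nrm[OF a]]) simp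
  qed
qed

lemma \<Psi>_dist: "\<lbrakk>a \<in> carrier A; b \<in> carrier A\<rbrakk> \<Longrightarrow> cdist Q (\<Psi> a) (\<Psi> b) = A.dst a b"
  by (simp add: cdist_def \<Psi>_in \<Psi>_nrm flip: \<Psi>_minus)

lemma \<Psi>_inj: "inj_on \<Psi> (carrier A)"
proof (rule inj_onI)
  fix a b assume ab: "a \<in> carrier A" "b \<in> carrier A" "\<Psi> a = \<Psi> b"
  then have "cdist Q (\<Psi> a) (\<Psi> b) = 0"
    using Q.zero \<Psi>_in by blast
  then show "a = b"
    by (simp only: \<Psi>_dist[OF ab(1,2)] A.eq_iff_nrm[OF ab(1,2)])
qed

lemma \<Psi>_limitin:
  assumes "\<forall>\<^sub>F n in sequentially. X n \<in> carrier A" "a \<in> carrier A"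
    and lim: "(\<lambda>n. A.dst (X n) a) \<longlonglongrightarrow> 0"
  shows "limitin Q.mtopology (\<lambda>n. \<Psi> (X n)) (\<Psi> a) sequentially"
  unfolding Q.limitin_metric
proof (intro conjI allI impI)
  show "\<Psi> a \<in> carrier Q"
    using assms by (simp add: \<Psi>_in)
  fix e :: real assume "e > 0"
  then have "\<forall>\<^sub>F n in sequentially. A.dst (X n) a < e"
    using lim by (intro order_tendstoD(2)) auto
  then show "\<forall>\<^sub>F n in sequentially. \<Psi> (X n) \<in> carrier Q \<and> cdist Q (\<Psi> (X n)) (\<Psi> a) < e"
    using assms(1)
  proof eventually_elim
    case (elim n)
    then show ?case
      using assms(2) by (simp add: \<Psi>_in \<Psi>_dist)
  qed
qed

end

lemma LIMSEQ_zero_less: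
  assumes "f \<longlonglongrightarrow> (0::real)" "e > 0"
  shows "\<exists>M. \<forall>m\<ge>M. f m < e"
  using order_tendstoD(2)[OF assms] by (simp add: eventually_sequentially)

section \<open>Summability and lifts to the algebra\<close>

context summable_cpc_approximations
begin

text \<open>Evaluating the operator norm at normalised elements turns the summability condition for
  neighbouring indices into a pointwise estimate.\<close>

lemma step_bound:
  "\<exists>\<epsilon>. summable \<epsilon> \<and> (\<forall>m. 0 \<le> \<epsilon> m) \<and> (\<forall>n. \<forall>x\<in>carrier (F n).
    A.dst (\<phi> n x) (\<phi> (Suc n) (\<psi> (Suc n) (\<phi> n x))) \<le> \<epsilon> (Suc n) * nrm (F n) x)"
proof -
  obtain \<epsilon> where \<epsilon>: "\<forall>m. 0 \<le> \<epsilon> m" "summable \<epsilon>"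
    "\<forall>n m. n < m \<longrightarrow> operator_norm (F n) A (\<lambda>x. \<phi> n x \<ominus>\<^bsub>A\<^esub> \<phi> m (\<psi> m (\<phi> n x))) < \<epsilon> m"
    using summable_approx by blast
  have "A.dst (\<phi> n x) (\<phi> (Suc n) (\<psi> (Suc n) (\<phi> n x))) \<le> \<epsilon> (Suc n) * nrm (F n) x"
    if x: "x \<in> carrier (F n)" for n x
  proof -
    define T where "T x = \<phi> n x \<ominus>\<^bsub>A\<^esub> \<phi> (Suc n) (\<psi> (Suc n) (\<phi> n x))" for x
    have T_in: "T y \<in> carrier A" if "y \<in> carrier (F n)" for y
      using that by (simp add: T_def)
    \<comment> \<open>This makes the image of the unit ball bounded; otherwise the real-valued
      supremum in \<open>operator_norm\<close> need not be an upper bound.\<close>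
    have "nrm A (T y) \<le> 2" if y: "y \<in> carrier (F n)" "nrm (F n) y \<le> 1" for y
    proof -
      have "nrm A (T y) \<le> nrm A (\<phi> n y) + nrm A (\<phi> (Suc n) (\<psi> (Suc n) (\<phi> n y)))"
        using y A.nrm_triangle[of "\<phi> n y" "\<ominus>\<^bsub>A\<^esub> \<phi> (Suc n) (\<psi> (Suc n) (\<phi> n y))"]
        by (simp add: T_def a_minus_def A.nrm_a_inv)
      moreover have "nrm A (\<phi> (Suc n) (\<psi> (Suc n) (\<phi> n y))) \<le> nrm (F (Suc n)) (\<psi> (Suc n) (\<phi> n y))"
        using y by (intro \<phi>.contractive) simp
      moreover have "\<dots> \<le> nrm A (\<phi> n y)"
        using y by (intro \<psi>.contractive) simp
      moreover have "\<dots> \<le> nrm (F n) y"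
        using y by (intro \<phi>.contractive)
      ultimately show ?thesis
        using y(2) by linarith
    qed
    then have bdd: "bdd_above ((\<lambda>y. nrm A (T y)) ` {y \<in> carrier (F n). nrm (F n) y \<le> 1})"
      by (intro bdd_aboveI2[of _ _ 2]) auto
    have "operator_norm (F n) A T < \<epsilon> (Suc n)"
      using \<epsilon>(3) unfolding T_def by blast
    then have unit: "nrm A (T y) \<le> \<epsilon> (Suc n)" if "y \<in> carrier (F n)" "nrm (F n) y \<le> 1" for y
      using cSUP_upper[OF _ bdd, of y] that unfolding operator_norm_def by auto
    have "nrm A (T x) \<le> \<epsilon> (Suc n) * nrm (F n) x"
    proof (cases "nrm (F n) x = 0")
      case True
      then have "x = \<zero>\<^bsub>F n\<^esub>"
        using x by (simp add: F.nrm_eq_0)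
      then show ?thesis
        by (simp add: T_def \<phi>.zero \<psi>.zero a_minus_def A.r_neg)
    next
      case False
      then have pos: "nrm (F n) x > 0"
        using F.nrm_nonneg[OF x] by linarith
      let ?c = "complex_of_real (1 / nrm (F n) x)"
      have lin: "T (c \<odot>\<^bsub>F n\<^esub> y) = c \<odot>\<^bsub>A\<^esub> T y" if "y \<in> carrier (F n)" for c y
        using that A.smult_add_right[of "\<phi> n y" "\<ominus>\<^bsub>A\<^esub> \<phi> (Suc n) (\<psi> (Suc n) (\<phi> n y))" c]
        by (simp add: T_def \<phi>.smult \<psi>.smult a_minus_def mult.commute flip: A.smult_minus_one A.smult_mult)
      have "nrm (F n) (?c \<odot>\<^bsub>F n\<^esub> x) \<le> 1"
        using x pos by (simp add: F.nrm_smult norm_divide)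
      then have "nrm A (T (?c \<odot>\<^bsub>F n\<^esub> x)) \<le> \<epsilon> (Suc n)"
        using x by (intro unit) simp_all
      then have "cmod ?c * nrm A (T x) \<le> \<epsilon> (Suc n)"
        by (simp only: lin[OF x] A.nrm_smult[OF T_in[OF x]])
      moreover have "cmod ?c = 1 / nrm (F n) x"
        using pos by (simp only: norm_of_real) simp
      ultimately show ?thesis
        using pos by (simp add: pos_divide_le_eq)
    qed
    then show ?thesis
      by (simp add: T_def)
  qed
  then show ?thesis
    using \<epsilon> by blast
qed

text \<open>A modulus for the Cauchy property that is uniform in the starting index
  \<open>n\<close>. The uniformity matters when the starting index itself tends to infinity, as for
  the lifts of \<open>\<psi> n a\<close> and of products formed in \<open>F n\<close>.\<close>

definition is_tail :: "(nat \<Rightarrow> real) \<Rightarrow> bool" where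
  "is_tail t \<longleftrightarrow> t \<longlonglongrightarrow> 0 \<and> (\<forall>m. 0 \<le> t m) \<and> (\<forall>n m m' x. n \<le> m \<longrightarrow> m \<le> m' \<longrightarrow> x \<in> carrier (F n) \<longrightarrow>
    A.dst (\<phi> m' (conn m' n x)) (\<phi> m (conn m n x)) \<le> t m * nrm (F n) x)"

lemma is_tail_exists: "\<exists>t. is_tail t"
proof -
  obtain \<epsilon> where \<epsilon>: "summable \<epsilon>" "\<And>m. 0 \<le> \<epsilon> m"
    and \<epsilon>_step: "\<And>n x. x \<in> carrier (F n) \<Longrightarrow> A.dst (\<phi> n x) (\<phi> (Suc n) (\<psi> (Suc n) (\<phi> n x))) \<le> \<epsilon> (Suc n) * nrm (F n) x"
    using step_bound by blast
  \<comment> \<open>Passing from index \<open>k\<close> to \<open>Suc k\<close> costs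
    \<open>\<epsilon> (Suc k)\<close>; with \<open>\<epsilon> m\<close> included in
    \<open>s m\<close>, the increments of \<open>s\<close> are exactly these costs.\<close>
  define s where "s m = sum \<epsilon> {..<Suc m}" for m
  have s_lim: "s \<longlonglongrightarrow> suminf \<epsilon>"
    unfolding s_def using \<epsilon>(1) by (intro LIMSEQ_Suc summable_LIMSEQ)
  have s_le: "s m \<le> suminf \<epsilon>" for m
    unfolding s_def using \<epsilon> by (intro sum_le_suminf) auto
  have diff: "A.dst (\<phi> m' (conn m' n x)) (\<phi> m (conn m n x)) \<le> (s m' - s m) * nrm (F n) x"
    if "n \<le> m" "m \<le> m'" and x: "x \<in> carrier (F n)" for n m m' x
    using \<open>m \<le> m'\<close>
  proof (induction m' rule: dec_induct)
    case base
    show ?case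
      using \<open>n \<le> m\<close> x by (simp add: a_minus_def A.r_neg)
  next
    case (step k)
    have nk: "n \<le> k"
      using step \<open>n \<le> m\<close> by simp
    have "A.dst (\<phi> (Suc k) (conn (Suc k) n x)) (\<phi> k (conn k n x)) \<le> \<epsilon> (Suc k) * nrm (F k) (conn k n x)"
      using \<epsilon>_step[of "conn k n x" k]
        A.nrm_minus_commute[of "\<phi> k (conn k n x)" "\<phi> (Suc k) (conn (Suc k) n x)"] x nk
      by (simp add: conn_Suc del: connecting.simps)
    also have "\<dots> \<le> \<epsilon> (Suc k) * nrm (F n) x"
      using x nk \<epsilon>(2) by (intro mult_left_mono conn_le)
    finally have "A.dst (\<phi> (Suc k) (conn (Suc k) n x)) (\<phi> k (conn k n x)) \<le> \<epsilon> (Suc k) * nrm (F n) x" .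
    moreover have "A.dst (\<phi> (Suc k) (conn (Suc k) n x)) (\<phi> m (conn m n x))
        \<le> A.dst (\<phi> (Suc k) (conn (Suc k) n x)) (\<phi> k (conn k n x)) + A.dst (\<phi> k (conn k n x)) (\<phi> m (conn m n x))"
      using x nk \<open>n \<le> m\<close> by (intro A.nrm_diff_triangle) (simp_all del: connecting.simps)
    moreover have "s (Suc k) = s k + \<epsilon> (Suc k)"
      by (simp add: s_def)
    ultimately show ?case
      using step.IH by (simp add: algebra_simps del: connecting.simps)
  qed
  have "is_tail (\<lambda>m. suminf \<epsilon> - s m)"
    unfolding is_tail_def
  proof (intro conjI allI impI)
    show "(\<lambda>m. suminf \<epsilon> - s m) \<longlonglongrightarrow> 0"
      using tendsto_diff[OF tendsto_const[of "suminf \<epsilon>"] s_lim] by simp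
    show "0 \<le> suminf \<epsilon> - s m" for m
      using s_le by simp
    show "A.dst (\<phi> m' (conn m' n x)) (\<phi> m (conn m n x)) \<le> (suminf \<epsilon> - s m) * nrm (F n) x"
      if "n \<le> m" "m \<le> m'" "x \<in> carrier (F n)" for n m m' x
      using diff[OF that] mult_right_mono[of "s m' - s m" "suminf \<epsilon> - s m" "nrm (F n) x"] s_le[of m'] that(3)
      by (auto intro: order_trans)
  qed
  then show ?thesis
    by (rule exI[of is_tail])
qed

definition tail :: "nat \<Rightarrow> real" where
  "tail = (SOME t. is_tail t)"

lemma is_tail: "is_tail tail"
  unfolding tail_def by (rule someI_ex[OF is_tail_exists])

lemma tail_lim: "tail \<longlonglongrightarrow> 0" and tail_nonneg: "0 \<le> tail m"
  using is_tail by (auto simp: is_tail_def)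

lemma tail_bound: "\<lbrakk>n \<le> m; m \<le> m'; x \<in> carrier (F n)\<rbrakk> \<Longrightarrow>
    A.dst (\<phi> m' (conn m' n x)) (\<phi> m (conn m n x)) \<le> tail m * nrm (F n) x"
  using is_tail unfolding is_tail_def by blast

lemma tail_scaled: "(\<lambda>m. tail m * r) \<longlonglongrightarrow> 0"
  using tail_lim by (rule tendsto_mult_left_zero)

lemma lift_exists:
  assumes x: "x \<in> carrier (F n)"
  shows "\<exists>a\<in>carrier A. \<forall>m\<ge>n. A.dst (\<phi> m (conn m n x)) a \<le> tail m * nrm (F n) x"
proof -
  \<comment> \<open>\<open>conn m n\<close> is meaningful for \<open>m \<ge> n\<close> only, hence
    the shifted index.\<close>
  define T where "T m = \<phi> (m + n) (conn (m + n) n x)" for m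
  have T_in: "T m \<in> carrier A" for m
    using x by (simp add: T_def)
  have T_diff: "A.dst (T m') (T m) \<le> tail (m + n) * nrm (F n) x" if "m \<le> m'" for m m'
    using tail_bound[of n "m + n" "m' + n" x] that x by (simp add: T_def)
  obtain a where a: "a \<in> carrier A" "(\<lambda>m. A.dst (T m) a) \<longlonglongrightarrow> 0"
  proof (rule A.Cauchy_limit[OF T_in])
    fix e :: real assume "e > 0"
    then obtain M where M: "\<And>m. m \<ge> M \<Longrightarrow> tail m * nrm (F n) x < e"
      using LIMSEQ_zero_less[OF tail_scaled] by blast
    have "A.dst (T m') (T m) < e" if "m' \<ge> M" "m \<ge> M" for m m'
    proof (cases "m \<le> m'")
      case True
      then show ?thesis
        using T_diff[of m m'] M[of "m + n"] that by simp
    next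
      case False
      then show ?thesis
        using T_diff[of m' m] M[of "m' + n"] that A.nrm_minus_commute[OF T_in[of m] T_in[of m']] by simp
    qed
    then show "\<exists>M. \<forall>m\<ge>M. \<forall>n\<ge>M. A.dst (T m) (T n) < e"
      by blast
  qed
  have "A.dst (T m) a \<le> tail (m + n) * nrm (F n) x" for m
  proof (rule LIMSEQ_le_const)
    show "(\<lambda>m'. tail (m + n) * nrm (F n) x + A.dst (T m') a) \<longlonglongrightarrow> tail (m + n) * nrm (F n) x"
      using tendsto_add[OF tendsto_const a(2)] by simp
    have "A.dst (T m) a \<le> tail (m + n) * nrm (F n) x + A.dst (T m') a" if "m \<le> m'" for m'
      using A.nrm_diff_triangle[OF T_in[of m] T_in[of m'] a(1)] T_diff[OF that]
        A.nrm_minus_commute[OF T_in[of m] T_in[of m']] by simp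
    then show "\<exists>N. \<forall>m'\<ge>N. A.dst (T m) a \<le> tail (m + n) * nrm (F n) x + A.dst (T m') a"
      by blast
  qed
  then have "A.dst (\<phi> m (conn m n x)) a \<le> tail m * nrm (F n) x" if "m \<ge> n" for m
    using that by (metis T_def le_add_diff_inverse2)
  then show ?thesis
    using a(1) by blast
qed

text \<open>The element of \<open>A\<close> that corresponds to \<open>\<rho>\<^sub>n(x)\<close> in the limit.\<close>

definition lift :: "nat \<Rightarrow> 'b \<Rightarrow> 'a" where
  "lift n x = (SOME a. a \<in> carrier A \<and> (\<forall>m\<ge>n. A.dst (\<phi> m (conn m n x)) a \<le> tail m * nrm (F n) x))"

lemma lift_spec: "x \<in> carrier (F n) \<Longrightarrow>
    lift n x \<in> carrier A \<and> (\<forall>m\<ge>n. A.dst (\<phi> m (conn m n x)) (lift n x) \<le> tail m * nrm (F n) x)"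
  unfolding lift_def by (rule someI_ex) (use lift_exists in blast)

lemma lift_in [simp]: "x \<in> carrier (F n) \<Longrightarrow> lift n x \<in> carrier A"
  using lift_spec by blast

lemma lift_bound: "x \<in> carrier (F n) \<Longrightarrow> n \<le> m \<Longrightarrow> A.dst (\<phi> m (conn m n x)) (lift n x) \<le> tail m * nrm (F n) x"
  using lift_spec by blast

lemma lift_bound_self: "x \<in> carrier (F n) \<Longrightarrow> A.dst (\<phi> n x) (lift n x) \<le> tail n * nrm (F n) x"
  using lift_bound[of x n n] by (simp add: connecting_self)

text \<open>The last map \<open>\<psi> (Suc m)\<close> of the connecting map is a contraction, so
  the error at \<open>Suc m\<close> is governed by the tail at \<open>m\<close>.\<close>

lemma conn_lift_bound:
  assumes x: "x \<in> carrier (F n)" and "n \<le> m"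
  shows "F.dst (Suc m) (conn (Suc m) n x) (\<psi> (Suc m) (lift n x)) \<le> tail m * nrm (F n) x"
proof -
  have "F.dst (Suc m) (\<psi> (Suc m) (\<phi> m (conn m n x))) (\<psi> (Suc m) (lift n x))
      \<le> A.dst (\<phi> m (conn m n x)) (lift n x)"
    using assms by (intro \<psi>.contractive_minus) simp_all
  then show ?thesis
    using lift_bound[OF assms] by (simp only: conn_Suc[OF assms(2)])
qed

lemma conn_lift_lim:
  assumes x: "x \<in> carrier (F n)"
  shows "(\<lambda>m. F.dst m (conn m n x) (\<psi> m (lift n x))) \<longlonglongrightarrow> 0"
proof -
  have "(\<lambda>m. F.dst (Suc m) (conn (Suc m) n x) (\<psi> (Suc m) (lift n x))) \<longlonglongrightarrow> 0"
    by (rule LIMSEQ_zero_squeeze[where k = n, OF tail_scaled _ conn_lift_bound[OF x]])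
      (use x in \<open>simp del: connecting.simps\<close>)
  then show ?thesis
    by (rule LIMSEQ_imp_Suc)
qed

lemma limit_map_eq:
  assumes x: "x \<in> carrier (F n)"
  shows "limit_map F \<rho> n x = \<Psi> (lift n x)"
  unfolding limit_map_def \<Psi>_def
proof (rule class_eqI)
  let ?y = "\<lambda>m. if n < m then conn m n x else \<zero>\<^bsub>F m\<^esub>"
  show "(\<lambda>m. \<psi> m (lift n x)) \<in> carrier P"
    using x by (simp add: \<psi>_prod)
  show "?y \<in> carrier P"
    using x by (intro prodI[of _ "nrm (F n) x"]) (simp_all add: conn_le)
  show "(\<lambda>m. F.dst m (?y m) (\<psi> m (lift n x))) \<longlonglongrightarrow> 0"
  proof (rule Lim_transform_eventually[OF conn_lift_lim[OF x]])
    show "\<forall>\<^sub>F m in sequentially. F.dst m (conn m n x) (\<psi> m (lift n x)) = F.dst m (?y m) (\<psi> m (lift n x))"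
      using eventually_gt_at_top[of n] by eventually_elim simp
  qed
qed

text \<open>By uniformity of \<open>tail\<close>, \<open>lift n (\<psi> n a)\<close> is within
  \<open>tail n * nrm A a\<close> of \<open>\<phi> n (\<psi> n a)\<close>, which tends to
  \<open>a\<close>. The lifts are therefore dense in \<open>A\<close>.\<close>

lemma lift_\<psi>_lim:
  assumes a: "a \<in> carrier A"
  shows "(\<lambda>n. A.dst (lift n (\<psi> n a)) a) \<longlonglongrightarrow> 0"
proof -
  have le: "A.dst (lift n (\<psi> n a)) a \<le> tail n * nrm A a + A.dst (\<phi> n (\<psi> n a)) a" for n
  proof -
    have "A.dst (lift n (\<psi> n a)) a \<le> A.dst (lift n (\<psi> n a)) (\<phi> n (\<psi> n a)) + A.dst (\<phi> n (\<psi> n a)) a"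
      using a by (intro A.nrm_diff_triangle) simp_all
    moreover have "A.dst (lift n (\<psi> n a)) (\<phi> n (\<psi> n a)) \<le> tail n * nrm (F n) (\<psi> n a)"
      using lift_bound_self[of "\<psi> n a" n] A.nrm_minus_commute[of "lift n (\<psi> n a)" "\<phi> n (\<psi> n a)"] a by simp
    moreover have "\<dots> \<le> tail n * nrm A a"
      using a by (intro mult_left_mono \<psi>.contractive tail_nonneg)
    ultimately show ?thesis
      by linarith
  qed
  have "(\<lambda>n. tail n * nrm A a + A.dst (\<phi> n (\<psi> n a)) a) \<longlonglongrightarrow> 0"
    by (intro tendsto_add_zero tail_scaled approx a)
  then show ?thesis
    by (rule LIMSEQ_zero_squeeze[OF _ _ le]) (use a in simp)
qed

text \<open>Density of the lifts puts the range of \<open>\<Psi>\<close> into the closure.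
  Conversely, if \<open>\<Psi> (b k)\<close> approximates a point of the closure, then
  \<open>b\<close> is Cauchy because \<open>\<Psi>\<close> is isometric, and completeness of
  \<open>A\<close> provides a preimage.\<close>

lemma system_limit_eq: "system_limit F \<rho> = \<Psi> ` carrier A"
proof -
  let ?S = "\<Union>n. limit_map F \<rho> n ` carrier (F n)"
  have S: "?S = (\<Union>n. (\<lambda>x. \<Psi> (lift n x)) ` carrier (F n))"
    using limit_map_eq by (intro SUP_cong image_cong refl)
  have L: "system_limit F \<rho> = {X \<in> carrier Q. \<forall>r>0. \<exists>Y\<in>?S. Y \<in> Q.mball X r}"
    by (simp only: system_limit_def norm_topology_def Q.metric_closure_of)
  show ?thesis
  proof
    show "\<Psi> ` carrier A \<subseteq> system_limit F \<rho>"
    proof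
      fix X assume "X \<in> \<Psi> ` carrier A"
      then obtain a where a: "a \<in> carrier A" "X = \<Psi> a"
        by blast
      have "\<exists>Y\<in>?S. Y \<in> Q.mball X r" if "r > 0" for r
      proof -
        obtain n where n: "A.dst (lift n (\<psi> n a)) a < r"
          using LIMSEQ_zero_less[OF lift_\<psi>_lim[OF a(1)] \<open>r > 0\<close>] by blast
        have "\<Psi> (lift n (\<psi> n a)) \<in> ?S"
          unfolding S by (rule UN_I[of n]) (use a in simp_all)
        moreover have "\<Psi> (lift n (\<psi> n a)) \<in> Q.mball X r"
          using n a by (simp add: \<Psi>_in \<Psi>_dist A.nrm_minus_commute[of a])
        ultimately show ?thesis
          by blast
      qed
      then show "X \<in> system_limit F \<rho>"
        unfolding L using a \<Psi>_in by blast
    qed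
    show "system_limit F \<rho> \<subseteq> \<Psi> ` carrier A"
    proof
      fix X assume X: "X \<in> system_limit F \<rho>"
      then have XQ: "X \<in> carrier Q"
        by (simp add: L)
      have "\<exists>a\<in>carrier A. cdist Q X (\<Psi> a) < inverse (real (Suc k))" for k
      proof -
        have "0 < inverse (real (Suc k))"
          by simp
        then obtain Y where Y: "Y \<in> ?S" "Y \<in> Q.mball X (inverse (real (Suc k)))"
          using X unfolding L by blast
        obtain n x where "x \<in> carrier (F n)" "Y = \<Psi> (lift n x)"
          using Y(1) unfolding S by blast
        then show ?thesis
          using Y(2) by (intro bexI[of _ "lift n x"]) simp_all
      qed
      then obtain b where b: "\<And>k. b k \<in> carrier A" "\<And>k. cdist Q X (\<Psi> (b k)) < inverse (real (Suc k))"
        by metis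
      have inv_lim: "(\<lambda>k. inverse (real (Suc k))) \<longlonglongrightarrow> 0"
        by (rule LIMSEQ_inverse_real_of_nat)
      obtain a where a: "a \<in> carrier A" "(\<lambda>k. A.dst (b k) a) \<longlonglongrightarrow> 0"
      proof (rule A.Cauchy_limit[OF b(1)])
        fix e :: real assume "e > 0"
        then obtain M where M: "\<And>k. k \<ge> M \<Longrightarrow> inverse (real (Suc k)) < e / 2"
          using LIMSEQ_zero_less[OF inv_lim, of "e / 2"] by auto
        have "A.dst (b m) (b n) < e" if "m \<ge> M" "n \<ge> M" for m n
        proof -
          have "A.dst (b m) (b n) = cdist Q (\<Psi> (b m)) (\<Psi> (b n))"
            by (simp add: \<Psi>_dist b)
          also have "\<dots> \<le> cdist Q X (\<Psi> (b m)) + cdist Q X (\<Psi> (b n))"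
            using Q.triangle[OF \<Psi>_in[OF b(1)] XQ \<Psi>_in[OF b(1)], of m n] Q.commute[of X] by simp
          also have "\<dots> < e / 2 + e / 2"
            using b(2) M that by (intro add_strict_mono) (meson less_trans)+
          finally show ?thesis by simp
        qed
        then show "\<exists>M. \<forall>m\<ge>M. \<forall>n\<ge>M. A.dst (b m) (b n) < e"
          by blast
      qed
      have "cdist Q X (\<Psi> a) \<le> 0"
      proof (rule LIMSEQ_le_const)
        show "(\<lambda>k. inverse (real (Suc k)) + A.dst (b k) a) \<longlonglongrightarrow> 0"
          by (intro tendsto_add_zero inv_lim a(2))
        have "cdist Q X (\<Psi> a) \<le> inverse (real (Suc k)) + A.dst (b k) a" for k
          using Q.triangle[OF XQ \<Psi>_in[OF b(1)] \<Psi>_in[OF a(1)], of k] b(2)[of k]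
          by (simp add: \<Psi>_dist b(1) a(1))
        then show "\<exists>N. \<forall>k\<ge>N. cdist Q X (\<Psi> a) \<le> inverse (real (Suc k)) + A.dst (b k) a"
          by blast
      qed
      then have "X = \<Psi> a"
        using Q.nonneg[of X "\<Psi> a"] Q.zero[OF XQ \<Psi>_in[OF a(1)]] by simp
      then show "X \<in> \<Psi> ` carrier A"
        using a(1) by blast
    qed
  qed
qed

section \<open>Products along the system\<close>

abbreviation conn_mult :: "nat \<Rightarrow> 'b \<Rightarrow> 'b \<Rightarrow> nat \<Rightarrow> 'b" where
  "conn_mult k x y n \<equiv> conn n k x \<otimes>\<^bsub>F n\<^esub> conn n k y"

text \<open>Up to a vanishing error, \<open>conn n k x\<close> is \<open>\<psi> n\<close> of the
  lift of \<open>x\<close>. Products inherit this because all norms stay bounded, and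
  \<open>approx_mult\<close> evaluates what remains.\<close>

lemma conn_mult_lim:
  assumes x: "x \<in> carrier (F k)" and y: "y \<in> carrier (F k)"
  shows "(\<lambda>n. A.dst (\<phi> n (conn_mult k x y n)) (lift k x \<otimes>\<^bsub>A\<^esub> lift k y)) \<longlonglongrightarrow> 0"
proof -
  let ?a = "lift k x" and ?b = "lift k y"
  let ?e = "\<lambda>n. F.dst n (conn n k x) (\<psi> n ?a) * nrm (F k) y + nrm A ?a * F.dst n (conn n k y) (\<psi> n ?b)
      + A.dst (\<phi> n (\<psi> n ?a \<otimes>\<^bsub>F n\<^esub> \<psi> n ?b)) (?a \<otimes>\<^bsub>A\<^esub> ?b)"
  have ab: "?a \<in> carrier A" "?b \<in> carrier A"
    using x y by simp_all
  have le: "A.dst (\<phi> n (conn_mult k x y n)) (?a \<otimes>\<^bsub>A\<^esub> ?b) \<le> ?e n" if n: "k \<le> n" for n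
  proof -
    have cx: "conn n k x \<in> carrier (F n)" and cy: "conn n k y \<in> carrier (F n)"
      using n x y by simp_all
    have "A.dst (\<phi> n (conn_mult k x y n)) (\<phi> n (\<psi> n ?a \<otimes>\<^bsub>F n\<^esub> \<psi> n ?b))
        \<le> F.dst n (conn_mult k x y n) (\<psi> n ?a \<otimes>\<^bsub>F n\<^esub> \<psi> n ?b)"
      using cx cy ab by (intro \<phi>.contractive_minus) simp_all
    also have "\<dots> \<le> F.dst n (conn n k x) (\<psi> n ?a) * nrm (F n) (conn n k y)
        + nrm (F n) (\<psi> n ?a) * F.dst n (conn n k y) (\<psi> n ?b)"
      using cx cy ab by (intro F.nrm_mult_diff) simp_all
    also have "\<dots> \<le> F.dst n (conn n k x) (\<psi> n ?a) * nrm (F k) y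
        + nrm A ?a * F.dst n (conn n k y) (\<psi> n ?b)"
      using cx cy ab n y
      by (intro add_mono mult_left_mono mult_right_mono conn_le \<psi>.contractive) simp_all
    finally have "A.dst (\<phi> n (conn_mult k x y n)) (\<phi> n (\<psi> n ?a \<otimes>\<^bsub>F n\<^esub> \<psi> n ?b))
        \<le> F.dst n (conn n k x) (\<psi> n ?a) * nrm (F k) y
        + nrm A ?a * F.dst n (conn n k y) (\<psi> n ?b)" .
    moreover have "A.dst (\<phi> n (conn_mult k x y n)) (?a \<otimes>\<^bsub>A\<^esub> ?b)
        \<le> A.dst (\<phi> n (conn_mult k x y n)) (\<phi> n (\<psi> n ?a \<otimes>\<^bsub>F n\<^esub> \<psi> n ?b))
        + A.dst (\<phi> n (\<psi> n ?a \<otimes>\<^bsub>F n\<^esub> \<psi> n ?b)) (?a \<otimes>\<^bsub>A\<^esub> ?b)"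
      using cx cy ab by (intro A.nrm_diff_triangle) simp_all
    ultimately show ?thesis
      by linarith
  qed
  have lim: "?e \<longlonglongrightarrow> 0"
    by (intro tendsto_add_zero tendsto_mult_left_zero tendsto_mult_right_zero conn_lift_lim x y
        approx_mult ab)
  show ?thesis
    by (rule LIMSEQ_zero_squeeze[where k = k, OF lim _ le]) (use x y in simp)
qed

lemma conn_mult_nrm:
  assumes "x \<in> carrier (F k)" "y \<in> carrier (F k)" "k \<le> n"
  shows "nrm (F n) (conn_mult k x y n) \<le> nrm (F k) x * nrm (F k) y"
proof -
  have "nrm (F n) (conn_mult k x y n) \<le> nrm (F n) (conn n k x) * nrm (F n) (conn n k y)"
    using assms by (intro F.nrm_mult) simp_all
  also have "\<dots> \<le> nrm (F k) x * nrm (F k) y"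
    using assms by (intro mult_mono conn_le) simp_all
  finally show ?thesis .
qed

text \<open>This is the defining formula of the limit product, read in \<open>A\<close>. The lift
  from \<open>F n\<close> differs from \<open>\<phi> n\<close> by \<open>tail n\<close> times a norm
  that is bounded in \<open>n\<close>.\<close>

lemma lift_mult_lim:
  assumes x: "x \<in> carrier (F k)" and y: "y \<in> carrier (F k)"
  shows "(\<lambda>n. A.dst (lift n (conn_mult k x y n)) (lift k x \<otimes>\<^bsub>A\<^esub> lift k y)) \<longlonglongrightarrow> 0"
proof -
  let ?ab = "lift k x \<otimes>\<^bsub>A\<^esub> lift k y"
  let ?z = "\<lambda>n. conn_mult k x y n"
  have z: "?z n \<in> carrier (F n)" if "k \<le> n" for n
    using that x y by simp
  have ab: "?ab \<in> carrier A"
    using x y by simp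
  have le: "A.dst (lift n (?z n)) ?ab \<le> tail n * (nrm (F k) x * nrm (F k) y) + A.dst (\<phi> n (?z n)) ?ab"
    if n: "k \<le> n" for n
  proof -
    have "A.dst (lift n (?z n)) ?ab \<le> A.dst (lift n (?z n)) (\<phi> n (?z n)) + A.dst (\<phi> n (?z n)) ?ab"
      using z[OF n] ab by (intro A.nrm_diff_triangle) simp_all
    moreover have "A.dst (lift n (?z n)) (\<phi> n (?z n)) \<le> tail n * nrm (F n) (?z n)"
      using lift_bound_self[OF z[OF n]] A.nrm_minus_commute[OF lift_in[OF z[OF n]] \<phi>.closed[OF z[OF n]]]
      by simp
    moreover have "\<dots> \<le> tail n * (nrm (F k) x * nrm (F k) y)"
      by (intro mult_left_mono conn_mult_nrm x y n tail_nonneg)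
    ultimately show ?thesis
      by linarith
  qed
  have lim: "(\<lambda>n. tail n * (nrm (F k) x * nrm (F k) y) + A.dst (\<phi> n (?z n)) ?ab) \<longlonglongrightarrow> 0"
    by (intro tendsto_add_zero tail_scaled conn_mult_lim x y)
  show ?thesis
    by (rule LIMSEQ_zero_squeeze[where k = k, OF lim _ le]) (use z ab in simp)
qed

lemma cpc_step: "cpc (F n) (F (Suc n)) (\<rho> n)"
proof -
  have "linear_map (F n) (F (Suc n)) (\<rho> n)"
    by (simp add: linear_map_def \<rho>_def \<phi>.add \<phi>.smult \<psi>.add \<psi>.smult)
  moreover have "positive_matrix k (F (Suc n)) (amplification k (\<rho> n) X)"
    if "positive_matrix k (F n) X" for k X
  proof -
    have "positive_matrix k (F (Suc n)) (amplification k (\<psi> (Suc n)) (amplification k (\<phi> n) X))"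
      using that cpc_up[of n] cpc_down[of "Suc n"] by (simp add: cpc_def completely_positive_def)
    moreover have "amplification k (\<psi> (Suc n)) (amplification k (\<phi> n) X) = amplification k (\<rho> n) X"
      by (auto simp: amplification_def \<rho>_def restrict_def)
    ultimately show ?thesis
      by simp
  qed
  moreover have "nrm (F (Suc n)) (\<rho> n x) \<le> nrm (F n) x" if "x \<in> carrier (F n)" for x
    using \<psi>.contractive[of "\<phi> n x" "Suc n"] \<phi>.contractive[OF that] that by (simp add: \<rho>_def)
  ultimately show ?thesis
    by (simp add: cpc_def completely_positive_def)
qed

text \<open>All \<open>conn m n (?z n)\<close> with \<open>m > n\<close> lie within
  \<open>?g n\<close> of \<open>\<psi> m ?ab\<close>, a bound independent of \<open>m\<close>; two
  indices \<open>n\<close> and \<open>i\<close> are compared through this common reference.\<close>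

theorem encoding: "cstar_encoding_system F \<rho>"
proof (intro cstar_encoding_system.intro cpc_system.intro cstar_encoding_system_axioms.intro cstar_F cpc_step)
  fix k x y and e :: real
  assume x: "x \<in> carrier (F k)" and y: "y \<in> carrier (F k)" and "0 < e"
  let ?ab = "lift k x \<otimes>\<^bsub>A\<^esub> lift k y"
  let ?z = "\<lambda>n. conn_mult k x y n"
  let ?g = "\<lambda>n. tail n * (nrm (F k) x * nrm (F k) y) + A.dst (\<phi> n (?z n)) ?ab"
  have ab: "?ab \<in> carrier A"
    using x y by simp
  have "?g \<longlonglongrightarrow> 0"
    by (intro tendsto_add_zero tail_scaled conn_mult_lim x y)
  then obtain M where M: "\<And>n. n \<ge> M \<Longrightarrow> ?g n < e / 2"
    using LIMSEQ_zero_less[of ?g "e / 2"] \<open>0 < e\<close> by auto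
  have near: "F.dst m (conn m n (?z n)) (\<psi> m ?ab) \<le> ?g n" if "k \<le> n" "n < m" for m n
  proof -
    \<comment> \<open>Splitting off the last step \<open>\<psi> m \<circ> \<phi> l\<close> moves the
      comparison with \<open>\<psi> m ?ab\<close> into \<open>A\<close>; this is where
      \<open>n < m\<close> enters.\<close>
    obtain l where l: "m = Suc l" "n \<le> l"
      using \<open>n < m\<close> by (cases m) auto
    have z: "?z n \<in> carrier (F n)"
      using that x y by simp
    have "F.dst m (\<psi> m (\<phi> l (conn l n (?z n)))) (\<psi> m ?ab) \<le> A.dst (\<phi> l (conn l n (?z n))) ?ab"
      using z l(2) ab by (intro \<psi>.contractive_minus) simp_all
    also have "\<dots> \<le> A.dst (\<phi> l (conn l n (?z n))) (\<phi> n (?z n)) + A.dst (\<phi> n (?z n)) ?ab"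
      using z l(2) ab by (intro A.nrm_diff_triangle) simp_all
    also have "A.dst (\<phi> l (conn l n (?z n))) (\<phi> n (?z n)) \<le> tail n * nrm (F n) (?z n)"
      using tail_bound[OF order_refl l(2) z] by (simp add: connecting_self)
    also have "\<dots> \<le> tail n * (nrm (F k) x * nrm (F k) y)"
      by (intro mult_left_mono conn_mult_nrm x y that tail_nonneg)
    finally show ?thesis
      using l by (simp add: conn_Suc del: connecting.simps)
  qed
  \<comment> \<open>The threshold has to exceed \<open>k\<close> as well, hence
    \<open>max M (Suc k)\<close>.\<close>
  have "F.dst m (conn m n (?z n)) (conn m i (?z i)) < e"
    if "max M (Suc k) < n" "max M (Suc k) < i" "max n i < m" for m n i
  proof -
    have c: "conn m n (?z n) \<in> carrier (F m)" "conn m i (?z i) \<in> carrier (F m)" "\<psi> m ?ab \<in> carrier (F m)"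
      using that x y ab by simp_all
    have "F.dst m (conn m n (?z n)) (conn m i (?z i))
        \<le> F.dst m (conn m n (?z n)) (\<psi> m ?ab) + F.dst m (\<psi> m ?ab) (conn m i (?z i))"
      by (rule F.nrm_diff_triangle[OF c(1,3,2)])
    then show ?thesis
      using near[of n m] near[of i m] M[of n] M[of i] F.nrm_minus_commute[OF c(2,3)] that by simp
  qed
  then show "\<exists>M>k. \<forall>m n i. M < n \<and> M < i \<and> max n i < m \<longrightarrow>
      F.dst m (conn m n (?z n)) (conn m i (?z i)) < e"
    by (intro exI[of _ "max M (Suc k)"]) auto
qed

section \<open>The product of the C*-limit\<close>

definition \<Psi>_inv :: "(nat \<Rightarrow> 'b) set \<Rightarrow> 'a" where
  "\<Psi>_inv = inv_into (carrier A) \<Psi>"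

lemma \<Psi>_inv [simp]: "a \<in> carrier A \<Longrightarrow> \<Psi>_inv (\<Psi> a) = a"
  by (simp add: \<Psi>_inv_def inv_into_f_f[OF \<Psi>_inj])

text \<open>Provides the witness behind the choice in \<open>limit_product\<close>. The limit
  formula is \<open>lift_mult_lim\<close> carried over by \<open>\<Psi>\<close>, and the bound holds
  with constant 1 because \<open>\<Psi>\<close> is isometric.\<close>

lemma transported_product: "is_limit_product F \<rho> (\<lambda>X Y. \<Psi> (\<Psi>_inv X \<otimes>\<^bsub>A\<^esub> \<Psi>_inv Y))"
  (is "is_limit_product F \<rho> ?p")
proof -
  have p: "?p (\<Psi> a) (\<Psi> b) = \<Psi> (a \<otimes>\<^bsub>A\<^esub> b)" if "a \<in> carrier A" "b \<in> carrier A" for a b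
    using that by simp
  have lim: "limitin (norm_topology Q) (\<lambda>n. limit_map F \<rho> n (conn_mult k x y n))
      (?p (limit_map F \<rho> k x) (limit_map F \<rho> k y)) sequentially"
    if x: "x \<in> carrier (F k)" and y: "y \<in> carrier (F k)" for k x y
  proof -
    have "limitin Q.mtopology (\<lambda>n. \<Psi> (lift n (conn_mult k x y n))) (\<Psi> (lift k x \<otimes>\<^bsub>A\<^esub> lift k y)) sequentially"
    proof (rule \<Psi>_limitin[OF _ _ lift_mult_lim[OF x y]])
      show "\<forall>\<^sub>F n in sequentially. lift n (conn_mult k x y n) \<in> carrier A"
        using eventually_ge_at_top[of k] by eventually_elim (use x y in simp)
    qed (use x y in simp)
    moreover have "\<forall>\<^sub>F n in sequentially. \<Psi> (lift n (conn_mult k x y n))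
        = limit_map F \<rho> n (conn_mult k x y n)"
      using eventually_ge_at_top[of k]
    proof eventually_elim
      case (elim n)
      then show ?case
        using x y by (intro limit_map_eq[symmetric]) simp
    qed
    ultimately show ?thesis
      using x y unfolding norm_topology_def
      by (subst limit_map_eq[OF x], subst limit_map_eq[OF y], subst p) (auto elim: limitin_transform_eventually[rotated])
  qed
  have bound: "\<exists>K. \<forall>X\<in>\<Psi> ` carrier A. \<forall>Y\<in>\<Psi> ` carrier A. nrm Q (?p X Y) \<le> K * nrm Q X * nrm Q Y"
    by (rule exI[of _ 1]) (simp add: \<Psi>_nrm A.nrm_mult)
  show ?thesis
    unfolding is_limit_product_def Let_def system_limit_eq
    by (intro conjI allI ballI lim bound)
      (auto simp: A.mult_add_left A.mult_add_right A.mult_smult_left A.mult_smult_right A.mult_assoc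
        simp flip: \<Psi>_add \<Psi>_smult)
qed

text \<open>Both sides of the claim are continuous in \<open>(a, b)\<close> and agree for \<open>a\<close>, \<open>b\<close> of the form
  \<open>lift n x\<close>.\<close>

lemma limit_product_unique:
  assumes "is_limit_product F \<rho> p" and a: "a \<in> carrier A" and b: "b \<in> carrier A"
  shows "p (\<Psi> a) (\<Psi> b) = \<Psi> (a \<otimes>\<^bsub>A\<^esub> b)"
proof -
  note p = assms(1)[unfolded is_limit_product_def Let_def system_limit_eq]
  have p_in: "p X Y \<in> \<Psi> ` carrier A" if "X \<in> \<Psi> ` carrier A" "Y \<in> \<Psi> ` carrier A" for X Y
    by (rule p[THEN conjunct1, THEN bspec, THEN bspec, OF that])
  have p_addl: "p (X \<oplus>\<^bsub>Q\<^esub> Y) Z = p X Z \<oplus>\<^bsub>Q\<^esub> p Y Z"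
    if "X \<in> \<Psi> ` carrier A" "Y \<in> \<Psi> ` carrier A" "Z \<in> \<Psi> ` carrier A" for X Y Z
    by (rule p[THEN conjunct2, THEN conjunct1, THEN bspec, THEN bspec, THEN bspec, OF that])
  have p_addr: "p X (Y \<oplus>\<^bsub>Q\<^esub> Z) = p X Y \<oplus>\<^bsub>Q\<^esub> p X Z"
    if "X \<in> \<Psi> ` carrier A" "Y \<in> \<Psi> ` carrier A" "Z \<in> \<Psi> ` carrier A" for X Y Z
    by (rule p[THEN conjunct2, THEN conjunct2, THEN conjunct1, THEN bspec, THEN bspec, THEN bspec, OF that])
  note p_bound = p[THEN conjunct2, THEN conjunct2, THEN conjunct2, THEN conjunct2, THEN conjunct2, THEN conjunct1]
  note p_lim = p[THEN conjunct2, THEN conjunct2, THEN conjunct2, THEN conjunct2, THEN conjunct2,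
      THEN conjunct2, THEN conjunct2, rule_format]
  \<comment> \<open>The product \<open>p\<close> read in \<open>A\<close>, where convergence can be
    argued with a single norm.\<close>
  define q where "q a b = \<Psi>_inv (p (\<Psi> a) (\<Psi> b))" for a b
  have q: "q a b \<in> carrier A" "p (\<Psi> a) (\<Psi> b) = \<Psi> (q a b)" if ab: "a \<in> carrier A" "b \<in> carrier A" for a b
  proof -
    obtain c where c: "c \<in> carrier A" "p (\<Psi> a) (\<Psi> b) = \<Psi> c"
      using p_in[OF imageI[OF ab(1)] imageI[OF ab(2)]] by (rule imageE)
    then show "q a b \<in> carrier A" "p (\<Psi> a) (\<Psi> b) = \<Psi> (q a b)"
      by (simp_all add: q_def)
  qed
  have \<Psi>_eqD: "x = y" if "\<Psi> x = \<Psi> y" "x \<in> carrier A" "y \<in> carrier A" for x y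
    using \<Psi>_inj that by (auto dest: inj_onD)
  have addl: "q (a \<oplus>\<^bsub>A\<^esub> c) b = q a b \<oplus>\<^bsub>A\<^esub> q c b"
    if "a \<in> carrier A" "b \<in> carrier A" "c \<in> carrier A" for a b c
  proof (rule \<Psi>_eqD)
    have "p (\<Psi> a \<oplus>\<^bsub>Q\<^esub> \<Psi> c) (\<Psi> b) = p (\<Psi> a) (\<Psi> b) \<oplus>\<^bsub>Q\<^esub> p (\<Psi> c) (\<Psi> b)"
      by (intro p_addl imageI that)
    then show "\<Psi> (q (a \<oplus>\<^bsub>A\<^esub> c) b) = \<Psi> (q a b \<oplus>\<^bsub>A\<^esub> q c b)"
      using that by (simp only: q(2)[symmetric] \<Psi>_add q(1) A.add.m_closed)
  qed (use that q in simp_all)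
  have addr: "q b (a \<oplus>\<^bsub>A\<^esub> c) = q b a \<oplus>\<^bsub>A\<^esub> q b c"
    if "a \<in> carrier A" "b \<in> carrier A" "c \<in> carrier A" for a b c
  proof (rule \<Psi>_eqD)
    have "p (\<Psi> b) (\<Psi> a \<oplus>\<^bsub>Q\<^esub> \<Psi> c) = p (\<Psi> b) (\<Psi> a) \<oplus>\<^bsub>Q\<^esub> p (\<Psi> b) (\<Psi> c)"
      by (intro p_addr imageI that)
    then show "\<Psi> (q b (a \<oplus>\<^bsub>A\<^esub> c)) = \<Psi> (q b a \<oplus>\<^bsub>A\<^esub> q b c)"
      using that by (simp only: q(2)[symmetric] \<Psi>_add q(1) A.add.m_closed)
  qed (use that q in simp_all)
  obtain K where K: "nrm A (q a b) \<le> K * nrm A a * nrm A b" if "a \<in> carrier A" "b \<in> carrier A" for a b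
  proof -
    obtain K where "\<forall>X\<in>\<Psi> ` carrier A. \<forall>Y\<in>\<Psi> ` carrier A. nrm Q (p X Y) \<le> K * nrm Q X * nrm Q Y"
      using p_bound by blast
    then have "nrm A (q a b) \<le> K * nrm A a * nrm A b" if "a \<in> carrier A" "b \<in> carrier A" for a b
      using that by (simp add: q \<Psi>_nrm)
    then show thesis
      using that by blast
  qed
  have lifts: "q (lift k x) (lift k y) = lift k x \<otimes>\<^bsub>A\<^esub> lift k y"
    if x: "x \<in> carrier (F k)" and y: "y \<in> carrier (F k)" for k x y
  proof (rule \<Psi>_eqD)
    have "limitin Q.mtopology (\<lambda>n. limit_map F \<rho> n (conn_mult k x y n))
      (p (limit_map F \<rho> k x) (limit_map F \<rho> k y)) sequentially"
      using p_lim[OF x y] by (simp only: norm_topology_def)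
    moreover have "limitin Q.mtopology (\<lambda>n. limit_map F \<rho> n (conn_mult k x y n))
      (\<Psi> (\<Psi>_inv (limit_map F \<rho> k x) \<otimes>\<^bsub>A\<^esub> \<Psi>_inv (limit_map F \<rho> k y))) sequentially"
      using transported_product x y by (simp add: is_limit_product_def Let_def norm_topology_def)
    ultimately have "p (limit_map F \<rho> k x) (limit_map F \<rho> k y)
        = \<Psi> (\<Psi>_inv (limit_map F \<rho> k x) \<otimes>\<^bsub>A\<^esub> \<Psi>_inv (limit_map F \<rho> k y))"
      by (rule Q.limitin_metric_unique) simp
    then show "\<Psi> (q (lift k x) (lift k y)) = \<Psi> (lift k x \<otimes>\<^bsub>A\<^esub> lift k y)"
      using x y by (simp add: limit_map_eq q)
  qed (use x y q in simp_all)
  \<comment> \<open>Both approximants come from the same \<open>F n\<close>, since the limit formula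
    determines \<open>p\<close> only on two elements of a common index.\<close>
  define a' where "a' n = lift n (\<psi> n a)" for n
  define b' where "b' n = lift n (\<psi> n b)" for n
  have in_A: "a' n \<in> carrier A" "b' n \<in> carrier A" for n
    using a b by (simp_all add: a'_def b'_def)
  have a'_lim: "A.up.tends (\<lambda>n. A.emb (a' n)) (A.emb a)"
    using lift_\<psi>_lim[OF a] in_A a by (simp add: A.tends_emb_iff a'_def)
  have b'_lim: "A.up.tends (\<lambda>n. A.emb (b' n)) (A.emb b)"
    using lift_\<psi>_lim[OF b] in_A b by (simp add: A.tends_emb_iff b'_def)
  have prod: "A.up.tends (\<lambda>n. A.emb (q (a' n) (b' n))) (A.emb a * A.emb b)"
  proof -
    have "A.emb (q (a' n) (b' n)) = A.emb (a' n) * A.emb (b' n)" for n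
      using lifts[of "\<psi> n a" n "\<psi> n b"] a b in_A by (simp add: A.emb_mult a'_def b'_def)
    then show ?thesis
      using A.up.tends_mult[OF a'_lim b'_lim] by simp
  qed
  have "A.up.tends (\<lambda>n. A.emb (q (a' n) (b' n))) (A.emb (q a b))"
  proof (rule A.up.tends_bound)
    fix n
    let ?c = "a' n \<ominus>\<^bsub>A\<^esub> a" and ?d = "b' n \<ominus>\<^bsub>A\<^esub> b"
    have cd: "?c \<in> carrier A" "?d \<in> carrier A"
      using a b in_A by simp_all
    have split: "a' n = ?c \<oplus>\<^bsub>A\<^esub> a" "b' n = ?d \<oplus>\<^bsub>A\<^esub> b"
      using a b in_A[of n] by (simp_all add: a_minus_def A.a_assoc A.l_neg)
    \<comment> \<open>Biadditivity splits the error into two terms, each with one small argument, to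
      which the bound \<open>K\<close> applies.\<close>
    have "q (a' n) (b' n) = q ?c (b' n) \<oplus>\<^bsub>A\<^esub> (q a ?d \<oplus>\<^bsub>A\<^esub> q a b)"
    proof -
      have "q (a' n) (b' n) = q (?c \<oplus>\<^bsub>A\<^esub> a) (b' n)"
        by (simp only: split(1)[symmetric])
      also have "\<dots> = q ?c (b' n) \<oplus>\<^bsub>A\<^esub> q a (b' n)"
        by (intro addl cd a in_A)
      also have "q a (b' n) = q a (?d \<oplus>\<^bsub>A\<^esub> b)"
        by (simp only: split(2)[symmetric])
      also have "\<dots> = q a ?d \<oplus>\<^bsub>A\<^esub> q a b"
        by (intro addr cd a b)
      finally show ?thesis .
    qed
    then have "A.emb (q (a' n) (b' n)) - A.emb (q a b) = A.emb (q ?c (b' n)) + A.emb (q a ?d)"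
      using cd a b in_A by (simp add: A.emb_add q)
    then have "A.upnorm (A.emb (q (a' n) (b' n)) - A.emb (q a b)) \<le> nrm A (q ?c (b' n)) + nrm A (q a ?d)"
      using A.up.N_add[of "A.emb (q ?c (b' n))" "A.emb (q a ?d)"] cd a b in_A by (simp add: q)
    also have "\<dots> \<le> K * nrm A ?c * nrm A (b' n) + K * nrm A a * nrm A ?d"
      by (intro add_mono K cd a b in_A)
    finally show "A.upnorm (A.emb (q (a' n) (b' n)) - A.emb (q a b))
        \<le> K * nrm A ?c * nrm A (b' n) + K * nrm A a * nrm A ?d" .
  next
    have "(\<lambda>n. A.dst (a' n) a) \<longlonglongrightarrow> 0" "(\<lambda>n. A.dst (b' n) b) \<longlonglongrightarrow> 0"
      using lift_\<psi>_lim a b by (simp_all add: a'_def b'_def)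
    moreover have "(\<lambda>n. nrm A (b' n)) \<longlonglongrightarrow> nrm A b"
      using A.up.tends_N[OF b'_lim] in_A b by simp
    ultimately have "(\<lambda>n. K * A.dst (a' n) a * nrm A (b' n) + K * nrm A a * A.dst (b' n) b)
        \<longlonglongrightarrow> K * 0 * nrm A b + K * nrm A a * 0"
      by (intro tendsto_add tendsto_mult tendsto_const)
    then show "(\<lambda>n. K * A.dst (a' n) a * nrm A (b' n) + K * nrm A a * A.dst (b' n) b) \<longlonglongrightarrow> 0"
      by simp
  qed
  from A.up.tends_unique[OF this prod] have "A.up.eqv (A.emb (q a b)) (A.emb (a \<otimes>\<^bsub>A\<^esub> b))"
    using a b by (simp add: A.emb_mult)
  then have "q a b = a \<otimes>\<^bsub>A\<^esub> b"
    using a b q by (simp add: A.emb_eqv_iff)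
  then show ?thesis
    using q(2)[OF a b] by simp
qed

lemma limit_product: "is_limit_product F \<rho> (limit_product F \<rho>)"
  unfolding limit_product_def by (rule someI[of "is_limit_product F \<rho>", OF transported_product])

lemma cstar_limit_sel:
  "carrier (cstar_limit F \<rho>) = \<Psi> ` carrier A" "mult (cstar_limit F \<rho>) = limit_product F \<rho>"
  "add (cstar_limit F \<rho>) = add Q" "zero (cstar_limit F \<rho>) = zero Q"
  "smult (cstar_limit F \<rho>) = smult Q" "adj (cstar_limit F \<rho>) = adj Q" "nrm (cstar_limit F \<rho>) = nrm Q"
  by (simp_all add: cstar_limit_def system_limit_eq)

lemma \<Psi>_mult: "\<lbrakk>a \<in> carrier A; b \<in> carrier A\<rbrakk> \<Longrightarrow> limit_product F \<rho> (\<Psi> a) (\<Psi> b) = \<Psi> (a \<otimes>\<^bsub>A\<^esub> b)"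
  by (rule limit_product_unique[OF limit_product])

lemma \<Psi>_bij: "bij_betw \<Psi> (carrier A) (carrier (cstar_limit F \<rho>))"
  by (simp add: bij_betw_def \<Psi>_inj cstar_limit_sel)

theorem cstar_algebra_limit: "cstar_algebra (cstar_limit F \<rho>)"
  by (rule cstar_algebra_transport[OF A.cstar_algebra_axioms \<Psi>_bij])
    (simp_all add: cstar_limit_sel \<Psi>_add \<Psi>_zero \<Psi>_smult \<Psi>_mult \<Psi>_adj \<Psi>_nrm)

text \<open>An arbitrary \<open>f\<close> is allowed because \<open>inv_into\<close> composed with
  \<open>\<Psi>\<close> is known to agree with \<open>\<Psi>\<close> on the carrier only.\<close>

theorem star_isomorphism_limit:
  assumes "\<And>a. a \<in> carrier A \<Longrightarrow> f a = \<Psi> a"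
  shows "star_isomorphism A (cstar_limit F \<rho>) f"
proof -
  have "bij_betw f (carrier A) (carrier (cstar_limit F \<rho>))"
    using \<Psi>_bij assms bij_betw_cong by blast
  then show ?thesis
    unfolding star_isomorphism_def linear_map_def
    by (auto simp: assms cstar_limit_sel \<Psi>_add \<Psi>_smult \<Psi>_mult \<Psi>_adj)
qed

end

theorem theorem4p5:
  fixes A :: "'a cstar" and F :: "nat \<Rightarrow> 'b cstar"
    and \<psi> :: "nat \<Rightarrow> 'a \<Rightarrow> 'b" and \<phi> :: "nat \<Rightarrow> 'b \<Rightarrow> 'a"
  assumes "summable_cpc_approximations A F \<psi> \<phi>"
  shows "let \<rho> = (\<lambda>n. \<psi> (Suc n) \<circ> \<phi> n);
             L = system_limit F \<rho>;
             CL = cstar_limit F \<rho>;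
             \<Psi> = (\<lambda>a. seq_class F (\<lambda>n. \<psi> n a));
             \<Theta> = (\<lambda>X. X)
         in cstar_encoding_system F \<rho> \<and>
            is_limit_product F \<rho> (mult CL) \<and>
            cstar_algebra CL \<and>
            \<Psi> ` carrier A \<subseteq> \<Theta> ` L \<and>
            star_isomorphism A CL (inv_into L \<Theta> \<circ> \<Psi>)"
proof -
  interpret S: summable_cpc_approximations A F \<psi> \<phi>
    by fact
  have \<rho>: "(\<lambda>n. \<psi> (Suc n) \<circ> \<phi> n) = S.\<rho>"
    by (rule ext) (simp add: S.\<rho>_def)
  have \<Psi>: "(\<lambda>a. seq_class F (\<lambda>n. \<psi> n a)) = S.\<Psi>"
    by (rule ext) (simp add: S.\<Psi>_def)
  have L: "S.\<Psi> ` carrier A = system_limit F S.\<rho>"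
    by (simp add: S.system_limit_eq)
  have "(inv_into (system_limit F S.\<rho>) (\<lambda>X. X) \<circ> S.\<Psi>) a = S.\<Psi> a" if "a \<in> carrier A" for a
    using f_inv_into_f[of "S.\<Psi> a" "\<lambda>X. X" "system_limit F S.\<rho>"] that by (simp flip: L)
  then have "star_isomorphism A (cstar_limit F S.\<rho>) (inv_into (system_limit F S.\<rho>) (\<lambda>X. X) \<circ> S.\<Psi>)"
    by (rule S.star_isomorphism_limit)
  moreover have "is_limit_product F S.\<rho> (mult (cstar_limit F S.\<rho>))"
    using S.limit_product by (simp add: S.cstar_limit_sel)
  ultimately show ?thesis
    unfolding Let_def \<rho> \<Psi> using S.encoding S.cstar_algebra_limit L by auto
qed

end
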